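(* Let $(A(u))$, $u\in\mathbb{R}^n$, be a measurable family of real $n\times n$ matrices which, where defined, are self-adjoint and commute with each other, and let each matrix $A(u)$ be positive definite. Fix an orthogonal matrix $C$ with $C^{-1}A(u)C=\mathrm{diag}(a_1(u),\dots,a_n(u))$ for all $u$ for which $A(u)$ is defined. Assume that the system of equations $a_k(u)=e^{t_k}$, $k=1,\dots,n$, has a unique solution $u=b(t)=(b_1(t),\dots,b_n(t))$ for almost every $t=(t_1,\dots,t_n)\in\mathbb{R}^n$, so that one has a measurable map $b:\mathbb{R}^n\to\mathbb{R}^n$ which is almost bijective. Let $K$ be a locally Lebesgue integrable function on $\mathbb{R}^n$ such that $A(u)$ is defined for almost every $u$ in the support of $K$ and $|\det A(u)|^{-1/2}K(u)\in L^1(\mathbb{R}^n)$. If a function $F$ is holomorphic in a neighborhood $E$ of the spectrum $\sigma(\mathcal{H}_{K,A})$ of the Hausdorff operator $\mathcal{H}_{K,A}$ in $L^2(\mathbb{R}^n)$ and $F(0)=0$, then $F(\mathcal{H}_{K,A})$ is also a Hausdorff operator of the form $\mathcal{H}_{K_F,A}$ (with some kernel $K_F$ and the same family $A$) bounded in $L^2(\mathbb{R}^n)$.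
   Context: For a locally Lebesgue integrable function $K$ on $\mathbb{R}^n$ such that $A(u)$ is defined and $\det A(u)\neq0$ for almost every $u$ in the support of $K$, the Hausdorff operator with kernel $K$ is $\mathcal{H}_{K,A}f(x)=\int_{\mathbb{R}^n}K(u)f(A(u)x)\,du$, where $x\in\mathbb{R}^n$ is a column vector. The condition $|\det A(u)|^{-1/2}K(u)\in L^1(\mathbb{R}^n)$ guarantees that it is bounded on $L^2(\mathbb{R}^n)$. The numbers $a_1(u),\dots,a_n(u)$ are the eigenvalues of $A(u)$ with multiplicities. The operator $F(\mathcal{H}_{K,A})$ is defined by the holomorphic functional calculus, $$F(\mathcal{H}_{K,A})=\frac{1}{2\pi i}\int_\Gamma F(\lambda)(\lambda-\mathcal{H}_{K,A})^{-1}\,d\lambda,$$ where $\Gamma$ is the boundary of any open neighborhood of $\sigma(\mathcal{H}_{K,A})$ whose closure is contained in $E$.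
   Formalization: "Almost bijective" is taken to include that b and its inverse carry null sets to null sets, and the kernel K_F is shown to satisfy |det A(u)|^{-1/2} K_F(u) in L^1 but not to be locally integrable; without these two changes the claim fails. *)

theory Defs
  imports "HOL-Complex_Analysis.Complex_Analysis"
begin

section \<open>The complex Hilbert space \<open>L\<^sup>2\<close> over Lebesgue measure\<close>

definition square_integrable :: "('a::euclidean_space \<Rightarrow> complex) \<Rightarrow> bool" where
  "square_integrable f \<longleftrightarrow>
     f \<in> borel_measurable lebesgue \<and> integrable lebesgue (\<lambda>x. (norm (f x))\<^sup>2)"

lemma square_integrable_measurable [measurable_dest]:
  "square_integrable f \<Longrightarrow> f \<in> borel_measurable lebesgue"
  by (simp add: square_integrable_def)

lemma square_integrable_zero [simp]: "square_integrable (\<lambda>x. 0)"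
  by (simp add: square_integrable_def)

lemma square_integrable_mult:
  assumes "square_integrable f"
  shows "square_integrable (\<lambda>x. c * f x)"
  using assms by (auto simp: square_integrable_def norm_mult power_mult_distrib)

lemma square_integrable_add:
  assumes "square_integrable f" "square_integrable g"
  shows "square_integrable (\<lambda>x. f x + g x)"
proof -
  have [measurable]: "f \<in> borel_measurable lebesgue" "g \<in> borel_measurable lebesgue"
    using assms by (auto simp: square_integrable_def)
  have "integrable lebesgue (\<lambda>x. 2 * (norm (f x))\<^sup>2 + 2 * (norm (g x))\<^sup>2)"
    using assms by (auto simp: square_integrable_def)
  moreover have "(norm (f x + g x))\<^sup>2 \<le> 2 * (norm (f x))\<^sup>2 + 2 * (norm (g x))\<^sup>2" for x
  proof -
    have "(norm (f x + g x))\<^sup>2 \<le> (norm (f x) + norm (g x))\<^sup>2"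
      by (intro power_mono norm_triangle_ineq) auto
    also have "\<dots> \<le> 2 * (norm (f x))\<^sup>2 + 2 * (norm (g x))\<^sup>2"
      using sum_squares_bound[of "norm (f x)" "norm (g x)"]
      by (simp add: power2_sum)
    finally show ?thesis .
  qed
  ultimately have "integrable lebesgue (\<lambda>x. (norm (f x + g x))\<^sup>2)"
    by (auto intro: Bochner_Integration.integrable_bound)
  then show ?thesis
    by (simp add: square_integrable_def)
qed

lemma square_integrable_inner:
  assumes "square_integrable f" "square_integrable g"
  shows "integrable lebesgue (\<lambda>x. f x \<bullet> g x)"
proof -
  have [measurable]: "f \<in> borel_measurable lebesgue" "g \<in> borel_measurable lebesgue"
    using assms by (auto simp: square_integrable_def)
  have "integrable lebesgue (\<lambda>x. (norm (f x))\<^sup>2 + (norm (g x))\<^sup>2)"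
    using assms by (auto simp: square_integrable_def)
  moreover have "norm (f x \<bullet> g x) \<le> norm ((norm (f x))\<^sup>2 + (norm (g x))\<^sup>2)" for x
  proof -
    have "\<bar>f x \<bullet> g x\<bar> \<le> norm (f x) * norm (g x)"
      by (rule Cauchy_Schwarz_ineq2)
    moreover have "2 * (norm (f x) * norm (g x)) \<le> (norm (f x))\<^sup>2 + (norm (g x))\<^sup>2"
      using sum_squares_bound[of "norm (f x)" "norm (g x)"] by (simp add: mult.assoc)
    moreover have "0 \<le> norm (f x) * norm (g x)"
      by simp
    ultimately show ?thesis
      by simp
  qed
  ultimately show ?thesis
    by (auto intro: Bochner_Integration.integrable_bound)
qed

definition L2_rel :: "('a::euclidean_space \<Rightarrow> complex) \<Rightarrow> ('a \<Rightarrow> complex) \<Rightarrow> bool" where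
  "L2_rel f g \<longleftrightarrow> square_integrable f \<and> square_integrable g \<and> (AE x in lebesgue. f x = g x)"

quotient_type (overloaded) 'a L2 = "'a::euclidean_space \<Rightarrow> complex" / partial: L2_rel
proof (rule part_equivpI)
  show "\<exists>f. L2_rel f (f :: 'a \<Rightarrow> complex)"
    by (rule exI[of _ "\<lambda>x. 0"]) (simp add: L2_rel_def)
  show "symp (L2_rel :: ('a \<Rightarrow> complex) \<Rightarrow> _)"
    by (auto simp: symp_def L2_rel_def elim: eventually_mono)
  show "transp (L2_rel :: ('a \<Rightarrow> complex) \<Rightarrow> _)"
    unfolding transp_def L2_rel_def by (auto elim: eventually_elim2)
qed

text \<open>
  The inner product below is the real part of the usual Hermitian one (\<open>\<bullet>\<close> on \<^typ>\<open>complex\<close>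
  is \<open>Re (z * cnj w)\<close>), so the norm is the usual complex \<open>L\<^sup>2\<close> norm.
\<close>

instantiation L2 :: (euclidean_space) real_inner
begin

lift_definition zero_L2 :: "'a L2" is "\<lambda>x. 0"
  by (simp add: L2_rel_def)

lift_definition plus_L2 :: "'a L2 \<Rightarrow> 'a L2 \<Rightarrow> 'a L2" is "\<lambda>f g x. f x + g x"
  by (auto simp: L2_rel_def square_integrable_add)

lift_definition uminus_L2 :: "'a L2 \<Rightarrow> 'a L2" is "\<lambda>f x. - f x"
  using square_integrable_mult[of _ "-1"] by (auto simp: L2_rel_def)

definition minus_L2 :: "'a L2 \<Rightarrow> 'a L2 \<Rightarrow> 'a L2" where
  "minus_L2 f g = f + (- g)"

lift_definition scaleR_L2 :: "real \<Rightarrow> 'a L2 \<Rightarrow> 'a L2" is "\<lambda>c f x. complex_of_real c * f x"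
  by (auto simp: L2_rel_def square_integrable_mult)

lift_definition inner_L2 :: "'a L2 \<Rightarrow> 'a L2 \<Rightarrow> real" is "\<lambda>f g. LINT x|lebesgue. f x \<bullet> g x"
proof -
  fix f f' g g' :: "'a \<Rightarrow> complex"
  assume "L2_rel f f'" "L2_rel g g'"
  then have *: "square_integrable f" "square_integrable f'" "square_integrable g"
    "square_integrable g'" "AE x in lebesgue. f x = f' x" "AE x in lebesgue. g x = g' x"
    by (auto simp: L2_rel_def)
  show "(LINT x|lebesgue. f x \<bullet> g x) = (LINT x|lebesgue. f' x \<bullet> g' x)"
  proof (rule integral_cong_AE)
    show "AE x in lebesgue. f x \<bullet> g x = f' x \<bullet> g' x"
      using *(5,6) by eventually_elim simp
  qed (use * in \<open>auto intro!: borel_measurable_integrable square_integrable_inner\<close>)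
qed

definition norm_L2 :: "'a L2 \<Rightarrow> real" where
  "norm_L2 f = sqrt (f \<bullet> f)"

definition dist_L2 :: "'a L2 \<Rightarrow> 'a L2 \<Rightarrow> real" where
  "dist_L2 f g = norm (f - g)"

definition sgn_L2 :: "'a L2 \<Rightarrow> 'a L2" where
  "sgn_L2 f = scaleR (inverse (norm f)) f"

definition uniformity_L2 :: "('a L2 \<times> 'a L2) filter" where
  "uniformity_L2 = (INF e\<in>{0 <..}. principal {(f, g). dist f g < e})"

definition open_L2 :: "'a L2 set \<Rightarrow> bool" where
  "open_L2 U \<longleftrightarrow> (\<forall>f\<in>U. eventually (\<lambda>(f', g). f' = f \<longrightarrow> g \<in> U) uniformity)"

instance
proof
  fix f g h :: "'a L2" and c d :: real
  show "f + g + h = f + (g + h)"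
    by transfer (auto simp: L2_rel_def algebra_simps square_integrable_add)
  show "f + g = g + f"
    by transfer (auto simp: L2_rel_def algebra_simps square_integrable_add)
  show "0 + f = f"
    by transfer (auto simp: L2_rel_def)
  show "- f + f = 0"
    by transfer (auto simp: L2_rel_def)
  show "f - g = f + - g"
    by (simp add: minus_L2_def)
  show "c *\<^sub>R (f + g) = c *\<^sub>R f + c *\<^sub>R g"
    by transfer
      (auto simp: L2_rel_def distrib_left intro!: square_integrable_add square_integrable_mult)
  show "(c + d) *\<^sub>R f = c *\<^sub>R f + d *\<^sub>R f"
    by transfer
      (auto simp: L2_rel_def distrib_right intro!: square_integrable_add square_integrable_mult)
  show "c *\<^sub>R d *\<^sub>R f = (c * d) *\<^sub>R f"
    by transfer (auto simp: L2_rel_def mult.assoc intro!: square_integrable_mult)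
  show "1 *\<^sub>R f = f"
    by transfer (auto simp: L2_rel_def)
  show "dist f g = norm (f - g)"
    by (simp add: dist_L2_def)
  show "sgn f = inverse (norm f) *\<^sub>R f"
    by (simp add: sgn_L2_def)
  show "uniformity = (INF e\<in>{0 <..}. principal {(f :: 'a L2, g). dist f g < e})"
    by (simp add: uniformity_L2_def)
  show "open U \<longleftrightarrow> (\<forall>f\<in>U. eventually (\<lambda>(f', g). f' = f \<longrightarrow> g \<in> U) uniformity)"
    for U :: "'a L2 set"
    by (simp add: open_L2_def)
  show "f \<bullet> g = g \<bullet> f"
    by transfer (simp add: inner_commute)
  show "(f + g) \<bullet> h = f \<bullet> h + g \<bullet> h"
    by transfer
      (simp add: L2_rel_def inner_add_left Bochner_Integration.integral_add square_integrable_inner)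
  show "(c *\<^sub>R f) \<bullet> g = c * (f \<bullet> g)"
    by transfer (simp add: scaleR_conv_of_real [symmetric])
  show "0 \<le> f \<bullet> f"
    by transfer simp
  show "f \<bullet> f = 0 \<longleftrightarrow> f = 0"
  proof transfer
    fix f :: "'a \<Rightarrow> complex"
    assume "L2_rel f f"
    then have f: "square_integrable f"
      by (simp add: L2_rel_def)
    have "(LINT x|lebesgue. f x \<bullet> f x) = 0 \<longleftrightarrow> (AE x in lebesgue. f x \<bullet> f x = 0)"
      by (intro integral_nonneg_eq_0_iff_AE square_integrable_inner f) simp
    then show "(LINT x|lebesgue. f x \<bullet> f x) = 0 \<longleftrightarrow> L2_rel f (\<lambda>x. 0)"
      using f by (simp add: L2_rel_def)
  qed
  show "norm f = sqrt (f \<bullet> f)"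
    by (simp add: norm_L2_def)
qed

end

lemma norm_abs_L2:
  assumes "square_integrable f"
  shows "norm (abs_L2 f) = sqrt (LINT x|lebesgue. (norm (f x))\<^sup>2)"
  using assms
  by (simp add: norm_L2_def inner_L2.abs_eq L2_rel_def power2_norm_eq_inner)

lift_definition scaleC_L2 :: "complex \<Rightarrow> 'a::euclidean_space L2 \<Rightarrow> 'a L2" is "\<lambda>c f x. c * f x"
  by (auto simp: L2_rel_def square_integrable_mult)

lemma norm_scaleC_L2: "norm (scaleC_L2 c f) = norm c * norm f"
proof -
  have "scaleC_L2 c f \<bullet> scaleC_L2 c f = (norm c)\<^sup>2 * (f \<bullet> f)"
    by transfer (simp add: power2_norm_eq_inner [symmetric] norm_mult power_mult_distrib)
  then show ?thesis
    by (simp add: norm_L2_def real_sqrt_mult)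
qed

lift_definition scaleC_blinfun :: "complex \<Rightarrow> 'a::euclidean_space L2 \<Rightarrow>\<^sub>L 'a L2" is scaleC_L2
proof
  fix c and f g :: "'a L2" and r :: real
  show "scaleC_L2 c (f + g) = scaleC_L2 c f + scaleC_L2 c g"
    by transfer
      (auto simp: L2_rel_def distrib_left intro!: square_integrable_add square_integrable_mult)
  show "scaleC_L2 c (r *\<^sub>R f) = r *\<^sub>R scaleC_L2 c f"
    by transfer (auto simp: L2_rel_def mult.left_commute intro!: square_integrable_mult)
  show "\<exists>K. \<forall>f :: 'a L2. norm (scaleC_L2 c f) \<le> norm f * K"
    by (auto simp: norm_scaleC_L2 mult.commute intro!: exI[of _ "norm c"])
qed


section \<open>Spectrum and holomorphic functional calculus\<close>

text \<open>
  \<^typ>\<open>'a L2 \<Rightarrow>\<^sub>L 'a L2\<close> consists of the bounded real-linear operators. If \<open>T\<close> is complex-linear then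
  a two-sided inverse of \<open>z - T\<close> is complex-linear as well, so for such \<open>T\<close> the notions below are
  the usual ones for operators on the complex Hilbert space.
\<close>

definition is_resolvent ::
  "('a::euclidean_space L2 \<Rightarrow>\<^sub>L 'a L2) \<Rightarrow> complex \<Rightarrow> ('a L2 \<Rightarrow>\<^sub>L 'a L2) \<Rightarrow> bool" where
  "is_resolvent T z R \<longleftrightarrow>
     (scaleC_blinfun z - T) o\<^sub>L R = id_blinfun \<and> R o\<^sub>L (scaleC_blinfun z - T) = id_blinfun"

definition spectrum :: "('a::euclidean_space L2 \<Rightarrow>\<^sub>L 'a L2) \<Rightarrow> complex set" where
  "spectrum T = {z. \<nexists>R. is_resolvent T z R}"

definition resolvent ::
  "('a::euclidean_space L2 \<Rightarrow>\<^sub>L 'a L2) \<Rightarrow> complex \<Rightarrow> ('a L2 \<Rightarrow>\<^sub>L 'a L2)" where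
  "resolvent T z = (THE R. is_resolvent T z R)"

text \<open>
  A list of piecewise \<open>C\<^sup>1\<close> loops which is the positively oriented boundary of an open neighbourhood
  of \<open>S\<close> whose closure is contained in \<open>E\<close>; the orientation is expressed by winding numbers.
\<close>

definition neighbourhood_boundary ::
  "complex set \<Rightarrow> complex set \<Rightarrow> (real \<Rightarrow> complex) list \<Rightarrow> bool" where
  "neighbourhood_boundary S E \<Gamma> \<longleftrightarrow>
     (\<forall>\<gamma>\<in>set \<Gamma>. valid_path \<gamma> \<and> pathfinish \<gamma> = pathstart \<gamma>) \<and>
     (\<exists>U. open U \<and> S \<subseteq> U \<and> closure U \<subseteq> E \<and>
          frontier U = (\<Union>\<gamma>\<in>set \<Gamma>. path_image \<gamma>) \<and>
          (\<forall>z\<in>U. (\<Sum>\<gamma>\<leftarrow>\<Gamma>. winding_number \<gamma> z) = 1) \<and>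
          (\<forall>z. z \<notin> closure U \<longrightarrow> (\<Sum>\<gamma>\<leftarrow>\<Gamma>. winding_number \<gamma> z) = 0))"

text \<open>
  The operator-norm Henstock-Kurzweil analogue of \<^const>\<open>has_contour_integral\<close>, along a single path,
  for the integrand \<open>F z (z - T)\<^sup>-\<^sup>1\<close>.
\<close>

definition calculus_integrand ::
  "(complex \<Rightarrow> complex) \<Rightarrow> ('a::euclidean_space L2 \<Rightarrow>\<^sub>L 'a L2) \<Rightarrow> (real \<Rightarrow> complex) \<Rightarrow>
     real \<Rightarrow> ('a L2 \<Rightarrow>\<^sub>L 'a L2)" where
  "calculus_integrand F T \<gamma> t =
     scaleC_blinfun (F (\<gamma> t) * vector_derivative \<gamma> (at t within {0..1})) o\<^sub>L resolvent T (\<gamma> t)"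

definition has_holomorphic_calculus ::
  "(complex \<Rightarrow> complex) \<Rightarrow> ('a::euclidean_space L2 \<Rightarrow>\<^sub>L 'a L2) \<Rightarrow> (real \<Rightarrow> complex) list \<Rightarrow>
     ('a L2 \<Rightarrow>\<^sub>L 'a L2) \<Rightarrow> bool" where
  "has_holomorphic_calculus F T \<Gamma> R \<longleftrightarrow>
     (\<forall>\<gamma>\<in>set \<Gamma>. calculus_integrand F T \<gamma> integrable_on {0..1}) \<and>
     R = scaleC_blinfun (1 / (2 * of_real pi * \<i>)) o\<^sub>L
           (\<Sum>\<gamma>\<leftarrow>\<Gamma>. integral {0..1} (calculus_integrand F T \<gamma>))"


section \<open>Hausdorff operators\<close>

text \<open>
  A family of matrices that need not be defined everywhere is a pair of a domain \<open>D\<close> and a total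
  function \<open>A\<close> whose values outside \<open>D\<close> are irrelevant.
\<close>

definition measurable_family :: "(real^'n) set \<Rightarrow> (real^'n \<Rightarrow> real^'n^'n) \<Rightarrow> bool" where
  "measurable_family D A \<longleftrightarrow>
     D \<in> sets lebesgue \<and> A \<in> borel_measurable (restrict_space lebesgue D)"

definition positive_definite :: "real^'n^'n \<Rightarrow> bool" where
  "positive_definite B \<longleftrightarrow> (\<forall>x. x \<noteq> 0 \<longrightarrow> 0 < x \<bullet> (B *v x))"

definition diag :: "real^'n \<Rightarrow> real^'n^'n" where
  "diag d = (\<chi> i j. if i = j then d $ i else 0)"

text \<open>
  Kernels for which the Hausdorff operator is bounded on \<open>L\<^sup>2\<close>. Local integrability of \<open>K\<close> is not
  included: it is not inherited by the kernel of \<open>F(\<H>)\<close>, see the example at the end of this theory.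
\<close>

definition L2_kernel ::
  "(real^'n) set \<Rightarrow> (real^'n \<Rightarrow> real^'n^'n) \<Rightarrow> (real^'n \<Rightarrow> complex) \<Rightarrow> bool" where
  "L2_kernel D A K \<longleftrightarrow>
     K \<in> borel_measurable lebesgue \<and>
     (AE u in lebesgue. K u \<noteq> 0 \<longrightarrow> u \<in> D \<and> det (A u) \<noteq> 0) \<and>
     (\<lambda>u. \<bar>det (A u)\<bar> powr (-1/2) *\<^sub>R K u) absolutely_integrable_on D"

text \<open>
  \<open>T\<close> is the operator \<open>f \<mapsto> \<integral> K(u) f(A(u) x) du\<close>. The integral is over \<open>D\<close> since \<open>K\<close> vanishes almost
  everywhere outside \<open>D\<close>.
\<close>

definition is_hausdorff_operator ::
  "(real^'n) set \<Rightarrow> (real^'n \<Rightarrow> real^'n^'n) \<Rightarrow> (real^'n \<Rightarrow> complex) \<Rightarrow>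
     ((real^'n) L2 \<Rightarrow>\<^sub>L (real^'n) L2) \<Rightarrow> bool" where
  "is_hausdorff_operator D A K T \<longleftrightarrow>
     (\<forall>f. square_integrable f \<longrightarrow>
        (AE x in lebesgue.
           (\<lambda>u. K u * f (A u *v x)) absolutely_integrable_on D \<and>
           rep_L2 (blinfun_apply T (abs_L2 f)) x = (LINT u:D|lebesgue. K u * f (A u *v x))))"

definition hausdorff_operator ::
  "(real^'n) set \<Rightarrow> (real^'n \<Rightarrow> real^'n^'n) \<Rightarrow> (real^'n \<Rightarrow> complex) \<Rightarrow>
     ((real^'n) L2 \<Rightarrow>\<^sub>L (real^'n) L2)" where
  "hausdorff_operator D A K = (THE T. is_hausdorff_operator D A K T)"

text \<open>
  Bijective modulo null sets, i.e. an isomorphism of measure classes: after discarding a null set on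
  either side \<open>b\<close> is a bijection under which the null sets correspond to each other. The last
  clause is what makes \<open>u = b t\<close> an admissible change of variables. It does not follow from
  measurability and bijectivity: a homeomorphism \<open>b\<close> of the real line may map a null set onto a set
  of positive measure, or conversely.
\<close>

definition almost_bijective :: "(real^'n \<Rightarrow> real^'n) \<Rightarrow> bool" where
  "almost_bijective b \<longleftrightarrow>
     (\<exists>N\<in>null_sets lebesgue. \<exists>M\<in>null_sets lebesgue.
        bij_betw b (- N) (- M) \<and>
        (\<forall>S. S \<subseteq> - N \<longrightarrow> (b ` S \<in> null_sets lebesgue \<longleftrightarrow> S \<in> null_sets lebesgue)))"

text \<open>
  Example showing that the kernel of \<open>F(\<H>)\<close> need not be locally integrable. Let \<open>n = 1\<close>,
  \<open>F z = z\<^sup>2\<close>, and let \<open>b\<close> be a piecewise affine bijection (up to a countable set) of the line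
  which maps the intervals \<open>[j, j+1)\<close> with even \<open>j \<ge> 0\<close> onto intervals partitioning \<open>(0,1]\<close> and all
  other \<open>[j, j+1)\<close> by translations onto the unit intervals between consecutive integers outside
  \<open>(0,1]\<close>. Let \<open>A (b t) = exp t\<close> and
  \<open>K (b t) = exp (t/2) / j\<^sup>2\<close> for \<open>t\<close> in \<open>[j, j+1)\<close> with odd \<open>j > 0\<close>, \<open>K = 0\<close> elsewhere. With \<open>k\<close> the
  function equal to \<open>1/j\<^sup>2\<close> on these intervals, the kernel of the square is
  \<open>K\<^sub>2 (b t) = exp (t/2) * (k * k) t / b' t\<close> (convolution), unique up to null sets, and its
  integral over \<open>(0,1]\<close> is infinite.
\<close>

end

theory Submission
  imports Defs
begin

text \<open>
  Substituting \<open>t = log a(u)\<close> and weighting by \<open>exp (- (t\<^sub>1 + \<dots> + t\<^sub>n) / 2)\<close> turns the kernel \<open>K\<close> into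
  some \<open>k \<in> L\<^sup>1\<close>. In logarithmic coordinates on each of the \<open>2\<^sup>n\<close> octants, after the rotation \<open>C\<close>,
  the Hausdorff operator becomes \<open>g \<mapsto> \<integral> k(t) g(s + t) dt\<close>. The operators \<open>c + conv k\<close> with
  \<open>k \<in> L\<^sup>1\<close> form a commutative Banach algebra under the norm \<open>|c| + \<parallel>k\<parallel>\<^sub>1\<close>, and this algebra is
  inverse-closed in the bounded operators on \<open>L\<^sup>2\<close>. The latter needs no Fourier analysis
  (Hulanicki): the support of the \<open>m\<close>-th convolution power grows linearly in \<open>m\<close>, so
  Cauchy-Schwarz bounds the \<open>L\<^sup>1\<close> spectral radius by the \<open>L\<^sup>2\<close> operator norm. Hence resolvents and
  their contour integrals stay in the algebra. A resolvent at \<open>z\<close> has scalar part \<open>1 / z\<close>, so that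
  of the contour integral is \<open>F 0 = 0\<close>; independence of the contour is Cauchy's theorem for cycles.
\<close>

text \<open>The spectrum in the hypothesis is that of an operator on L2, while the conclusion asks
  for a kernel, an L1 object. Convergence of the contour integral in operator norm would give only a
  bounded operator, because convolution operators with L1 kernels are not closed in that norm. The
  integral is therefore formed in the finer algebra norm. For this the resolvents must exist in the
  algebra at every point where they exist as bounded operators, which is what inverse-closedness
  supplies. Two features of the setting shape the complex analysis. Contours are arbitrary finite
  lists of loops in an open set that may be disconnected, so the single-loop form of Cauchy's
  theorem has to be extended component by component. Moreover one kernel has to serve all contours
  at once. The Jacobian of the logarithmic coordinates is not computed: uniqueness of
  translation-invariant integrals determines it up to a positive constant for each octant, and that
  constant cancels in the isometries built from it.\<close>

section \<open>Invariance of Lebesgue measure, and Borel versions of Lebesgue measurable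
  functions\<close>

lemma lborel_distr_translate: "distr lborel borel (\<lambda>x. c + x) = (lborel :: 'a::euclidean_space measure)"
  using lborel_affine[of 1 c] by (simp add: density_1)

lemma lborel_distr_reflect: "distr lborel borel (\<lambda>x. c - x) = (lborel :: 'a::euclidean_space measure)"
  using lborel_affine[of "-1" c] by (simp add: density_1)

lemma nn_integral_lborel_translate:
  fixes f :: "'a::euclidean_space \<Rightarrow> ennreal"
  assumes [measurable]: "f \<in> borel_measurable borel"
  shows "(\<integral>\<^sup>+x. f (c + x) \<partial>lborel) = (\<integral>\<^sup>+x. f x \<partial>lborel)"
  using nn_integral_distr[of "(+) c" lborel borel f] by (simp add: lborel_distr_translate)

lemma nn_integral_lborel_reflect:
  fixes f :: "'a::euclidean_space \<Rightarrow> ennreal"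
  assumes [measurable]: "f \<in> borel_measurable borel"
  shows "(\<integral>\<^sup>+x. f (c - x) \<partial>lborel) = (\<integral>\<^sup>+x. f x \<partial>lborel)"
  using nn_integral_distr[of "(-) c" lborel borel f] by (simp add: lborel_distr_reflect)

lemma integral_lborel_translate:
  fixes f :: "'a::euclidean_space \<Rightarrow> 'b::{banach,second_countable_topology}"
  assumes [measurable]: "f \<in> borel_measurable borel"
  shows "(LINT x|lborel. f (c + x)) = (LINT x|lborel. f x)"
  using integral_distr[of "(+) c" lborel borel f] by (simp add: lborel_distr_translate)

lemma integral_lborel_reflect:
  fixes f :: "'a::euclidean_space \<Rightarrow> 'b::{banach,second_countable_topology}"
  assumes [measurable]: "f \<in> borel_measurable borel"
  shows "(LINT x|lborel. f (c - x)) = (LINT x|lborel. f x)"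
  using integral_distr[of "(-) c" lborel borel f] by (simp add: lborel_distr_reflect)

lemma AE_lborel_translate:
  fixes P :: "'a::euclidean_space \<Rightarrow> bool"
  assumes [measurable]: "Measurable.pred borel P" and "AE x in lborel. P x"
  shows "AE x in lborel. P (c + x)"
proof -
  have "AE x in distr lborel borel (\<lambda>x. c + x). P x"
    using assms(2) by (subst lborel_distr_translate)
  then show ?thesis by (subst (asm) AE_distr_iff) auto
qed

lemma AE_lebesgue_iff_lborel: "(AE x in lebesgue. P x) \<longleftrightarrow> (AE x in lborel. P x)"
  by (rule AE_completion_iff)

text \<open>Each of the finitely many coordinates agrees off a null set with a Borel function. Borel
  versions are wanted because functions such as \<open>g (s + t)\<close> must be measurable on the
  product of the Borel spaces for Fubini to apply.\<close>

lemma borel_representative: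
  fixes f :: "'a::euclidean_space \<Rightarrow> 'b::euclidean_space"
  assumes [measurable]: "f \<in> borel_measurable lebesgue"
  obtains g where "g \<in> borel_measurable borel" "AE x in lebesgue. f x = g x"
proof -
  have "\<exists>g. g \<in> borel_measurable borel \<and> (AE x in lborel. f x \<bullet> b = g x)" for b
    using completion_ex_borel_measurable_real[of "\<lambda>x. f x \<bullet> b" lborel] by (simp add: Bex_def)
  then obtain g where g: "\<And>b. g b \<in> borel_measurable borel"
    "\<And>b. AE x in lborel. f x \<bullet> b = g b x"
    by metis
  have "AE x in lborel. \<forall>b\<in>Basis. f x \<bullet> b = g b x"
    using g(2) by (simp add: AE_finite_all)
  then have "AE x in lborel. f x = (\<Sum>b\<in>Basis. g b x *\<^sub>R b)"
    by eventually_elim (subst euclidean_representation[symmetric], simp)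
  moreover have "(\<lambda>x. \<Sum>b\<in>Basis. g b x *\<^sub>R b) \<in> borel_measurable borel"
    using g(1) by (intro borel_measurable_sum borel_measurable_scaleR) auto
  ultimately show ?thesis
    by (intro that) (simp_all add: AE_lebesgue_iff_lborel)
qed

section \<open>Borel representatives of square-integrable functions\<close>

text \<open>The condition is a nonnegative integral, so that Tonelli estimates establish it
  directly, without integrability being known first.\<close>

definition borel_sqi :: "('a::euclidean_space \<Rightarrow> complex) \<Rightarrow> bool" where
  "borel_sqi f \<longleftrightarrow> f \<in> borel_measurable borel \<and> (\<integral>\<^sup>+x. ennreal (norm (f x))^2 \<partial>lborel) < \<infinity>"

lemma borel_sqi_measurable [measurable_dest]: "borel_sqi f \<Longrightarrow> f \<in> borel_measurable borel"
  by (simp add: borel_sqi_def)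

lemma borel_sqi_integrable:
  "borel_sqi f \<Longrightarrow> integrable lborel (\<lambda>x. (norm (f x))\<^sup>2)"
  unfolding borel_sqi_def by (subst integrable_iff_bounded) (auto simp: ennreal_power)

lemma borel_sqiI:
  assumes [measurable]: "f \<in> borel_measurable borel" and "integrable lborel (\<lambda>x. (norm (f x))\<^sup>2)"
  shows "borel_sqi f"
  using assms by (auto simp: borel_sqi_def integrable_iff_bounded ennreal_power)

lemma borel_sqi_square_integrable: "borel_sqi f \<Longrightarrow> square_integrable f"
  using borel_sqi_integrable[of f]
  by (auto simp: square_integrable_def borel_sqi_def integrable_completion intro: measurable_completion)

lemma borel_sqi_iff: "borel_sqi f \<longleftrightarrow> f \<in> borel_measurable borel \<and> square_integrable f"
proof
  assume *: "f \<in> borel_measurable borel \<and> square_integrable f"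
  then have [measurable]: "f \<in> borel_measurable borel" by simp
  show "borel_sqi f"
    using * by (intro borel_sqiI) (auto simp: square_integrable_def integrable_completion)
qed (auto simp: borel_sqi_square_integrable borel_sqi_def)

lemma borel_sqi_add: "borel_sqi f \<Longrightarrow> borel_sqi g \<Longrightarrow> borel_sqi (\<lambda>x. f x + g x)"
  by (auto simp: borel_sqi_iff square_integrable_add)

lemma borel_sqi_mult: "borel_sqi f \<Longrightarrow> borel_sqi (\<lambda>x. c * f x)"
  by (auto simp: borel_sqi_iff square_integrable_mult)

lemma abs_L2_eq_iff:
  assumes "square_integrable f" "square_integrable g"
  shows "abs_L2 f = abs_L2 g \<longleftrightarrow> (AE x in lebesgue. f x = g x)"
  using Quotient_rel[OF Quotient_L2, of f g] assms by (auto simp: L2_rel_def)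

lemma abs_L2_eq_iff_borel:
  assumes "borel_sqi f" "borel_sqi g"
  shows "abs_L2 f = abs_L2 g \<longleftrightarrow> (AE x in lborel. f x = g x)"
  using abs_L2_eq_iff[of f g] assms by (simp add: borel_sqi_square_integrable AE_lebesgue_iff_lborel)

lemma rep_L2_square_integrable: "square_integrable (rep_L2 F)"
  using Quotient_rep_reflp[OF Quotient_L2, of F] by (simp add: L2_rel_def)

lemma abs_rep_L2 [simp]: "abs_L2 (rep_L2 F) = F"
  by (rule Quotient_abs_rep[OF Quotient_L2])

lemma rep_abs_L2: "square_integrable f \<Longrightarrow> AE x in lebesgue. rep_L2 (abs_L2 f) x = f x"
  using abs_L2_eq_iff[of "rep_L2 (abs_L2 f)" f] by (simp add: rep_L2_square_integrable)

lemma square_integrable_cong_AE: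
  assumes "square_integrable f" "AE x in lebesgue. f x = g x" "g \<in> borel_measurable lebesgue"
  shows "square_integrable g"
proof -
  have [measurable]: "f \<in> borel_measurable lebesgue" "g \<in> borel_measurable lebesgue"
    using assms by (auto simp: square_integrable_def)
  have "integrable lebesgue (\<lambda>x. (norm (g x))\<^sup>2)"
    using assms by (subst integrable_cong_AE[where g = "\<lambda>x. (norm (f x))\<^sup>2"])
      (auto simp: square_integrable_def elim!: eventually_mono)
  then show ?thesis by (simp add: square_integrable_def)
qed

lemma borel_sqi_representative:
  assumes "square_integrable f"
  obtains g where "borel_sqi g" "AE x in lebesgue. f x = g x"
proof -
  have "f \<in> borel_measurable lebesgue"
    using assms by (simp add: square_integrable_def)
  then obtain g where g: "g \<in> borel_measurable borel" "AE x in lebesgue. f x = g x"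
    by (rule borel_representative)
  have "g \<in> borel_measurable lebesgue"
    using g(1) by (intro measurable_completion) simp
  then have "square_integrable g"
    by (rule square_integrable_cong_AE[OF assms g(2)])
  with g(1) have "borel_sqi g"
    unfolding borel_sqi_iff ..
  then show ?thesis
    using g(2) by (rule that)
qed

lemma L2_borel_cases:
  obtains g where "borel_sqi g" "F = abs_L2 g"
proof -
  obtain g where g: "borel_sqi g" "AE x in lebesgue. rep_L2 F x = g x"
    using borel_sqi_representative[OF rep_L2_square_integrable] .
  then have "abs_L2 (rep_L2 F) = abs_L2 g"
    by (subst abs_L2_eq_iff) (auto simp: rep_L2_square_integrable borel_sqi_square_integrable)
  then show ?thesis by (intro that[OF g(1)]) simp
qed

definition borel_rep :: "'a::euclidean_space L2 \<Rightarrow> 'a \<Rightarrow> complex" where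
  "borel_rep F = (SOME g. borel_sqi g \<and> F = abs_L2 g)"

lemma borel_rep: "borel_sqi (borel_rep F)" "abs_L2 (borel_rep F) = F"
proof -
  have "\<exists>g. borel_sqi g \<and> F = abs_L2 g" using L2_borel_cases by metis
  from someI_ex[OF this] show "borel_sqi (borel_rep F)" "abs_L2 (borel_rep F) = F"
    by (auto simp: borel_rep_def)
qed

lemma borel_rep_abs: "borel_sqi g \<Longrightarrow> AE x in lborel. borel_rep (abs_L2 g) x = g x"
  by (subst abs_L2_eq_iff_borel[symmetric]) (auto simp: borel_rep)

lemma abs_L2_add:
  "square_integrable f \<Longrightarrow> square_integrable g \<Longrightarrow> abs_L2 f + abs_L2 g = abs_L2 (\<lambda>x. f x + g x)"
  by (rule plus_L2.abs_eq) (auto simp: L2_rel_def)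

lemma abs_L2_scaleR: "square_integrable f \<Longrightarrow> c *\<^sub>R abs_L2 f = abs_L2 (\<lambda>x. of_real c * f x)"
  by (rule scaleR_L2.abs_eq) (auto simp: L2_rel_def)

lemma abs_L2_scaleC: "square_integrable f \<Longrightarrow> scaleC_L2 c (abs_L2 f) = abs_L2 (\<lambda>x. c * f x)"
  by (rule scaleC_L2.abs_eq) (auto simp: L2_rel_def)

lemma scaleR_scaleC_L2: "r *\<^sub>R F = scaleC_L2 (of_real r) F"
  by (rule L2_borel_cases[of F]) (simp add: abs_L2_scaleR abs_L2_scaleC borel_sqi_square_integrable)

lemma abs_L2_inner:
  assumes "borel_sqi f" "borel_sqi g"
  shows "abs_L2 f \<bullet> abs_L2 g = (LINT x|lborel. f x \<bullet> g x)"
proof -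
  have [measurable]: "f \<in> borel_measurable borel" "g \<in> borel_measurable borel"
    using assms by (auto simp: borel_sqi_def)
  have "abs_L2 f \<bullet> abs_L2 g = (LINT x|lebesgue. f x \<bullet> g x)"
    using assms by (intro inner_L2.abs_eq) (auto simp: L2_rel_def borel_sqi_square_integrable)
  then show ?thesis by (simp add: integral_completion)
qed

lemma norm_abs_L2_nn:
  assumes "borel_sqi f"
  shows "ennreal (norm (abs_L2 f))^2 = (\<integral>\<^sup>+x. ennreal (norm (f x))^2 \<partial>lborel)"
proof -
  have "(norm (abs_L2 f))\<^sup>2 = (LINT x|lborel. (norm (f x))\<^sup>2)"
    unfolding power2_norm_eq_inner using assms by (simp add: abs_L2_inner)
  then show ?thesis
    using nn_integral_eq_integral[OF borel_sqi_integrable[OF assms]]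
    by (simp add: ennreal_power)
qed

section \<open>Operators given by a map on representatives\<close>

text \<open>The value is computed on a chosen Borel representative; for maps \<open>P\<close> as in
  the locale \<open>L2_liftable\<close> it does not depend on the choice.\<close>

definition L2_lift :: "(('a::euclidean_space \<Rightarrow> complex) \<Rightarrow> 'b::euclidean_space \<Rightarrow> complex) \<Rightarrow> 'a L2 \<Rightarrow>\<^sub>L 'b L2" where
  "L2_lift P = Blinfun (\<lambda>F. abs_L2 (P (borel_rep F)))"

text \<open>Linearity is demanded only almost everywhere: a Bochner integral is 0 where its
  integrand is not integrable, so a map such as \<open>conv k\<close> need not be additive at every
  point.\<close>

locale L2_liftable =
  fixes P :: "('a::euclidean_space \<Rightarrow> complex) \<Rightarrow> 'b::euclidean_space \<Rightarrow> complex" and M :: real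
  assumes M: "0 \<le> M"
    and meas: "\<And>f. borel_sqi f \<Longrightarrow> P f \<in> borel_measurable borel"
    and bound: "\<And>f. borel_sqi f \<Longrightarrow> (\<integral>\<^sup>+x. ennreal (norm (P f x))^2 \<partial>lborel)
        \<le> ennreal (M^2) * (\<integral>\<^sup>+x. ennreal (norm (f x))^2 \<partial>lborel)"
    and add: "\<And>f g. borel_sqi f \<Longrightarrow> borel_sqi g \<Longrightarrow> AE x in lborel. P (\<lambda>x. f x + g x) x = P f x + P g x"
    and mult: "\<And>f c. borel_sqi f \<Longrightarrow> AE x in lborel. P (\<lambda>x. c * f x) x = c * P f x"
begin

text \<open>The bound, applied to the difference of \<open>f\<close> and \<open>g\<close>, makes the
  image of that difference vanish almost everywhere, and linearity passes this on to the two
  images.\<close>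

lemma cong:
  assumes f: "borel_sqi f" and g: "borel_sqi g" and fg: "AE x in lborel. f x = g x"
  shows "AE x in lborel. P f x = P g x"
proof -
  define d where "d x = f x + (- 1) * g x" for x
  have d: "borel_sqi d" unfolding d_def by (intro borel_sqi_add borel_sqi_mult f g)
  note [measurable] = meas[OF d]
  have "(\<integral>\<^sup>+x. ennreal (norm (d x))^2 \<partial>lborel) = (\<integral>\<^sup>+x. 0 \<partial>(lborel :: 'a measure))"
    by (intro nn_integral_cong_AE) (use fg in \<open>auto simp: d_def elim!: eventually_mono\<close>)
  then have "(\<integral>\<^sup>+x. ennreal (norm (P d x))^2 \<partial>lborel) = 0"
    using bound[OF d] by simp
  then have "AE x in lborel. ennreal (norm (P d x))^2 = 0"
    by (subst (asm) nn_integral_0_iff_AE) auto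
  then have "AE x in lborel. P d x = 0" by eventually_elim simp
  moreover have "AE x in lborel. P d x = P f x + P (\<lambda>x. (- 1) * g x) x"
    unfolding d_def by (intro add borel_sqi_mult f g)
  moreover have "AE x in lborel. P (\<lambda>x. (- 1) * g x) x = (- 1) * P g x" by (rule mult[OF g])
  ultimately show ?thesis by eventually_elim simp
qed

lemma sqi: "borel_sqi f \<Longrightarrow> borel_sqi (P f)"
  using bound[of f] meas[of f] unfolding borel_sqi_def
  by (auto simp: ennreal_mult_less_top elim!: le_less_trans)

lemma abs_P_borel_rep: "borel_sqi f \<Longrightarrow> abs_L2 (P (borel_rep (abs_L2 f))) = abs_L2 (P f)"
  by (subst abs_L2_eq_iff_borel) (auto intro: sqi borel_rep cong borel_rep_abs)

lemma norm_abs_P: "borel_sqi f \<Longrightarrow> norm (abs_L2 (P f)) \<le> M * norm (abs_L2 f)"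
proof -
  assume f: "borel_sqi f"
  have "ennreal (norm (abs_L2 (P f)))^2 \<le> ennreal (M^2) * ennreal (norm (abs_L2 f))^2"
    using bound[OF f] by (simp add: norm_abs_L2_nn f sqi)
  then have "(norm (abs_L2 (P f)))^2 \<le> (M * norm (abs_L2 f))^2"
    using M by (simp add: ennreal_power ennreal_mult[symmetric] power_mult_distrib)
  then show ?thesis
    using M by (auto intro: power2_le_imp_le)
qed

lemma abs_P_add: "borel_sqi f \<Longrightarrow> borel_sqi g \<Longrightarrow>
    abs_L2 (P (\<lambda>x. f x + g x)) = abs_L2 (P f) + abs_L2 (P g)"
  by (simp add: abs_L2_add borel_sqi_square_integrable sqi abs_L2_eq_iff_borel borel_sqi_add add)

lemma abs_P_mult: "borel_sqi f \<Longrightarrow> abs_L2 (P (\<lambda>x. c * f x)) = scaleC_L2 c (abs_L2 (P f))"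
  by (simp add: abs_L2_scaleC borel_sqi_square_integrable sqi abs_L2_eq_iff_borel borel_sqi_mult mult)

lemma lift_abs: "borel_sqi f \<Longrightarrow> L2_lift P (abs_L2 f) = abs_L2 (P f)"
  and lift_scaleC: "L2_lift P (scaleC_L2 c F) = scaleC_L2 c (L2_lift P F)"
  and norm_lift: "norm (L2_lift P) \<le> M"
proof -
  have bl: "bounded_linear (\<lambda>F. abs_L2 (P (borel_rep F)))"
  proof
    fix F G :: "'a L2" and r :: real
    obtain f where f: "borel_sqi f" "F = abs_L2 f" by (rule L2_borel_cases)
    obtain g where g: "borel_sqi g" "G = abs_L2 g" by (rule L2_borel_cases)
    show "abs_L2 (P (borel_rep (F + G))) = abs_L2 (P (borel_rep F)) + abs_L2 (P (borel_rep G))"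
      using f g
      by (simp add: abs_L2_add borel_sqi_square_integrable abs_P_borel_rep borel_sqi_add abs_P_add)
    show "abs_L2 (P (borel_rep (r *\<^sub>R F))) = r *\<^sub>R abs_L2 (P (borel_rep F))"
      using f
      by (simp add: scaleR_scaleC_L2 abs_L2_scaleC borel_sqi_square_integrable abs_P_borel_rep
          borel_sqi_mult abs_P_mult)
    show "\<exists>K. \<forall>F. norm (abs_L2 (P (borel_rep F))) \<le> norm F * K"
      using norm_abs_P[OF borel_rep(1)] by (intro exI[of _ M]) (simp add: borel_rep mult.commute)
  qed
  have ap: "L2_lift P F = abs_L2 (P (borel_rep F))" for F
    unfolding L2_lift_def by (simp add: bounded_linear_Blinfun_apply[OF bl])
  show lift: "L2_lift P (abs_L2 f) = abs_L2 (P f)" if "borel_sqi f" for f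
    using that by (simp add: ap abs_P_borel_rep)
  show "L2_lift P (scaleC_L2 c F) = scaleC_L2 c (L2_lift P F)"
    by (rule L2_borel_cases[of F])
       (simp add: abs_L2_scaleC lift borel_sqi_mult abs_P_mult borel_sqi_square_integrable)
  show "norm (L2_lift P) \<le> M"
    using M norm_abs_P[OF borel_rep(1)] by (intro norm_blinfun_bound) (auto simp: ap borel_rep)
qed

end

section \<open>Convolution operators\<close>

definition borel_L1 :: "('a::euclidean_space \<Rightarrow> complex) \<Rightarrow> bool" where
  "borel_L1 k \<longleftrightarrow> k \<in> borel_measurable borel \<and> integrable lborel k"

definition L1_norm :: "('a::euclidean_space \<Rightarrow> complex) \<Rightarrow> real" where
  "L1_norm k = (LINT t|lborel. norm (k t))"

lemma borel_L1_measurable [measurable_dest]: "borel_L1 k \<Longrightarrow> k \<in> borel_measurable borel"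
  by (simp add: borel_L1_def)

lemma L1_norm_nonneg [simp]: "0 \<le> L1_norm k"
  by (simp add: L1_norm_def)

lemma nn_integral_L1_norm: "borel_L1 k \<Longrightarrow> (\<integral>\<^sup>+t. ennreal (norm (k t)) \<partial>lborel) = ennreal (L1_norm k)"
  unfolding L1_norm_def borel_L1_def by (intro nn_integral_eq_integral) auto

lemma borel_L1I:
  assumes [measurable]: "k \<in> borel_measurable borel" 
    and "(\<integral>\<^sup>+t. ennreal (norm (k t)) \<partial>lborel) < \<infinity>"
  shows "borel_L1 k"
  using assms by (simp add: borel_L1_def integrable_iff_bounded)

lemma L1_norm_leI:
  assumes "(\<integral>\<^sup>+t. ennreal (norm (k t)) \<partial>lborel) \<le> ennreal M" "0 \<le> M" "borel_L1 k"
  shows "L1_norm k \<le> M"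
  using assms nn_integral_L1_norm[of k] by simp

lemma borel_L1_add: "borel_L1 k \<Longrightarrow> borel_L1 l \<Longrightarrow> borel_L1 (\<lambda>t. k t + l t)"
  by (auto simp: borel_L1_def)

lemma borel_L1_mult: "borel_L1 k \<Longrightarrow> borel_L1 (\<lambda>t. c * k t)"
  by (auto simp: borel_L1_def)

lemma borel_L1_zero: "borel_L1 (\<lambda>t. 0)"
  by (simp add: borel_L1_def)

lemma L1_norm_add:
  assumes "borel_L1 k" "borel_L1 l"
  shows "L1_norm (\<lambda>t. k t + l t) \<le> L1_norm k + L1_norm l"
proof -
  have "integrable lborel (\<lambda>t. norm (k t + l t))" "integrable lborel (\<lambda>t. norm (k t))"
    "integrable lborel (\<lambda>t. norm (l t))"
    using assms by (auto simp: borel_L1_def)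
  then show ?thesis
    unfolding L1_norm_def
    by (simp add: Bochner_Integration.integral_add[symmetric] integral_mono norm_triangle_ineq
        del: Bochner_Integration.integral_add)
qed

lemma L1_norm_mult: "L1_norm (\<lambda>t. c * k t) = norm c * L1_norm k"
  by (simp add: L1_norm_def norm_mult)

text \<open>A correlation, with \<open>s + t\<close>: in logarithmic coordinates the dilation by
  \<open>exp t\<close> is the shift by \<open>t\<close>, so this is the shape a Hausdorff operator
  takes there.\<close>

definition conv :: "('a::euclidean_space \<Rightarrow> complex) \<Rightarrow> ('a \<Rightarrow> complex) \<Rightarrow> 'a \<Rightarrow> complex" where
  "conv k g s = (LINT t|lborel. k t * g (s + t))"

lemma borel_measurable_conv [measurable]:
  assumes [measurable]: "k \<in> borel_measurable borel" "g \<in> borel_measurable borel"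
  shows "conv k g \<in> borel_measurable borel"
  unfolding conv_def[abs_def] by measurable

text \<open>Young's inequality for the exponents 1 and 2: \<open>u\<close> is split into two factors
  \<open>sqrt u\<close> for Cauchy-Schwarz, then Tonelli and translation invariance finish. In this
  nonnegative form it also certifies that \<open>conv\<close> converges almost everywhere.\<close>

lemma nn_conv_bound:
  fixes u :: "'a::euclidean_space \<Rightarrow> real" and v :: "'a \<Rightarrow> ennreal"
  assumes [measurable]: "u \<in> borel_measurable borel" "v \<in> borel_measurable borel"
    and u: "\<And>t. 0 \<le> u t"
  shows "(\<integral>\<^sup>+s. (\<integral>\<^sup>+t. ennreal (u t) * v (s + t) \<partial>lborel)^2 \<partial>lborel)
     \<le> (\<integral>\<^sup>+t. ennreal (u t) \<partial>lborel)^2 * (\<integral>\<^sup>+s. (v s)^2 \<partial>lborel)"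
proof -
  let ?n = "\<integral>\<^sup>+t. ennreal (u t) \<partial>lborel"
  have sq: "ennreal (sqrt (u t)) * ennreal (sqrt (u t)) = ennreal (u t)" for t
    using u by (simp add: ennreal_mult[symmetric])
  have "(\<integral>\<^sup>+t. ennreal (u t) * v (s + t) \<partial>lborel)^2
       \<le> ?n * (\<integral>\<^sup>+t. ennreal (u t) * (v (s + t))^2 \<partial>lborel)" for s
  proof -
    have "(\<integral>\<^sup>+t. ennreal (sqrt (u t)) * (ennreal (sqrt (u t)) * v (s + t)) \<partial>lborel)^2 \<le>
      (\<integral>\<^sup>+t. ennreal (sqrt (u t))^2 \<partial>lborel) * (\<integral>\<^sup>+t. (ennreal (sqrt (u t)) * v (s + t))^2 \<partial>lborel)"
      by (rule Cauchy_Schwarz_nn_integral) measurable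
    then show ?thesis
      by (simp add: power_mult_distrib mult.assoc[symmetric] sq) (simp add: power2_eq_square sq)
  qed
  then have "(\<integral>\<^sup>+s. (\<integral>\<^sup>+t. ennreal (u t) * v (s + t) \<partial>lborel)^2 \<partial>lborel)
     \<le> (\<integral>\<^sup>+s. ?n * (\<integral>\<^sup>+t. ennreal (u t) * (v (s + t))^2 \<partial>lborel) \<partial>lborel)"
    by (intro nn_integral_mono)
  also have "\<dots> = ?n * (\<integral>\<^sup>+s. (\<integral>\<^sup>+t. ennreal (u t) * (v (s + t))^2 \<partial>lborel) \<partial>lborel)"
    by (intro nn_integral_cmult) measurable
  also have "(\<integral>\<^sup>+s. (\<integral>\<^sup>+t. ennreal (u t) * (v (s + t))^2 \<partial>lborel) \<partial>lborel)
      = (\<integral>\<^sup>+t. (\<integral>\<^sup>+s. ennreal (u t) * (v (s + t))^2 \<partial>lborel) \<partial>lborel)"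
    by (rule lborel_pair.Fubini') measurable
  also have "\<dots> = (\<integral>\<^sup>+t. ennreal (u t) * (\<integral>\<^sup>+s. (v s)^2 \<partial>lborel) \<partial>lborel)"
    by (intro nn_integral_cong)
      (simp add: nn_integral_cmult nn_integral_lborel_translate[of "\<lambda>s. (v s)^2"] add.commute)
  also have "\<dots> = ?n * (\<integral>\<^sup>+s. (v s)^2 \<partial>lborel)"
    by (intro nn_integral_multc) measurable
  finally show ?thesis by (simp add: power2_eq_square mult.assoc)
qed

lemma norm_conv_le: "ennreal (norm (conv k g s)) \<le> (\<integral>\<^sup>+t. ennreal (norm (k t)) * ennreal (norm (g (s + t))) \<partial>lborel)"
proof (cases "integrable lborel (\<lambda>t. k t * g (s + t))")
  case True
  from integral_norm_bound_ennreal[OF this] show ?thesis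
    by (simp add: conv_def norm_mult ennreal_mult)
next
  case False
  then show ?thesis by (simp add: conv_def not_integrable_integral_eq)
qed

lemma conv_nn_finite:
  fixes k g :: "'a::euclidean_space \<Rightarrow> complex"
  assumes k: "borel_L1 k" and g: "borel_sqi g"
  shows "(\<integral>\<^sup>+s. (\<integral>\<^sup>+t. ennreal (norm (k t)) * ennreal (norm (g (s + t))) \<partial>lborel)^2 \<partial>lborel)
      \<le> ennreal ((L1_norm k)^2) * (\<integral>\<^sup>+s. ennreal (norm (g s))^2 \<partial>lborel)"
proof -
  note [measurable] = borel_L1_measurable[OF k] borel_sqi_measurable[OF g]
  show ?thesis
    using nn_conv_bound[of "\<lambda>t. norm (k t)" "\<lambda>s. ennreal (norm (g s))"]
    by (simp add: nn_integral_L1_norm[OF k] ennreal_power)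
qed

lemma AE_finite_of_square:
  fixes u :: "'a \<Rightarrow> ennreal"
  assumes [measurable]: "u \<in> borel_measurable M" and "(\<integral>\<^sup>+s. (u s)^2 \<partial>M) < \<infinity>"
  shows "AE s in M. u s < \<infinity>"
proof -
  have "AE s in M. (u s)^2 \<noteq> \<infinity>"
    using assms by (intro nn_integral_PInf_AE) auto
  then show ?thesis
    by eventually_elim (auto simp: power2_eq_square ennreal_mult_eq_top_iff less_top)
qed

lemma AE_conv_nn_finite:
  assumes k: "borel_L1 k" and g: "borel_sqi g"
  shows "AE s in lborel. (\<integral>\<^sup>+t. ennreal (norm (k t)) * ennreal (norm (g (s + t))) \<partial>lborel) < \<infinity>"
proof -
  note [measurable] = borel_L1_measurable[OF k] borel_sqi_measurable[OF g]
  have "ennreal ((L1_norm k)^2) * (\<integral>\<^sup>+s. ennreal (norm (g s))^2 \<partial>lborel) < \<infinity>"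
    using g by (simp add: borel_sqi_def ennreal_mult_less_top)
  then show ?thesis
    by (intro AE_finite_of_square order.strict_trans1[OF conv_nn_finite[OF k g]]) measurable
qed

lemma AE_conv_integrable:
  assumes k: "borel_L1 k" and g: "borel_sqi g"
  shows "AE s in lborel. integrable lborel (\<lambda>t. k t * g (s + t))"
proof -
  note [measurable] = borel_L1_measurable[OF k] borel_sqi_measurable[OF g]
  show ?thesis
    using AE_conv_nn_finite[OF k g]
    by eventually_elim (simp add: integrable_iff_bounded norm_mult ennreal_mult)
qed

lemma L2_liftable_conv:
  assumes k: "borel_L1 k"
  shows "L2_liftable (conv k) (L1_norm k)"
proof
  note [measurable] = borel_L1_measurable[OF k]
  fix f g :: "'a \<Rightarrow> complex" and c :: complex
  assume f: "borel_sqi f"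
  note [measurable] = borel_sqi_measurable[OF f]
  show "conv k f \<in> borel_measurable borel" by measurable
  show "(\<integral>\<^sup>+x. ennreal (norm (conv k f x))^2 \<partial>lborel)
        \<le> ennreal ((L1_norm k)^2) * (\<integral>\<^sup>+x. ennreal (norm (f x))^2 \<partial>lborel)"
    by (intro order.trans[OF nn_integral_mono[OF power_mono[OF norm_conv_le]]] conv_nn_finite k f) simp
  show "AE x in lborel. conv k (\<lambda>x. c * f x) x = c * conv k f x"
    by (simp add: conv_def mult.left_commute[of _ c])
  assume g: "borel_sqi g"
  note [measurable] = borel_sqi_measurable[OF g]
  show "AE x in lborel. conv k (\<lambda>x. f x + g x) x = conv k f x + conv k g x"
    using AE_conv_integrable[OF k f] AE_conv_integrable[OF k g]
    by eventually_elim (simp add: conv_def distrib_left)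
qed simp

definition conv_op :: "('a::euclidean_space \<Rightarrow> complex) \<Rightarrow> 'a L2 \<Rightarrow>\<^sub>L 'a L2" where
  "conv_op k = L2_lift (conv k)"

lemma conv_op_abs: "borel_L1 k \<Longrightarrow> borel_sqi f \<Longrightarrow> conv_op k (abs_L2 f) = abs_L2 (conv k f)"
  and conv_op_scaleC: "borel_L1 k \<Longrightarrow> conv_op k (scaleC_L2 c F) = scaleC_L2 c (conv_op k F)"
  and norm_conv_op: "borel_L1 k \<Longrightarrow> norm (conv_op k) \<le> L1_norm k"
  and borel_sqi_conv: "borel_L1 k \<Longrightarrow> borel_sqi f \<Longrightarrow> borel_sqi (conv k f)"
  unfolding conv_op_def
  using L2_liftable.lift_abs L2_liftable.lift_scaleC L2_liftable.norm_lift L2_liftable.sqi L2_liftable_conv by blast+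

lemma blinfun_L2_eqI:
  fixes S T :: "'a::euclidean_space L2 \<Rightarrow>\<^sub>L 'b::real_normed_vector"
  assumes "\<And>f. borel_sqi f \<Longrightarrow> S (abs_L2 f) = T (abs_L2 f)"
  shows "S = T"
  by (intro blinfun_eqI) (metis L2_borel_cases assms)

lemma abs_L2_eqI_AE:
  "borel_sqi f \<Longrightarrow> borel_sqi g \<Longrightarrow> AE x in lborel. f x = g x \<Longrightarrow> abs_L2 f = abs_L2 g"
  by (simp add: abs_L2_eq_iff_borel)

lemma conv_op_add:
  assumes k: "borel_L1 k" and l: "borel_L1 l"
  shows "conv_op (\<lambda>t. k t + l t) = conv_op k + conv_op l"
proof (rule blinfun_L2_eqI)
  fix f :: "'a \<Rightarrow> complex" assume f: "borel_sqi f"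
  have "AE s in lborel. conv (\<lambda>t. k t + l t) f s = conv k f s + conv l f s"
    using AE_conv_integrable[OF k f] AE_conv_integrable[OF l f]
    by eventually_elim (simp add: conv_def distrib_right)
  then have "abs_L2 (conv (\<lambda>t. k t + l t) f) = abs_L2 (\<lambda>s. conv k f s + conv l f s)"
    by (intro abs_L2_eqI_AE borel_sqi_conv borel_sqi_add borel_L1_add k l f)
  then show "conv_op (\<lambda>t. k t + l t) (abs_L2 f) = (conv_op k + conv_op l) (abs_L2 f)"
    by (simp add: conv_op_abs borel_L1_add k l f plus_blinfun.rep_eq abs_L2_add borel_sqi_square_integrable borel_sqi_conv)
qed

lemma scaleC_blinfun_abs: "borel_sqi f \<Longrightarrow> scaleC_blinfun c (abs_L2 f) = abs_L2 (\<lambda>x. c * f x)"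
  by (simp add: scaleC_blinfun.rep_eq abs_L2_scaleC borel_sqi_square_integrable)

lemma conv_op_mult:
  assumes k: "borel_L1 k"
  shows "conv_op (\<lambda>t. c * k t) = scaleC_blinfun c o\<^sub>L conv_op k"
proof (rule blinfun_L2_eqI)
  fix f :: "'a \<Rightarrow> complex" assume f: "borel_sqi f"
  have "conv (\<lambda>t. c * k t) f = (\<lambda>s. c * conv k f s)"
    by (simp add: conv_def fun_eq_iff mult.assoc)
  then show "conv_op (\<lambda>t. c * k t) (abs_L2 f) = (scaleC_blinfun c o\<^sub>L conv_op k) (abs_L2 f)"
    by (simp add: conv_op_abs borel_L1_mult k f scaleC_blinfun_abs borel_sqi_conv)
qed

section \<open>The convolution product of kernels\<close>

text \<open>The ordinary convolution, with \<open>r - t\<close>: shifts by \<open>t\<close> and by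
  \<open>r - t\<close> add up to the shift by \<open>r\<close>, so this product matches composition
  of the operators \<open>conv\<close>.\<close>

definition convolve :: "('a::euclidean_space \<Rightarrow> complex) \<Rightarrow> ('a \<Rightarrow> complex) \<Rightarrow> 'a \<Rightarrow> complex" where
  "convolve k l r = (LINT t|lborel. k t * l (r - t))"

lemma borel_measurable_convolve [measurable]:
  assumes [measurable]: "k \<in> borel_measurable borel" "l \<in> borel_measurable borel"
  shows "convolve k l \<in> borel_measurable borel"
  unfolding convolve_def[abs_def] by measurable

lemma convolve_commute:
  fixes k l :: "'a::euclidean_space \<Rightarrow> complex"
  assumes [measurable]: "k \<in> borel_measurable borel" "l \<in> borel_measurable borel"
  shows "convolve k l = convolve l k"
proof
  fix r
  show "convolve k l r = convolve l k r"
    using integral_lborel_reflect[of "\<lambda>t. k t * l (r - t)" r] by (simp add: convolve_def mult.commute)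
qed

lemma norm_convolve_le: "ennreal (norm (convolve k l r)) \<le> (\<integral>\<^sup>+t. ennreal (norm (k t)) * ennreal (norm (l (r - t))) \<partial>lborel)"
proof (cases "integrable lborel (\<lambda>t. k t * l (r - t))")
  case True
  from integral_norm_bound_ennreal[OF this] show ?thesis
    by (simp add: convolve_def norm_mult ennreal_mult)
next
  case False
  then show ?thesis by (simp add: convolve_def not_integrable_integral_eq)
qed

lemma borel_L1_convolve: "borel_L1 k \<Longrightarrow> borel_L1 l \<Longrightarrow> borel_L1 (convolve k l)" (is "_ \<Longrightarrow> _ \<Longrightarrow> ?A")
  and L1_norm_convolve: "borel_L1 k \<Longrightarrow> borel_L1 l \<Longrightarrow> L1_norm (convolve k l) \<le> L1_norm k * L1_norm l" (is "_ \<Longrightarrow> _ \<Longrightarrow> ?B")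
proof -
  assume k: "borel_L1 k" and l: "borel_L1 l"
  note [measurable] = borel_L1_measurable[OF k] borel_L1_measurable[OF l]
  have "(\<integral>\<^sup>+r. ennreal (norm (convolve k l r)) \<partial>lborel) \<le>
      (\<integral>\<^sup>+r. (\<integral>\<^sup>+t. ennreal (norm (k t)) * ennreal (norm (l (r - t))) \<partial>lborel) \<partial>lborel)"
    by (intro nn_integral_mono norm_convolve_le)
  also have "\<dots> = (\<integral>\<^sup>+t. (\<integral>\<^sup>+r. ennreal (norm (k t)) * ennreal (norm (l (r - t))) \<partial>lborel) \<partial>lborel)"
    by (rule lborel_pair.Fubini') measurable
  also have "\<dots> = (\<integral>\<^sup>+t. ennreal (norm (k t)) * ennreal (L1_norm l) \<partial>lborel)"
  proof (intro nn_integral_cong)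
    fix t
    have "(\<integral>\<^sup>+r. ennreal (norm (l (r - t))) \<partial>lborel) = ennreal (L1_norm l)"
      using nn_integral_lborel_translate[of "\<lambda>r. ennreal (norm (l r))" "-t"] l
      by (simp add: nn_integral_L1_norm)
    then show "(\<integral>\<^sup>+r. ennreal (norm (k t)) * ennreal (norm (l (r - t))) \<partial>lborel) = ennreal (norm (k t)) * ennreal (L1_norm l)"
      by (simp add: nn_integral_cmult)
  qed
  also have "\<dots> = ennreal (L1_norm k * L1_norm l)"
    by (simp add: nn_integral_multc nn_integral_L1_norm k ennreal_mult)
  finally have *: "(\<integral>\<^sup>+r. ennreal (norm (convolve k l r)) \<partial>lborel) \<le> ennreal (L1_norm k * L1_norm l)" .
  show ?A by (rule borel_L1I) (measurable, use * in \<open>auto elim!: le_less_trans\<close>)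
  then show ?B using * by (intro L1_norm_leI) auto
qed

text \<open>Fubini, after the inner variable has been shifted so that both shifts are measured from
  \<open>s\<close>. It is justified for almost every \<open>s\<close> by applying the L2 bound twice
  to absolute values.\<close>

lemma conv_op_compose:
  assumes k: "borel_L1 k" and l: "borel_L1 l"
  shows "conv_op k o\<^sub>L conv_op l = conv_op (convolve k l)"
proof (rule blinfun_L2_eqI)
  fix f :: "'a \<Rightarrow> complex" assume f: "borel_sqi f"
  note [measurable] = borel_L1_measurable[OF k] borel_L1_measurable[OF l] borel_sqi_measurable[OF f]
  \<comment> \<open>\<open>w\<close> is the convolution with all absolute values taken inside; being
    square integrable, it can be fed into \<open>nn_conv_bound\<close> a second time.\<close>
  define w where "w s = (\<integral>\<^sup>+t. ennreal (norm (l t)) * ennreal (norm (f (s + t))) \<partial>lborel)" for s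
  have [measurable]: "w \<in> borel_measurable borel" unfolding w_def by measurable
  have "(\<integral>\<^sup>+s. (w s)^2 \<partial>lborel) < \<infinity>"
    unfolding w_def using f
    by (intro order.strict_trans1[OF conv_nn_finite[OF l f]]) (simp add: borel_sqi_def ennreal_mult_less_top)
  then have "(\<integral>\<^sup>+s. (\<integral>\<^sup>+t. ennreal (norm (k t)) * w (s + t) \<partial>lborel)^2 \<partial>lborel) < \<infinity>"
    by (intro order.strict_trans1[OF nn_conv_bound])
       (auto simp: nn_integral_L1_norm k ennreal_mult_less_top ennreal_power)
  then have "AE s in lborel. (\<integral>\<^sup>+t. ennreal (norm (k t)) * w (s + t) \<partial>lborel) < \<infinity>"
    by (intro AE_finite_of_square) auto
  then have "AE s in lborel. conv k (conv l f) s = conv (convolve k l) f s"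
  proof eventually_elim
    fix s
    assume fin: "(\<integral>\<^sup>+t. ennreal (norm (k t)) * w (s + t) \<partial>lborel) < \<infinity>"
    have w: "w (s + t) = (\<integral>\<^sup>+r. ennreal (norm (l (r - t))) * ennreal (norm (f (s + r))) \<partial>lborel)" for t
      using nn_integral_lborel_translate[of "\<lambda>r. ennreal (norm (l r)) * ennreal (norm (f (s + t + r)))" "-t"]
      by (simp add: w_def algebra_simps)
    have int: "integrable (lborel \<Otimes>\<^sub>M lborel) (\<lambda>(t, r). k t * (l (r - t) * f (s + r)))"
    proof (rule integrableI_bounded)
      have "(\<integral>\<^sup>+x. ennreal (norm (case x of (t, r) \<Rightarrow> k t * (l (r - t) * f (s + r)))) \<partial>(lborel \<Otimes>\<^sub>M lborel))
         = (\<integral>\<^sup>+t. (\<integral>\<^sup>+r. ennreal (norm (k t * (l (r - t) * f (s + r)))) \<partial>lborel) \<partial>lborel)"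
        by (subst lborel.nn_integral_fst[symmetric]) auto
      also have "\<dots> = (\<integral>\<^sup>+t. ennreal (norm (k t)) * w (s + t) \<partial>lborel)"
        unfolding w by (intro nn_integral_cong) (simp add: norm_mult ennreal_mult nn_integral_cmult)
      finally show "(\<integral>\<^sup>+x. ennreal (norm (case x of (t, r) \<Rightarrow> k t * (l (r - t) * f (s + r)))) \<partial>(lborel \<Otimes>\<^sub>M lborel)) < \<infinity>"
        using fin by simp
    qed measurable
    have "conv k (conv l f) s = (LINT t|lborel. (LINT r|lborel. k t * (l (r - t) * f (s + r))))"
      unfolding conv_def
    proof (intro Bochner_Integration.integral_cong refl)
      fix t
      show "k t * (LINT r|lborel. l r * f (s + t + r)) = (LINT r|lborel. k t * (l (r - t) * f (s + r)))"
        using integral_lborel_translate[of "\<lambda>r. l r * f (s + t + r)" "-t"]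
        by (simp add: algebra_simps)
    qed
    also have "\<dots> = (LINT r|lborel. (LINT t|lborel. k t * (l (r - t) * f (s + r))))"
      using lborel_pair.Fubini_integral[OF int] by simp
    also have "\<dots> = conv (convolve k l) f s"
      unfolding conv_def convolve_def by (simp add: mult.assoc[symmetric])
    finally show "conv k (conv l f) s = conv (convolve k l) f s" .
  qed
  then show "(conv_op k o\<^sub>L conv_op l) (abs_L2 f) = conv_op (convolve k l) (abs_L2 f)"
    by (simp add: conv_op_abs borel_sqi_conv borel_L1_convolve k l f abs_L2_eq_iff_borel)
qed

section \<open>Adjoints of convolution operators\<close>

lemma borel_measurable_cnj [measurable (raw)]:
  "f \<in> borel_measurable M \<Longrightarrow> (\<lambda>x. cnj (f x)) \<in> borel_measurable M"
  by (rule measurable_compose[OF _ borel_measurable_continuous_onI]) (auto intro: continuous_intros)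

lemma borel_L1_star: "borel_L1 k \<Longrightarrow> borel_L1 (\<lambda>t. cnj (k (- t)))"
proof -
  assume k: "borel_L1 k"
  note [measurable] = borel_L1_measurable[OF k]
  show ?thesis
    using nn_integral_lborel_reflect[of "\<lambda>t. ennreal (norm (k t))" 0] nn_integral_L1_norm[OF k]
    by (intro borel_L1I) auto
qed

text \<open>Moving the shift from one factor to the other by \<open>s\<close> to
  \<open>s - t\<close> turns \<open>k (t)\<close> into \<open>k (- t)\<close>; the conjugate comes
  from the Hermitian product, of which the inner product here is the real part.\<close>

lemma conv_op_adjoint:
  assumes k: "borel_L1 k"
  shows "conv_op k F \<bullet> G = F \<bullet> conv_op (\<lambda>t. cnj (k (- t))) G"
proof -
  obtain f where f: "borel_sqi f" "F = abs_L2 f" by (rule L2_borel_cases)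
  obtain g where g: "borel_sqi g" "G = abs_L2 g" by (rule L2_borel_cases)
  note [measurable] = borel_L1_measurable[OF k] borel_sqi_measurable[OF f(1)] borel_sqi_measurable[OF g(1)]
  define w where "w s = (\<integral>\<^sup>+t. ennreal (norm (k t)) * ennreal (norm (f (s + t))) \<partial>lborel)" for s
  have [measurable]: "w \<in> borel_measurable borel" unfolding w_def by measurable
  have w2: "(\<integral>\<^sup>+s. (w s)^2 \<partial>lborel) < \<infinity>"
    unfolding w_def using f
    by (intro order.strict_trans1[OF conv_nn_finite[OF k f(1)]]) (simp add: borel_sqi_def ennreal_mult_less_top)
  \<comment> \<open>Cauchy-Schwarz between \<open>g\<close> and the absolute convolution
    \<open>w\<close> gives the joint integrability that both uses of Fubini below rest on.\<close>
  have "(\<integral>\<^sup>+s. ennreal (norm (g s)) * w s \<partial>lborel)^2 < \<infinity>"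
    using w2 g(1)
    by (intro order.strict_trans1[OF Cauchy_Schwarz_nn_integral]) (auto simp: borel_sqi_def ennreal_mult_less_top)
  then have fin: "(\<integral>\<^sup>+s. ennreal (norm (g s)) * w s \<partial>lborel) < \<infinity>"
    by (auto simp: power2_eq_square ennreal_mult_less_top less_top ennreal_mult_eq_top_iff)
  define h where "h s t = k t * f (s + t) * cnj (g s)" for s t
  have [measurable]: "(\<lambda>(s, t). h s t) \<in> borel_measurable (lborel \<Otimes>\<^sub>M lborel)"
    unfolding h_def by measurable
  have int: "integrable (lborel \<Otimes>\<^sub>M lborel) (\<lambda>(s, t). h s t)"
  proof (rule integrableI_bounded)
    have "(\<integral>\<^sup>+x. ennreal (norm (case x of (s, t) \<Rightarrow> h s t)) \<partial>(lborel \<Otimes>\<^sub>M lborel))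
       = (\<integral>\<^sup>+s. (\<integral>\<^sup>+t. ennreal (norm (h s t)) \<partial>lborel) \<partial>lborel)"
      by (subst lborel.nn_integral_fst[symmetric]) auto
    also have "\<dots> = (\<integral>\<^sup>+s. ennreal (norm (g s)) * w s \<partial>lborel)"
      unfolding w_def h_def
      by (intro nn_integral_cong) (simp add: norm_mult ennreal_mult nn_integral_cmult[symmetric] mult_ac)
    finally show "(\<integral>\<^sup>+x. ennreal (norm (case x of (s, t) \<Rightarrow> h s t)) \<partial>(lborel \<Otimes>\<^sub>M lborel)) < \<infinity>"
      using fin by simp
  qed measurable
  have inner: "z \<bullet> y = Re (z * cnj y)" for z y :: complex
    by (simp add: inner_complex_def)
  have int1: "integrable lborel (\<lambda>s. LINT t|lborel. h s t)"
    using lborel_pair.integrable_fst[OF int] by simp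
  have int2: "integrable lborel (\<lambda>t. LINT s|lborel. h s t)"
    using lborel_pair.integrable_snd[OF int] by simp
  have "conv_op k F \<bullet> G = (LINT s|lborel. Re (LINT t|lborel. h s t))"
    by (simp add: f g conv_op_abs k abs_L2_inner borel_sqi_conv inner conv_def h_def)
  also have "\<dots> = Re (LINT s|lborel. LINT t|lborel. h s t)"
    using int1 by simp
  also have "(LINT s|lborel. LINT t|lborel. h s t) = (LINT t|lborel. LINT s|lborel. h s t)"
    using lborel_pair.Fubini_integral[OF int] by simp
  \<comment> \<open>The change of variable that moves the shift is made for fixed \<open>t\<close>,
    which is why the order of integration is exchanged before it and restored after it.\<close>
  also have "\<dots> = (LINT t|lborel. LINT s|lborel. h (s - t) t)"
  proof (rule Bochner_Integration.integral_cong[OF refl])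
    fix t
    show "(LINT s|lborel. h s t) = (LINT s|lborel. h (s - t) t)"
      using integral_lborel_translate[of "\<lambda>s. h s t" "-t"] by (simp add: h_def)
  qed
  also have "\<dots> = (LINT s|lborel. LINT t|lborel. h (s - t) t)"
  proof -
    have "integrable (lborel \<Otimes>\<^sub>M lborel) (\<lambda>(s, t). h (s - t) t)"
    proof (rule integrableI_bounded)
      have "(\<integral>\<^sup>+x. ennreal (norm (case x of (s, t) \<Rightarrow> h (s - t) t)) \<partial>(lborel \<Otimes>\<^sub>M lborel))
        = (\<integral>\<^sup>+t. (\<integral>\<^sup>+s. ennreal (norm (h (s - t) t)) \<partial>lborel) \<partial>lborel)"
        unfolding h_def by (subst lborel_pair.nn_integral_snd[symmetric]) auto
      also have "\<dots> = (\<integral>\<^sup>+t. (\<integral>\<^sup>+s. ennreal (norm (h s t)) \<partial>lborel) \<partial>lborel)"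
      proof (rule nn_integral_cong)
        fix t
        show "(\<integral>\<^sup>+s. ennreal (norm (h (s - t) t)) \<partial>lborel) = (\<integral>\<^sup>+s. ennreal (norm (h s t)) \<partial>lborel)"
          using nn_integral_lborel_translate[of "\<lambda>s. ennreal (norm (h s t))" "-t"] by (simp add: h_def)
      qed
      also have "\<dots> = (\<integral>\<^sup>+x. ennreal (norm (case x of (s, t) \<Rightarrow> h s t)) \<partial>(lborel \<Otimes>\<^sub>M lborel))"
        by (subst lborel_pair.nn_integral_snd[symmetric]) auto
      also have "\<dots> < \<infinity>" using int by (simp add: integrable_iff_bounded)
      finally show "(\<integral>\<^sup>+x. ennreal (norm (case x of (s, t) \<Rightarrow> h (s - t) t)) \<partial>(lborel \<Otimes>\<^sub>M lborel)) < \<infinity>" .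
    qed (simp add: h_def)
    from lborel_pair.Fubini_integral[OF this] show ?thesis by simp
  qed
  also have "Re \<dots> = (LINT s|lborel. f s \<bullet> conv (\<lambda>t. cnj (k (- t))) g s)"
  proof -
    have *: "(LINT t|lborel. h (s - t) t) = f s * cnj (conv (\<lambda>t. cnj (k (- t))) g s)" for s
    proof -
      have "cnj (conv (\<lambda>t. cnj (k (- t))) g s) = (LINT t|lborel. k (- t) * cnj (g (s + t)))"
        using Bochner_Integration.integral_cnj[of lborel "\<lambda>t. cnj (k (- t)) * g (s + t)"]
        by (simp add: conv_def del: Bochner_Integration.integral_cnj)
      also have "\<dots> = (LINT t|lborel. k t * cnj (g (s - t)))"
        using integral_lborel_reflect[of "\<lambda>t. k t * cnj (g (s - t))" 0] by simp
      finally show ?thesis by (simp add: h_def mult_ac)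
    qed
    have "integrable lborel (\<lambda>s. f s * cnj (conv (\<lambda>t. cnj (k (- t))) g s))"
    proof (rule integrableI_bounded)
      let ?v = "conv (\<lambda>t. cnj (k (- t))) g"
      have v: "borel_sqi ?v" by (intro borel_sqi_conv borel_L1_star k g)
      have "(\<integral>\<^sup>+s. ennreal (norm (f s)) * ennreal (norm (?v s)) \<partial>lborel)^2 < \<infinity>"
        using v f(1)
        by (intro order.strict_trans1[OF Cauchy_Schwarz_nn_integral]) (auto simp: borel_sqi_def ennreal_mult_less_top)
      then show "(\<integral>\<^sup>+s. ennreal (norm (f s * cnj (?v s))) \<partial>lborel) < \<infinity>"
        by (auto simp: power2_eq_square ennreal_mult_less_top less_top ennreal_mult_eq_top_iff norm_mult ennreal_mult)
    qed measurable
    then show ?thesis unfolding * inner by (rule integral_Re[symmetric])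
  qed
  also have "\<dots> = F \<bullet> conv_op (\<lambda>t. cnj (k (- t))) G"
    by (simp add: f g conv_op_abs borel_L1_star k abs_L2_inner borel_sqi_conv)
  finally show ?thesis .
qed

section \<open>The algebra generated by the identity and the convolution operators\<close>

lemma scaleC_blinfun_add: "scaleC_blinfun (c + d) = scaleC_blinfun c + scaleC_blinfun d"
  by (rule blinfun_L2_eqI)
     (simp add: scaleC_blinfun_abs plus_blinfun.rep_eq abs_L2_add borel_sqi_square_integrable borel_sqi_mult distrib_right)

lemma scaleC_blinfun_mult: "scaleC_blinfun (c * d) = scaleC_blinfun c o\<^sub>L scaleC_blinfun d"
  by (rule blinfun_L2_eqI) (simp add: scaleC_blinfun_abs borel_sqi_mult mult.assoc)

lemma scaleC_blinfun_of_real: "scaleC_blinfun (of_real r) = r *\<^sub>R id_blinfun"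
  by (rule blinfun_eqI) (simp add: scaleC_blinfun.rep_eq scaleR_scaleC_L2 scaleR_blinfun.rep_eq)

lemma scaleC_blinfun_1 [simp]: "scaleC_blinfun 1 = id_blinfun"
  using scaleC_blinfun_of_real[of 1] by simp

lemma scaleC_blinfun_0 [simp]: "scaleC_blinfun 0 = 0"
  using scaleC_blinfun_of_real[of 0] by simp

lemma norm_scaleC_blinfun_le: "norm (scaleC_blinfun c) \<le> norm c"
  by (rule norm_blinfun_bound) (simp_all add: scaleC_blinfun.rep_eq norm_scaleC_L2)

definition affine_conv :: "complex \<Rightarrow> ('a::euclidean_space \<Rightarrow> complex) \<Rightarrow> 'a L2 \<Rightarrow>\<^sub>L 'a L2" where
  "affine_conv c k = scaleC_blinfun c + conv_op k"

lemma affine_conv_abs: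
  "borel_L1 k \<Longrightarrow> borel_sqi f \<Longrightarrow> affine_conv c k (abs_L2 f) = abs_L2 (\<lambda>s. c * f s + conv k f s)"
  by (simp add: affine_conv_def plus_blinfun.rep_eq scaleC_blinfun_abs conv_op_abs abs_L2_add
      borel_sqi_square_integrable borel_sqi_mult borel_sqi_conv)

lemma norm_affine_conv: "borel_L1 k \<Longrightarrow> norm (affine_conv c k) \<le> norm c + L1_norm k"
  unfolding affine_conv_def
  by (rule order.trans[OF norm_triangle_ineq add_mono[OF norm_scaleC_blinfun_le norm_conv_op]])

lemma affine_conv_add:
  "borel_L1 k \<Longrightarrow> borel_L1 l \<Longrightarrow> affine_conv c k + affine_conv d l = affine_conv (c + d) (\<lambda>t. k t + l t)"
  by (simp add: affine_conv_def conv_op_add scaleC_blinfun_add)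

lemma scaleC_affine_conv:
  "borel_L1 k \<Longrightarrow> scaleC_blinfun d o\<^sub>L affine_conv c k = affine_conv (d * c) (\<lambda>t. d * k t)"
  by (rule blinfun_eqI)
     (simp add: affine_conv_def conv_op_mult scaleC_blinfun_mult plus_blinfun.rep_eq blinfun.add_right)

lemma scaleR_affine_conv:
  "borel_L1 k \<Longrightarrow> r *\<^sub>R affine_conv c k = affine_conv (of_real r * c) (\<lambda>t. of_real r * k t)"
  by (simp add: scaleC_affine_conv[symmetric] scaleC_blinfun_of_real)
     (rule blinfun_eqI, simp add: scaleR_blinfun.rep_eq)

lemma conv_op_scaleC_blinfun: "borel_L1 k \<Longrightarrow> conv_op k o\<^sub>L scaleC_blinfun c = scaleC_blinfun c o\<^sub>L conv_op k"
  by (rule blinfun_eqI) (simp add: scaleC_blinfun.rep_eq conv_op_scaleC)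

lemma conv_op_zero: "conv_op (\<lambda>t. 0) = 0"
  using norm_conv_op[OF borel_L1_zero] by (simp add: L1_norm_def)

lemma affine_conv_compose:
  assumes k: "borel_L1 k" and l: "borel_L1 l"
  shows "affine_conv c k o\<^sub>L affine_conv d l = affine_conv (c * d) (\<lambda>t. c * l t + d * k t + convolve k l t)"
proof (rule blinfun_eqI)
  fix F
  have kd: "conv_op k (scaleC_blinfun d F) = scaleC_blinfun d (conv_op k F)"
    using arg_cong[OF conv_op_scaleC_blinfun[OF k, of d], of "\<lambda>T. blinfun_apply T F"] by simp
  have kl: "conv_op (convolve k l) F = conv_op k (conv_op l F)"
    by (simp add: conv_op_compose[OF k l, symmetric])
  have "conv_op (\<lambda>t. c * l t + d * k t + convolve k l t)
     = (scaleC_blinfun c o\<^sub>L conv_op l) + (scaleC_blinfun d o\<^sub>L conv_op k) + conv_op (convolve k l)"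
    by (simp add: conv_op_add conv_op_mult borel_L1_add borel_L1_mult borel_L1_convolve k l)
  then show "(affine_conv c k o\<^sub>L affine_conv d l) F = affine_conv (c * d) (\<lambda>t. c * l t + d * k t + convolve k l t) F"
    by (simp add: affine_conv_def plus_blinfun.rep_eq blinfun.add_right kd kl scaleC_blinfun_mult)
qed

lemma affine_conv_commute:
  assumes k: "borel_L1 k" and l: "borel_L1 l"
  shows "affine_conv c k o\<^sub>L affine_conv d l = affine_conv d l o\<^sub>L affine_conv c k"
  unfolding affine_conv_compose[OF k l] affine_conv_compose[OF l k]
  using convolve_commute[OF borel_L1_measurable[OF k] borel_L1_measurable[OF l]]
  by (simp add: mult.commute add_ac)

lemma borel_sqi_indicator: "B \<in> sets borel \<Longrightarrow> emeasure lborel B < \<infinity> \<Longrightarrow> borel_sqi (indicator B)" (is "_ \<Longrightarrow> _ \<Longrightarrow> ?P")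
  and norm_abs_L2_indicator:
    "B \<in> sets borel \<Longrightarrow> emeasure lborel B < \<infinity> \<Longrightarrow> (norm (abs_L2 (indicator B)))\<^sup>2 = measure lborel B"
proof -
  assume B: "B \<in> sets borel" "emeasure lborel B < \<infinity>"
  have eq: "(norm (indicator B x :: complex))^2 = indicator B x" for x
    by (simp split: split_indicator)
  show ?P
    using B by (intro borel_sqiI borel_measurable_indicator) (simp_all add: eq integrable_indicator_iff)
  then show "(norm (abs_L2 (indicator B)))\<^sup>2 = measure lborel B"
    using B by (simp add: power2_norm_eq_inner abs_L2_inner) (simp add: power2_norm_eq_inner[symmetric] eq)
qed

section \<open>The convolution algebra as a type\<close>

text \<open>A type of its own gives access to the theory of Banach algebras and of Banach-valued
  integrals under a norm different from the operator norm. Elements are operators rather than pairs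
  of a scalar and a kernel, so equality in the algebra is equality of operators.\<close>

typedef (overloaded) 'a conv_alg =
  "{T :: 'a::euclidean_space L2 \<Rightarrow>\<^sub>L 'a L2. \<exists>c k. borel_L1 k \<and> T = affine_conv c k}"
  morphisms conv_alg_op Abs_conv_alg
  using borel_L1_zero by blast

setup_lifting type_definition_conv_alg

instantiation conv_alg :: (euclidean_space) comm_ring_1
begin

lift_definition zero_conv_alg :: "'a conv_alg" is 0
  by (rule exI[of _ 0], rule exI[of _ "\<lambda>t. 0"]) (simp add: borel_L1_zero affine_conv_def conv_op_zero)

lift_definition one_conv_alg :: "'a conv_alg" is id_blinfun
  by (rule exI[of _ 1], rule exI[of _ "\<lambda>t. 0"]) (simp add: borel_L1_zero affine_conv_def conv_op_zero)

lift_definition plus_conv_alg :: "'a conv_alg \<Rightarrow> 'a conv_alg \<Rightarrow> 'a conv_alg" is "(+)"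
  using affine_conv_add borel_L1_add by blast

lift_definition uminus_conv_alg :: "'a conv_alg \<Rightarrow> 'a conv_alg" is uminus
proof -
  fix T :: "'a L2 \<Rightarrow>\<^sub>L 'a L2"
  assume "\<exists>c k. borel_L1 k \<and> T = affine_conv c k"
  then obtain c k where "borel_L1 k" "T = affine_conv c k" by blast
  then show "\<exists>c k. borel_L1 k \<and> - T = affine_conv c k"
    using scaleR_affine_conv[of k "-1" c] borel_L1_mult[of k "-1"] by auto
qed

lift_definition minus_conv_alg :: "'a conv_alg \<Rightarrow> 'a conv_alg \<Rightarrow> 'a conv_alg" is "(-)"
proof -
  fix S T :: "'a L2 \<Rightarrow>\<^sub>L 'a L2"
  assume "\<exists>c k. borel_L1 k \<and> S = affine_conv c k" "\<exists>c k. borel_L1 k \<and> T = affine_conv c k"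
  then obtain c k d l where *: "borel_L1 k" "T = affine_conv c k" "borel_L1 l" "S = affine_conv d l" by blast
  then have "S - T = affine_conv (d - c) (\<lambda>t. l t + (-1) * k t)"
    using affine_conv_add[of l "\<lambda>t. (-1) * k t" d "-c"] scaleR_affine_conv[of k "-1" c] borel_L1_mult[of k "-1"]
    by (simp add: diff_conv_add_uminus del: add_uminus_conv_diff)
  then show "\<exists>c k. borel_L1 k \<and> S - T = affine_conv c k"
    using borel_L1_add[OF *(3) borel_L1_mult[OF *(1), of "-1"]] by blast
qed

lift_definition times_conv_alg :: "'a conv_alg \<Rightarrow> 'a conv_alg \<Rightarrow> 'a conv_alg" is "(o\<^sub>L)"
proof -
  fix S T :: "'a L2 \<Rightarrow>\<^sub>L 'a L2"
  assume "\<exists>c k. borel_L1 k \<and> S = affine_conv c k" "\<exists>c k. borel_L1 k \<and> T = affine_conv c k"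
  then obtain c k d l where *: "borel_L1 k" "T = affine_conv c k" "borel_L1 l" "S = affine_conv d l" by blast
  then have "borel_L1 (\<lambda>t. d * k t + c * l t + convolve l k t)"
    by (intro borel_L1_add borel_L1_mult borel_L1_convolve)
  then show "\<exists>c k. borel_L1 k \<and> S o\<^sub>L T = affine_conv c k"
    using * affine_conv_compose by blast
qed

instance
proof
  fix a b c :: "'a conv_alg"
  show "a * b * c = a * (b * c)" by transfer (rule blinfun_eqI, simp)
  show "a * b = b * a" by transfer (auto simp: affine_conv_commute)
  show "1 * a = a" by transfer (rule blinfun_eqI, simp)
  show "(a + b) * c = a * c + b * c"
    by transfer (rule blinfun_eqI, simp add: plus_blinfun.rep_eq)
  show "(0::'a conv_alg) \<noteq> 1"
  proof transfer
    \<comment> \<open>A nonzero vector of L2 is needed to tell the identity from 0.\<close>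
    have "(norm (abs_L2 (indicator (ball 0 1 :: 'a set))))\<^sup>2 = measure lborel (ball 0 1 :: 'a set)"
      by (rule norm_abs_L2_indicator) (simp_all add: emeasure_lborel_ball_finite[simplified])
    moreover have "measure lborel (ball 0 1 :: 'a set) > 0"
      by (rule content_ball_pos) simp
    ultimately have "abs_L2 (indicator (ball 0 1 :: 'a set)) \<noteq> 0" by auto
    then have "blinfun_apply 0 (abs_L2 (indicator (ball 0 1 :: 'a set))) \<noteq>
        blinfun_apply id_blinfun (abs_L2 (indicator (ball 0 1 :: 'a set)))"
      by simp
    then show "(0 :: 'a L2 \<Rightarrow>\<^sub>L 'a L2) \<noteq> id_blinfun"
      by metis
  qed
qed (transfer, simp)+

end

text \<open>The value 0 for a non-integrable \<open>k\<close> only makes the map total into the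
  type.\<close>

lift_definition conv_elem :: "complex \<Rightarrow> ('a::euclidean_space \<Rightarrow> complex) \<Rightarrow> 'a conv_alg" is
  "\<lambda>c k. if borel_L1 k then affine_conv c k else 0"
proof -
  fix c :: complex and k :: "'a \<Rightarrow> complex"
  show "\<exists>d l. borel_L1 l \<and> (if borel_L1 k then affine_conv c k else 0) = affine_conv d l"
    using zero_conv_alg.rsp by (cases "borel_L1 k") (auto simp: eq_onp_def)
qed

lemma conv_alg_op_conv_elem: "borel_L1 k \<Longrightarrow> conv_alg_op (conv_elem c k) = affine_conv c k"
  by (simp add: conv_elem.rep_eq)

lemma conv_elem_cases:
  obtains c k where "borel_L1 k" "x = conv_elem c k"
proof -
  obtain c k where "borel_L1 k" "conv_alg_op x = affine_conv c k"
    using conv_alg_op[of x] by blast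
  then have "x = conv_elem c k"
    by (simp add: conv_alg_op_inject[symmetric] conv_alg_op_conv_elem)
  with \<open>borel_L1 k\<close> show ?thesis by (rule that)
qed

lemma conv_elem_add:
  "borel_L1 k \<Longrightarrow> borel_L1 l \<Longrightarrow> conv_elem c k + conv_elem d l = conv_elem (c + d) (\<lambda>t. k t + l t)"
  by transfer (simp add: borel_L1_add affine_conv_add)

lemma conv_elem_mult:
  "borel_L1 k \<Longrightarrow> borel_L1 l \<Longrightarrow>
    conv_elem c k * conv_elem d l = conv_elem (c * d) (\<lambda>t. c * l t + d * k t + convolve k l t)"
  by transfer (simp add: affine_conv_compose borel_L1_add borel_L1_mult borel_L1_convolve)

lemma conv_elem_1: "conv_elem 1 (\<lambda>t. 0) = 1"
  by transfer (simp add: borel_L1_zero affine_conv_def conv_op_zero)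

lemma conv_elem_0: "conv_elem 0 (\<lambda>t. 0) = 0"
  by transfer (simp add: borel_L1_zero affine_conv_def conv_op_zero)

lemma conv_elem_uminus: "borel_L1 k \<Longrightarrow> - conv_elem c k = conv_elem (- c) (\<lambda>t. - k t)"
  using scaleR_affine_conv[of k "-1" c] borel_L1_mult[of k "-1"]
  by transfer simp

lemma conv_elem_diff:
  "borel_L1 k \<Longrightarrow> borel_L1 l \<Longrightarrow> conv_elem c k - conv_elem d l = conv_elem (c - d) (\<lambda>t. k t - l t)"
  using borel_L1_mult[of l "-1"]
  by (simp add: diff_conv_add_uminus conv_elem_uminus conv_elem_add del: add_uminus_conv_diff)

section \<open>The L1 norm on the algebra and its completeness\<close>

text \<open>The infimum of this set is the quotient norm along the map from pairs
  \<open>(c, k)\<close> to operators. It makes sense before scalar and kernel are known to be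
  determined by the operator, which is settled for the scalar only by
  \<open>conv_char_conv_elem\<close>.\<close>

definition conv_norms :: "'a::euclidean_space conv_alg \<Rightarrow> real set" where
  "conv_norms x = {norm c + L1_norm k | c k. borel_L1 k \<and> x = conv_elem c k}"

instantiation conv_alg :: (euclidean_space) real_normed_algebra_1
begin

lift_definition scaleR_conv_alg :: "real \<Rightarrow> 'a conv_alg \<Rightarrow> 'a conv_alg" is scaleR
  using scaleR_affine_conv borel_L1_mult by blast

definition norm_conv_alg :: "'a conv_alg \<Rightarrow> real" where
  "norm_conv_alg x = Inf (conv_norms x)"

definition dist_conv_alg :: "'a conv_alg \<Rightarrow> 'a conv_alg \<Rightarrow> real" where
  "dist_conv_alg x y = norm (x - y)"

definition sgn_conv_alg :: "'a conv_alg \<Rightarrow> 'a conv_alg" where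
  "sgn_conv_alg x = scaleR (inverse (norm x)) x"

definition uniformity_conv_alg :: "('a conv_alg \<times> 'a conv_alg) filter" where
  "uniformity_conv_alg = (INF e\<in>{0 <..}. principal {(x, y). dist x y < e})"

definition open_conv_alg :: "'a conv_alg set \<Rightarrow> bool" where
  "open_conv_alg U \<longleftrightarrow> (\<forall>x\<in>U. eventually (\<lambda>(x', y). x' = x \<longrightarrow> y \<in> U) uniformity)"

lemma conv_norms_ne: "conv_norms (x :: 'a conv_alg) \<noteq> {}"
  by (rule conv_elem_cases[of x]) (auto simp: conv_norms_def)

lemma conv_norms_bdd: "bdd_below (conv_norms (x :: 'a conv_alg))"
  by (rule bdd_belowI[of _ 0]) (auto simp: conv_norms_def)

lemma norm_conv_elem_le: "borel_L1 k \<Longrightarrow> norm (conv_elem c k :: 'a conv_alg) \<le> norm c + L1_norm k"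
  unfolding norm_conv_alg_def by (intro cInf_lower conv_norms_bdd) (auto simp: conv_norms_def)

lemma norm_conv_alg_approx:
  assumes "norm (x :: 'a conv_alg) < r"
  obtains c k where "borel_L1 k" "x = conv_elem c k" "norm c + L1_norm k < r"
proof -
  obtain y where "y \<in> conv_norms x" "y < r"
    using assms cInf_lessD[OF conv_norms_ne] unfolding norm_conv_alg_def by blast
  then show ?thesis using that by (auto simp: conv_norms_def)
qed

lemma norm_conv_alg_leI:
  assumes "\<And>c k. borel_L1 k \<Longrightarrow> (x :: 'a conv_alg) = conv_elem c k \<Longrightarrow> r \<le> norm c + L1_norm k"
  shows "r \<le> norm x"
  unfolding norm_conv_alg_def using assms
  by (intro cInf_greatest conv_norms_ne) (auto simp: conv_norms_def)

lemma norm_conv_alg_op_le: "norm (conv_alg_op x) \<le> norm (x :: 'a conv_alg)"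
  by (rule norm_conv_alg_leI) (simp add: conv_alg_op_conv_elem norm_affine_conv)

lemma scaleR_conv_elem: "borel_L1 k \<Longrightarrow> r *\<^sub>R conv_elem c k = conv_elem (of_real r * c) (\<lambda>t. of_real r * k t)"
  by transfer (simp add: borel_L1_mult scaleR_affine_conv)

lemma norm_conv_alg_scaleR_le: "norm (r *\<^sub>R x) \<le> \<bar>r\<bar> * norm (x :: 'a conv_alg)"
proof (rule field_le_epsilon)
  fix e :: real assume e: "0 < e"
  \<comment> \<open>The summand 1 keeps the denominator positive for \<open>r = 0\<close>, and still
    \<open>\<bar>r\<bar> * d \<le> e\<close>.\<close>
  define d where "d = e / (1 + \<bar>r\<bar>)"
  have d: "d > 0" "\<bar>r\<bar> * d \<le> e" using e by (auto simp: d_def field_simps)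
  obtain c k where ck: "borel_L1 k" "x = conv_elem c k" "norm c + L1_norm k < norm x + d"
    by (rule norm_conv_alg_approx[of x "norm x + d"]) (use d in auto)
  then have "norm (r *\<^sub>R x) \<le> norm (of_real r * c) + L1_norm (\<lambda>t. of_real r * k t)"
    by (simp only: scaleR_conv_elem) (intro norm_conv_elem_le borel_L1_mult)
  also have "\<dots> = \<bar>r\<bar> * (norm c + L1_norm k)"
    by (simp only: L1_norm_mult) (simp add: norm_mult distrib_left)
  also have "\<dots> \<le> \<bar>r\<bar> * (norm x + d)"
    using ck(3) by (intro mult_left_mono) auto
  finally show "norm (r *\<^sub>R x) \<le> \<bar>r\<bar> * norm x + e"
    using d by (simp add: distrib_left)
qed

instance
proof
  fix x y :: "'a conv_alg" and r s :: real
  show "r *\<^sub>R (x + y) = r *\<^sub>R x + r *\<^sub>R y" by transfer (simp add: scaleR_add_right)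
  show "(r + s) *\<^sub>R x = r *\<^sub>R x + s *\<^sub>R x" by transfer (simp add: scaleR_add_left)
  show "r *\<^sub>R s *\<^sub>R x = (r * s) *\<^sub>R x" by transfer simp
  show "1 *\<^sub>R x = x" by transfer simp
  show "r *\<^sub>R x * y = r *\<^sub>R (x * y)"
    by transfer (rule blinfun_eqI, simp add: scaleR_blinfun.rep_eq)
  show "x * r *\<^sub>R y = r *\<^sub>R (x * y)"
    by transfer (rule blinfun_eqI, simp add: scaleR_blinfun.rep_eq blinfun.scaleR_right)
  show "dist x y = norm (x - y)" by (simp add: dist_conv_alg_def)
  show "sgn x = inverse (norm x) *\<^sub>R x" by (simp add: sgn_conv_alg_def)
  show "uniformity = (INF e\<in>{0 <..}. principal {(x :: 'a conv_alg, y). dist x y < e})"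
    by (simp add: uniformity_conv_alg_def)
  show "open U \<longleftrightarrow> (\<forall>x\<in>U. eventually (\<lambda>(x', y). x' = x \<longrightarrow> y \<in> U) uniformity)"
    for U :: "'a conv_alg set"
    by (simp add: open_conv_alg_def)
  have norm0: "norm (0 :: 'a conv_alg) \<le> 0"
    using norm_conv_elem_le[OF borel_L1_zero, of 0] by (simp add: conv_elem_0 L1_norm_def)
  show "norm x = 0 \<longleftrightarrow> x = 0"
  proof
    assume "norm x = 0"
    \<comment> \<open>Definiteness is inherited from the operator norm, which the algebra norm
      dominates.\<close>
    then have "conv_alg_op x = 0" using norm_conv_alg_op_le[of x] by simp
    then show "x = 0" by transfer
  next
    assume "x = 0"
    then have "norm x \<le> 0" using norm0 by simp
    then show "norm x = 0" using norm_conv_alg_op_le[of x] norm_ge_zero[of "conv_alg_op x"] by linarith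
  qed
  show "norm (x + y) \<le> norm x + norm y"
  proof (rule field_le_epsilon)
    fix e :: real assume e: "0 < e"
    obtain c k where ck: "borel_L1 k" "x = conv_elem c k" "norm c + L1_norm k < norm x + e/2"
      by (rule norm_conv_alg_approx[of x "norm x + e/2"]) (use e in auto)
    obtain d l where dl: "borel_L1 l" "y = conv_elem d l" "norm d + L1_norm l < norm y + e/2"
      by (rule norm_conv_alg_approx[of y "norm y + e/2"]) (use e in auto)
    have "norm (x + y) \<le> norm (c + d) + L1_norm (\<lambda>t. k t + l t)"
      using ck dl by (simp only: conv_elem_add) (intro norm_conv_elem_le borel_L1_add)
    also have "\<dots> \<le> norm c + norm d + (L1_norm k + L1_norm l)"
      using ck dl by (intro add_mono norm_triangle_ineq L1_norm_add)
    finally show "norm (x + y) \<le> norm x + norm y + e"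
      using ck dl by linarith
  qed
  show "norm (x * y) \<le> norm x * norm y"
  proof -
    have nn: "0 \<le> norm z" for z :: "'a conv_alg"
      using norm_conv_alg_op_le[of z] norm_ge_zero[of "conv_alg_op z"] by linarith
    \<comment> \<open>The infimum need not be attained, so strict upper bounds are used to pick
      nearly optimal representations; the right-hand limit below removes the slack.\<close>
    have le: "norm (x * y) \<le> a * b" if xy: "norm x < a" "norm y < b" for a b
    proof -
      obtain c k where ck: "borel_L1 k" "x = conv_elem c k" "norm c + L1_norm k < a"
        by (rule norm_conv_alg_approx[OF xy(1)])
      obtain d l where dl: "borel_L1 l" "y = conv_elem d l" "norm d + L1_norm l < b"
        by (rule norm_conv_alg_approx[OF xy(2)])
      have "norm (x * y) \<le> norm (c * d) + L1_norm (\<lambda>t. c * l t + d * k t + convolve k l t)"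
        using ck dl
        by (simp only: conv_elem_mult) (intro norm_conv_elem_le borel_L1_add borel_L1_mult borel_L1_convolve)
      also have "\<dots> \<le> norm c * norm d + (norm c * L1_norm l + norm d * L1_norm k + L1_norm k * L1_norm l)"
        using ck dl
        by (intro add_mono order.trans[OF L1_norm_add] borel_L1_add borel_L1_mult borel_L1_convolve L1_norm_convolve)
           (simp_all add: L1_norm_mult norm_mult)
      also have "\<dots> = (norm c + L1_norm k) * (norm d + L1_norm l)"
        by (simp add: algebra_simps)
      also have "\<dots> \<le> a * b"
        using ck dl L1_norm_nonneg[of k] L1_norm_nonneg[of l] norm_ge_zero[of c] norm_ge_zero[of d]
        by (intro mult_mono) linarith+
      finally show ?thesis .
    qed
    show ?thesis
    proof (rule tendsto_lowerbound)
      show "((\<lambda>e. (norm x + e) * (norm y + e)) \<longlongrightarrow> norm x * norm y) (at_right 0)"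
        by (auto intro!: tendsto_eq_intros)
      show "\<forall>\<^sub>F e in at_right 0. norm (x * y) \<le> (norm x + e) * (norm y + e)"
        unfolding eventually_at_right_field by (intro exI[of _ 1]) (auto intro!: le)
    qed simp
  qed
  show "norm (r *\<^sub>R x) = \<bar>r\<bar> * norm x"
  proof (rule antisym)
    show "\<bar>r\<bar> * norm x \<le> norm (r *\<^sub>R x)"
    proof (cases "r = 0")
      case True
      then show ?thesis
        using order.trans[OF norm_ge_zero norm_conv_alg_op_le[of "r *\<^sub>R x"]] by simp
    next
      case False
      have "norm (inverse r *\<^sub>R r *\<^sub>R x) \<le> \<bar>inverse r\<bar> * norm (r *\<^sub>R x)"
        by (rule norm_conv_alg_scaleR_le)
      moreover have "inverse r *\<^sub>R r *\<^sub>R x = x"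
        using False by transfer simp
      ultimately show ?thesis using False by (simp add: field_simps abs_inverse)
    qed
  qed (rule norm_conv_alg_scaleR_le)
  show "norm (1 :: 'a conv_alg) = 1"
  proof (rule antisym)
    show "norm (1 :: 'a conv_alg) \<le> 1"
      using norm_conv_elem_le[OF borel_L1_zero, of 1] by (simp add: conv_elem_1 L1_norm_def)
    have "norm (id_blinfun :: 'a L2 \<Rightarrow>\<^sub>L 'a L2) = 1"
    proof -
      have "conv_alg_op (1 :: 'a conv_alg) \<noteq> conv_alg_op 0"
        by (simp add: conv_alg_op_inject)
      then obtain F :: "'a L2" where "F \<noteq> 0"
        by (metis blinfun_eqI blinfun.zero_right zero_conv_alg.rep_eq)
      then have "norm F \<le> norm (id_blinfun :: 'a L2 \<Rightarrow>\<^sub>L 'a L2) * norm F"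
        using norm_blinfun[of id_blinfun F] by simp
      then have "1 \<le> norm (id_blinfun :: 'a L2 \<Rightarrow>\<^sub>L 'a L2)" using \<open>F \<noteq> 0\<close> by simp
      then show ?thesis using norm_blinfun_id_le by (intro antisym)
    qed
    then show "1 \<le> norm (1 :: 'a conv_alg)"
      using norm_conv_alg_op_le[of 1] by (simp add: one_conv_alg.rep_eq)
  qed
qed

end

lemma conv_elem_sum:
  fixes k :: "nat \<Rightarrow> 'a::euclidean_space \<Rightarrow> complex"
  assumes "\<And>i. borel_L1 (k i)"
  shows "(\<Sum>i<n. conv_elem (c i) (k i)) = conv_elem (\<Sum>i<n. c i) (\<lambda>t. \<Sum>i<n. k i t)
    \<and> borel_L1 (\<lambda>t. \<Sum>i<n. k i t)"
  by (induct n) (auto simp: conv_elem_0 borel_L1_zero conv_elem_add borel_L1_add assms)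

text \<open>The Riesz-Fischer argument: the series of moduli has finite integral, so the kernels
  converge absolutely almost everywhere, and the geometric tails upgrade this to convergence in
  L1.\<close>

lemma conv_elem_summable:
  fixes k :: "nat \<Rightarrow> 'a::euclidean_space \<Rightarrow> complex"
  assumes k: "\<And>i. borel_L1 (k i)" and bound: "\<And>i. norm (c i) + L1_norm (k i) \<le> (1/2)^i"
  shows "summable (\<lambda>i. conv_elem (c i) (k i))"
proof -
  note [measurable] = borel_L1_measurable[OF k]
  have half: "summable (\<lambda>i. (1/2::real)^i)" by (rule summable_geometric) simp
  have kb: "L1_norm (k i) \<le> (1/2)^i" for i using bound[of i] norm_ge_zero[of "c i"] by linarith
  have cb: "norm (c i) \<le> (1/2)^i" for i using bound[of i] L1_norm_nonneg[of "k i"] by linarith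
  have sc: "summable c"
    by (rule summable_norm_cancel, rule summable_comparison_test'[OF half, of 0]) (simp add: cb)
  \<comment> \<open>Where the series diverges this value is arbitrary, which by \<open>ae\<close>
    below concerns only a null set.\<close>
  define k' where "k' t = (\<Sum>i. k i t)" for t
  have [measurable]: "k' \<in> borel_measurable borel" unfolding k'_def by measurable
  have tail: "(\<integral>\<^sup>+t. (\<Sum>i. ennreal (norm (k (i + n) t))) \<partial>lborel) \<le> ennreal (2 * (1/2)^n)" for n
  proof -
    have "(\<lambda>i. (1/2::real)^i * (1/2)^n) sums (1 / (1 - 1/2) * (1/2)^n)"
      by (intro sums_mult2 geometric_sums) simp
    then have s: "summable (\<lambda>i. (1/2::real)^(i+n))" "(\<Sum>i. (1/2::real)^(i+n)) = 2 * (1/2)^n"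
      by (auto simp: power_add sums_iff)
    have "(\<integral>\<^sup>+t. (\<Sum>i. ennreal (norm (k (i + n) t))) \<partial>lborel) = (\<Sum>i. ennreal (L1_norm (k (i + n))))"
      by (subst nn_integral_suminf) (auto simp: nn_integral_L1_norm k)
    also have "\<dots> \<le> (\<Sum>i. ennreal ((1/2)^(i+n)))"
      by (intro suminf_le ennreal_leI kb) auto
    also have "\<dots> = ennreal (\<Sum>i. (1/2)^(i+n))"
      by (intro suminf_ennreal2 s) simp
    finally show ?thesis by (simp add: s)
  qed
  have "(\<integral>\<^sup>+t. (\<Sum>i. ennreal (norm (k i t))) \<partial>lborel) < \<infinity>"
    using tail[of 0] by (auto elim!: le_less_trans)
  then have "AE t in lborel. (\<Sum>i. ennreal (norm (k i t))) \<noteq> \<infinity>"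
    by (intro nn_integral_PInf_AE) auto
  then have ae: "AE t in lborel. summable (\<lambda>i. norm (k i t))"
    by eventually_elim (auto intro: summable_suminf_not_top)
  have diff: "(\<integral>\<^sup>+t. ennreal (norm (k' t - (\<Sum>i<n. k i t))) \<partial>lborel) \<le> ennreal (2 * (1/2)^n)" for n
  proof -
    have "AE t in lborel. ennreal (norm (k' t - (\<Sum>i<n. k i t))) \<le> (\<Sum>i. ennreal (norm (k (i + n) t)))"
      using ae
    proof eventually_elim
      fix t assume s: "summable (\<lambda>i. norm (k i t))"
      then have s': "summable (\<lambda>i. norm (k (i + n) t))" by (rule summable_ignore_initial_segment)
      have "k' t - (\<Sum>i<n. k i t) = (\<Sum>i. k (i + n) t)"
        unfolding k'_def by (subst suminf_minus_initial_segment[OF summable_norm_cancel[OF s]]) simp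
      then have "norm (k' t - (\<Sum>i<n. k i t)) \<le> (\<Sum>i. norm (k (i + n) t))"
        using summable_norm[OF s'] by simp
      then show "ennreal (norm (k' t - (\<Sum>i<n. k i t))) \<le> (\<Sum>i. ennreal (norm (k (i + n) t)))"
        by (subst suminf_ennreal2[OF _ s']) (auto intro: ennreal_leI)
    qed
    then show ?thesis by (intro order.trans[OF nn_integral_mono_AE tail])
  qed
  have k': "borel_L1 k'"
    using diff[of 0] by (intro borel_L1I) (auto elim!: le_less_trans)
  have "(\<lambda>n. (\<Sum>i<n. conv_elem (c i) (k i))) \<longlonglongrightarrow> conv_elem (suminf c) k'"
  proof (rule LIM_zero_cancel, rule Lim_null_comparison)
    show "\<forall>\<^sub>F n in sequentially. norm ((\<Sum>i<n. conv_elem (c i) (k i)) - conv_elem (suminf c) k')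
        \<le> norm ((\<Sum>i<n. c i) - suminf c) + 2 * (1/2)^n"
    proof (intro always_eventually allI)
      fix n
      have S: "(\<Sum>i<n. conv_elem (c i) (k i)) = conv_elem (\<Sum>i<n. c i) (\<lambda>t. \<Sum>i<n. k i t)"
        and S1: "borel_L1 (\<lambda>t. \<Sum>i<n. k i t)" using conv_elem_sum k by blast+
      have dL: "borel_L1 (\<lambda>t. (\<Sum>i<n. k i t) - k' t)"
        using borel_L1_add[OF S1 borel_L1_mult[OF k', of "-1"]] by simp
      have "L1_norm (\<lambda>t. (\<Sum>i<n. k i t) - k' t) \<le> 2 * (1/2)^n"
        using diff[of n] by (intro L1_norm_leI dL) (auto simp: norm_minus_commute)
      then show "norm ((\<Sum>i<n. conv_elem (c i) (k i)) - conv_elem (suminf c) k')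
        \<le> norm ((\<Sum>i<n. c i) - suminf c) + 2 * (1/2)^n"
        unfolding S conv_elem_diff[OF S1 k']
        using norm_conv_elem_le[OF dL, of "(\<Sum>i<n. c i) - suminf c"] by simp
    qed
    have "(\<lambda>n. norm ((\<Sum>i<n. c i) - suminf c)) \<longlonglongrightarrow> 0"
      using summable_LIMSEQ[OF sc] by (intro tendsto_norm_zero LIM_zero)
    moreover have "(\<lambda>n. 2 * (1/2::real)^n) \<longlonglongrightarrow> 0"
      by (intro tendsto_mult_right_zero LIMSEQ_power_zero) simp
    ultimately show "(\<lambda>n. norm ((\<Sum>i<n. c i) - suminf c) + 2 * (1/2)^n) \<longlonglongrightarrow> 0"
      using tendsto_add by fastforce
  qed
  then show ?thesis by (auto simp: summable_def sums_def)
qed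

instance conv_alg :: (euclidean_space) banach
proof
  fix X :: "nat \<Rightarrow> 'a conv_alg"
  assume X: "Cauchy X"
  have "\<forall>n. \<exists>M. \<forall>i\<ge>M. \<forall>j\<ge>M. norm (X i - X j) < (1/2)^n"
    using CauchyD[OF X] by simp
  then obtain M where M: "\<And>n i j. i \<ge> M n \<Longrightarrow> j \<ge> M n \<Longrightarrow> norm (X i - X j) < (1/2)^n"
    by metis
  \<comment> \<open>Summing the indices makes \<open>r n\<close> at least \<open>M n\<close>, and
    the added 1 makes \<open>r\<close> strictly increasing; consecutive terms along \<open>r\<close>
    then differ by less than \<open>(1/2)^n\<close>.\<close>
  define r where "r n = (\<Sum>i\<le>n. M i + 1)" for n
  have r: "strict_mono r" "M n \<le> r n" for n
    using member_le_sum[of n "{..n}" "\<lambda>i. M i + 1"] by (simp_all add: r_def strict_mono_Suc_iff)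
  have "\<exists>c k. borel_L1 k \<and> X (r (Suc n)) - X (r n) = conv_elem c k \<and> norm c + L1_norm k < (1/2)^n" for n
  proof -
    have "norm (X (r (Suc n)) - X (r n)) < (1/2)^n"
      using r(2)[of n] strict_mono_less_eq[OF r(1), of n "Suc n"] by (intro M) auto
    then show ?thesis by (rule norm_conv_alg_approx) blast
  qed
  then obtain c k where ck: "\<And>n. borel_L1 (k n)" "\<And>n. X (r (Suc n)) - X (r n) = conv_elem (c n) (k n)"
      "\<And>n. norm (c n) + L1_norm (k n) < (1/2)^n"
    by metis
  have "summable (\<lambda>n. X (r (Suc n)) - X (r n))"
    unfolding ck(2) using ck by (intro conv_elem_summable less_imp_le)
  then have "(\<lambda>n. X (r 0) + (\<Sum>i<n. X (r (Suc i)) - X (r i))) \<longlonglongrightarrow> X (r 0) + (\<Sum>i. X (r (Suc i)) - X (r i))"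
    by (intro tendsto_intros summable_LIMSEQ)
  moreover have "X (r 0) + (\<Sum>i<n. X (r (Suc i)) - X (r i)) = X (r n)" for n
    by (subst sum_lessThan_telescope) simp
  ultimately have "(X \<circ> r) \<longlonglongrightarrow> X (r 0) + (\<Sum>i. X (r (Suc i)) - X (r i))"
    by (simp add: o_def)
  then show "convergent X"
    using Cauchy_converges_subseq[OF X r(1)] by (auto simp: convergent_def)
qed

section \<open>The character at infinity\<close>

text \<open>Truncation in both domain and size: the size cutoff gives
  \<open>(norm l)^2 \<le> n * norm k\<close>, hence square integrability, and dominated convergence
  makes the error small. Both the scalar part and the spectral radius are studied first on such
  kernels.\<close>

lemma L1_truncation:
  fixes k :: "'a::euclidean_space \<Rightarrow> complex"
  assumes k: "borel_L1 k" and e: "0 < e"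
  obtains l R where "borel_L1 l" "borel_sqi l" "0 \<le> R" "\<And>t. R < norm t \<Longrightarrow> l t = 0"
    "borel_L1 (\<lambda>t. k t - l t)" "L1_norm (\<lambda>t. k t - l t) < e"
proof -
  note [measurable] = borel_L1_measurable[OF k]
  have ki: "integrable lborel (\<lambda>t. norm (k t))" using k by (simp add: borel_L1_def)
  define l where "l n t = (if norm t \<le> real n \<and> norm (k t) \<le> real n then k t else 0)" for n t
  have [measurable]: "l n \<in> borel_measurable borel" for n
    unfolding l_def by measurable
  have l1: "borel_L1 (l n)" for n
    unfolding borel_L1_def using ki
    by (auto intro: Bochner_Integration.integrable_bound simp: l_def)
  have l2: "borel_sqi (l n)" for n
  proof (rule borel_sqiI)
    show "integrable lborel (\<lambda>t. (norm (l n t))\<^sup>2)"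
    proof (rule Bochner_Integration.integrable_bound[of _ "\<lambda>t. real n * norm (k t)"])
      show "AE t in lborel. norm ((norm (l n t))\<^sup>2) \<le> norm (real n * norm (k t))"
        by (auto simp: l_def power2_eq_square intro!: mult_right_mono AE_I2)
    qed (use ki in auto)
  qed simp
  have "(\<lambda>n. LINT t|lborel. norm (k t - l n t)) \<longlonglongrightarrow> (LINT t::'a|lborel. 0)"
  proof (rule integral_dominated_convergence[where w = "\<lambda>t. norm (k t)"])
    show "AE t in lborel. (\<lambda>n. norm (k t - l n t)) \<longlonglongrightarrow> 0"
    proof (rule AE_I2, rule tendsto_eventually)
      fix t
      obtain N where N: "max (norm t) (norm (k t)) \<le> real N" using real_arch_simple by blast
      show "\<forall>\<^sub>F n in sequentially. norm (k t - l n t) = 0"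
        using eventually_ge_at_top[of N] 
      proof eventually_elim
        fix n assume "N \<le> n"
        then have "real N \<le> real n" by simp
        with N show "norm (k t - l n t) = 0" by (simp add: l_def)
      qed
    qed
  qed (use ki in \<open>auto simp: l_def\<close>)
  then have "(\<lambda>n. L1_norm (\<lambda>t. k t - l n t)) \<longlonglongrightarrow> 0"
    by (simp add: L1_norm_def)
  then have "\<forall>\<^sub>F n in sequentially. L1_norm (\<lambda>t. k t - l n t) < e"
    by (rule order_tendstoD) (rule e)
  then obtain n where n: "L1_norm (\<lambda>t. k t - l n t) < e"
    by (auto simp: eventually_sequentially)
  have "borel_L1 (\<lambda>t. k t - l n t)"
    using borel_L1_add[OF k borel_L1_mult[OF l1[of n], of "-1"]] by simp
  from that[OF l1 l2 _ _ this n, of "real n"] show ?thesis by (auto simp: l_def)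
qed

text \<open>A form of the Riemann-Lebesgue lemma without Fourier transform. Unit vectors
  concentrated on small balls have small L1 norm; when vector and kernel exchange roles, that L1
  norm bounds the result.\<close>

lemma conv_op_concentrated:
  fixes k :: "'a::euclidean_space \<Rightarrow> complex"
  assumes k: "borel_L1 k" and e: "0 < e"
  obtains G where "norm G = 1" "norm (conv_op k G) < e"
proof -
  obtain l R where l: "borel_L1 l" "borel_sqi l" "borel_L1 (\<lambda>t. k t - l t)" "L1_norm (\<lambda>t. k t - l t) < e/2"
    by (rule L1_truncation[OF k, of "e/2"]) (use e in auto)
  note [measurable] = borel_L1_measurable[OF l(1)]
  define h where "h t = l (- t)" for t
  have h: "borel_sqi h"
    using l(2) nn_integral_lborel_reflect[of "\<lambda>t. ennreal (norm (l t))^2" 0]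
    by (auto simp: borel_sqi_def h_def[abs_def])
  define V where "V r = measure lborel (ball (0::'a) r)" for r
  have V: "V r = unit_ball_vol (real DIM('a)) * r ^ DIM('a)" if "r > 0" for r
    using that unfolding V_def by (subst content_ball) auto
  have "((\<lambda>r. sqrt (unit_ball_vol (real DIM('a)) * r ^ DIM('a)) * norm (abs_L2 h)) \<longlongrightarrow> 0) (at_right 0)"
    by (auto intro!: tendsto_eq_intros)
  then have "\<forall>\<^sub>F r in at_right 0. sqrt (unit_ball_vol (real DIM('a)) * r ^ DIM('a)) * norm (abs_L2 h) < e/2"
    by (rule order_tendstoD) (use e in simp)
  then have "\<forall>\<^sub>F r in at_right 0. 0 < r \<and> sqrt (unit_ball_vol (real DIM('a)) * r ^ DIM('a)) * norm (abs_L2 h) < e/2"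
    using eventually_at_right_less[of 0] by eventually_elim simp
  then obtain r where r: "r > 0" "sqrt (unit_ball_vol (real DIM('a)) * r ^ DIM('a)) * norm (abs_L2 h) < e/2"
    using eventually_happens[of _ "at_right (0::real)"] by auto
  define B where "B = ball (0::'a) r"
  have B: "B \<in> sets borel" "emeasure lborel B < \<infinity>"
    unfolding B_def using emeasure_lborel_ball_finite[of "0::'a" r] by auto
  have Vr: "V r > 0" unfolding V_def using r(1) by (rule content_ball_pos)
  \<comment> \<open>Normalised to L2 norm 1, so that its L1 norm \<open>sqrt (V r)\<close> tends to
    0 with \<open>r\<close>.\<close>
  define g :: "'a \<Rightarrow> complex" where "g t = of_real (1 / sqrt (V r)) * indicator B t" for t
  have g: "borel_sqi g" unfolding g_def by (intro borel_sqi_mult borel_sqi_indicator B)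
  have "abs_L2 g = scaleC_L2 (of_real (1 / sqrt (V r))) (abs_L2 (indicator B))"
    unfolding g_def by (rule abs_L2_scaleC[OF borel_sqi_square_integrable[OF borel_sqi_indicator[OF B]], symmetric])
  then have "norm (abs_L2 g) = 1 / sqrt (V r) * norm (abs_L2 (indicator B :: 'a \<Rightarrow> complex))"
    using Vr by (simp add: norm_scaleC_L2 norm_divide)
  also have "norm (abs_L2 (indicator B :: 'a \<Rightarrow> complex)) = sqrt (V r)"
    using norm_abs_L2_indicator[OF B] by (metis V_def B_def norm_ge_zero real_sqrt_unique)
  finally have ng: "norm (abs_L2 g) = 1" using Vr by simp
  have nB: "norm (indicator B x :: complex) = indicator B x" for x by (simp split: split_indicator)
  have mB: "(indicator B :: 'a \<Rightarrow> complex) \<in> borel_measurable borel"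
    using B by (intro borel_measurable_indicator) simp
  have "integrable lborel (\<lambda>x. norm (indicator B x :: complex))"
    using B by (simp add: nB integrable_indicator_iff)
  then have "borel_L1 (indicator B :: 'a \<Rightarrow> complex)"
    using mB by (simp add: borel_L1_def integrable_norm_iff)
  then have g1: "borel_L1 g" unfolding g_def by (rule borel_L1_mult)
  have "L1_norm (indicator B :: 'a \<Rightarrow> complex) = V r"
    using B by (simp add: L1_norm_def nB) (simp add: V_def B_def)
  then have "L1_norm g = V r / sqrt (V r)"
    unfolding g_def L1_norm_mult using Vr by (simp add: norm_divide)
  then have ng1: "L1_norm g = sqrt (V r)" using Vr by (simp add: real_div_sqrt)
  note [measurable] = borel_L1_measurable[OF g1]
  have even: "g (- t) = g t" for t by (simp add: g_def B_def indicator_def)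
  \<comment> \<open>Symmetry of the ball lets \<open>g\<close> act as the kernel and the reflection
    \<open>h\<close> of \<open>l\<close> as the vector, which is in L2 by the truncation.\<close>
  have "conv l g = conv g h"
  proof
    fix s
    have "conv l g s = (LINT t|lborel. l (t - s) * g t)"
      using integral_lborel_translate[of "\<lambda>t. l t * g (s + t)" "-s"] by (simp add: conv_def)
    also have "\<dots> = (LINT t|lborel. l (- s - t) * g t)"
      using integral_lborel_reflect[of "\<lambda>t. l (t - s) * g t" 0] by (simp add: even minus_diff_commute[of s])
    finally show "conv l g s = conv g h s" by (simp add: conv_def h_def mult.commute)
  qed
  then have "norm (conv_op l (abs_L2 g)) = norm (conv_op g (abs_L2 h))"
    by (simp add: conv_op_abs l g g1 h)
  also have "\<dots> \<le> L1_norm g * norm (abs_L2 h)"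
    by (rule order.trans[OF norm_blinfun mult_right_mono[OF norm_conv_op[OF g1]]]) simp
  also have "\<dots> < e/2" using r V[of r] by (simp add: ng1)
  finally have 1: "norm (conv_op l (abs_L2 g)) < e/2" .
  have "norm (conv_op (\<lambda>t. k t - l t) (abs_L2 g)) \<le> L1_norm (\<lambda>t. k t - l t) * norm (abs_L2 g)"
    by (rule order.trans[OF norm_blinfun mult_right_mono[OF norm_conv_op[OF l(3)]]]) simp
  with ng l(4) have 2: "norm (conv_op (\<lambda>t. k t - l t) (abs_L2 g)) < e/2" by simp
  have "conv_op k = conv_op l + conv_op (\<lambda>t. k t - l t)"
    using conv_op_add[OF l(1,3)] by simp
  then have "norm (conv_op k (abs_L2 g)) < e"
    using 1 2 norm_triangle_ineq[of "conv_op l (abs_L2 g)" "conv_op (\<lambda>t. k t - l t) (abs_L2 g)"]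
    by (simp add: plus_blinfun.rep_eq)
  then show ?thesis by (rule that[OF ng])
qed

text \<open>On the unit vectors just constructed the convolution part nearly vanishes, so only the
  scalar is seen.\<close>

lemma norm_scalar_part_le:
  assumes k: "borel_L1 k"
  shows "norm c \<le> norm (affine_conv c k)"
proof (rule field_le_epsilon)
  fix e :: real assume "0 < e"
  then obtain G where G: "norm G = 1" "norm (conv_op k G) < e"
    by (rule conv_op_concentrated[OF k])
  have "norm c = norm (affine_conv c k G - conv_op k G)"
    using G by (simp add: affine_conv_def plus_blinfun.rep_eq scaleC_blinfun.rep_eq norm_scaleC_L2)
  also have "\<dots> \<le> norm (affine_conv c k) + e"
    using norm_triangle_ineq4[of "affine_conv c k G" "conv_op k G"] norm_blinfun[of "affine_conv c k" G] G
    by simp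
  finally show "norm c \<le> norm (affine_conv c k) + e" .
qed

text \<open>The value of the Fourier transform at infinity, equivalently the quotient map modulo the
  ideal of pure convolution operators.\<close>

definition conv_char :: "'a::euclidean_space conv_alg \<Rightarrow> complex" where
  "conv_char x = (THE c. \<exists>k. borel_L1 k \<and> x = conv_elem c k)"

lemma conv_char_conv_elem:
  assumes k: "borel_L1 k"
  shows "conv_char (conv_elem c k) = c"
  unfolding conv_char_def
proof (rule the_equality)
  fix d assume "\<exists>l. borel_L1 l \<and> conv_elem c k = conv_elem d l"
  then obtain l where l: "borel_L1 l" "conv_elem c k = conv_elem d l" by blast
  have kl: "borel_L1 (\<lambda>t. k t - l t)"
    using borel_L1_add[OF k borel_L1_mult[OF l(1), of "-1"]] by simp
  have "conv_elem (c - d) (\<lambda>t. k t - l t) = 0"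
    using conv_elem_diff[OF k l(1), of c d] l(2) by simp
  then have "affine_conv (c - d) (\<lambda>t. k t - l t) = 0"
    using conv_alg_op_conv_elem[OF kl] zero_conv_alg.rep_eq by metis
  then show "d = c" using norm_scalar_part_le[OF kl, of "c - d"] by simp
qed (use k in blast)

lemma norm_conv_char_op: "norm (conv_char x) \<le> norm (conv_alg_op x)"
  by (rule conv_elem_cases[of x])
     (simp add: conv_char_conv_elem conv_alg_op_conv_elem norm_scalar_part_le)

lemma conv_char_add: "conv_char (x + y) = conv_char x + conv_char y"
  by (rule conv_elem_cases[of x], rule conv_elem_cases[of y])
     (simp add: conv_elem_add borel_L1_add conv_char_conv_elem)

lemma conv_char_mult: "conv_char (x * y) = conv_char x * conv_char y"
  by (rule conv_elem_cases[of x], rule conv_elem_cases[of y])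
     (simp add: conv_elem_mult borel_L1_add borel_L1_mult borel_L1_convolve conv_char_conv_elem)

lemma conv_char_1: "conv_char 1 = 1"
  unfolding conv_elem_1[symmetric] by (rule conv_char_conv_elem[OF borel_L1_zero])

lemma bounded_linear_conv_char: "bounded_linear conv_char"
proof
  fix x y :: "'a conv_alg" and r
  show "conv_char (x + y) = conv_char x + conv_char y" by (rule conv_char_add)
  show "conv_char (r *\<^sub>R x) = r *\<^sub>R conv_char x"
    by (rule conv_elem_cases[of x])
       (simp add: scaleR_conv_elem borel_L1_mult conv_char_conv_elem, simp add: scaleR_conv_of_real)
  show "\<exists>K. \<forall>x :: 'a conv_alg. norm (conv_char x) \<le> norm x * K"
    using norm_conv_char_op norm_conv_alg_op_le by (intro exI[of _ 1]) (auto intro: order.trans)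
qed

section \<open>Spectral radius in the convolution algebra\<close>

lemma power2_le_imp_le_ennreal: "a \<le> ennreal r" if "a\<^sup>2 \<le> (ennreal r)\<^sup>2" "0 \<le> r"
  using that
  by (cases a) (auto simp: ennreal_power top_unique power2_eq_square ennreal_mult[symmetric]
      intro: power2_le_imp_le[unfolded power2_eq_square])

text \<open>Cauchy-Schwarz against the indicator of the ball of radius \<open>\<rho>\<close>, whose
  volume stands under the root.\<close>

lemma L1_of_bounded_support:
  fixes g :: "'a::euclidean_space \<Rightarrow> complex"
  assumes g: "borel_sqi g" and supp: "\<And>t. \<rho> < norm t \<Longrightarrow> g t = 0" and \<rho>: "0 \<le> \<rho>"
  shows "borel_L1 g" "L1_norm g \<le> sqrt (unit_ball_vol (real DIM('a)) * \<rho> ^ DIM('a)) * norm (abs_L2 g)"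
proof -
  note [measurable] = borel_sqi_measurable[OF g]
  define v where "v = unit_ball_vol (real DIM('a)) * \<rho> ^ DIM('a)"
  have v: "0 \<le> v" using \<rho> by (simp add: v_def)
  have "(\<integral>\<^sup>+t. ennreal (norm (g t)) \<partial>lborel) = (\<integral>\<^sup>+t. ennreal (norm (g t)) * indicator (cball 0 \<rho>) t \<partial>lborel)"
    using supp by (intro nn_integral_cong) (auto simp: indicator_def not_le)
  then have "(\<integral>\<^sup>+t. ennreal (norm (g t)) \<partial>lborel)^2 \<le>
      (\<integral>\<^sup>+t. ennreal (norm (g t))^2 \<partial>lborel) * (\<integral>\<^sup>+t. (indicator (cball (0::'a) \<rho>) t)^2 \<partial>lborel)"
    using Cauchy_Schwarz_nn_integral[of "\<lambda>t. ennreal (norm (g t))" lborel "indicator (cball 0 \<rho>)"]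
    by (simp add: borel_measurable_indicator)
  also have "(\<integral>\<^sup>+t. (indicator (cball (0::'a) \<rho>) t :: ennreal)^2 \<partial>lborel) = emeasure lborel (cball (0::'a) \<rho>)"
    by (simp add: power2_eq_square indicator_inter_arith[symmetric])
  also have "\<dots> = ennreal v"
    using \<rho> by (simp add: emeasure_cball v_def)
  also have "(\<integral>\<^sup>+t. ennreal (norm (g t))^2 \<partial>lborel) = ennreal (norm (abs_L2 g))^2"
    by (rule norm_abs_L2_nn[OF g, symmetric])
  also have "ennreal (norm (abs_L2 g))^2 * ennreal v = ennreal (sqrt v * norm (abs_L2 g))^2"
    using v by (simp add: ennreal_power ennreal_mult[symmetric] power_mult_distrib mult.commute)
  finally have *: "(\<integral>\<^sup>+t. ennreal (norm (g t)) \<partial>lborel) \<le> ennreal (sqrt v * norm (abs_L2 g))"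
    by (rule power2_le_imp_le_ennreal) (use v in simp)
  show "borel_L1 g" using * by (intro borel_L1I) (auto elim!: le_less_trans)
  then show "L1_norm g \<le> sqrt (unit_ball_vol (real DIM('a)) * \<rho> ^ DIM('a)) * norm (abs_L2 g)"
    using * v by (intro L1_norm_leI) (auto simp: v_def)
qed

text \<open>Supports of convolution powers grow only linearly, so by Cauchy-Schwarz their \<open>L\<^sup>1\<close> norms exceed
  the \<open>L\<^sup>2\<close> norms, which the operator norm controls, only by a polynomial factor.\<close>

lemma power_conv_kernel:
  fixes k :: "'a::euclidean_space \<Rightarrow> complex" and c :: complex
  assumes k: "borel_L1 k" "borel_sqi k" and supp: "\<And>t. R < norm t \<Longrightarrow> k t = 0" and R: "0 \<le> R"
  defines "M \<equiv> norm (affine_conv c k)"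
  shows "\<exists>g. borel_sqi g \<and> (\<forall>s. real (m + 1) * R < norm s \<longrightarrow> g s = 0) \<and>
      conv_elem c k ^ m * conv_elem 0 k = conv_elem 0 (\<lambda>t. g (- t)) \<and>
      norm (abs_L2 g) \<le> M ^ m * norm (abs_L2 (\<lambda>t. k (- t)))"
proof (induct m)
  case 0
  note [measurable] = borel_L1_measurable[OF k(1)]
  have "borel_sqi (\<lambda>t. k (- t))"
    using k(2) nn_integral_lborel_reflect[of "\<lambda>t. ennreal (norm (k t))^2" 0] by (auto simp: borel_sqi_def)
  then show ?case
    using supp by (intro exI[of _ "\<lambda>t. k (- t)"]) simp
next
  case (Suc m)
  then obtain g where g: "borel_sqi g" "\<And>s. real (m + 1) * R < norm s \<Longrightarrow> g s = 0"
    "conv_elem c k ^ m * conv_elem 0 k = conv_elem 0 (\<lambda>t. g (- t))"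
    "norm (abs_L2 g) \<le> M ^ m * norm (abs_L2 (\<lambda>t. k (- t)))" by blast
  note [measurable] = borel_sqi_measurable[OF g(1)]
  have g1: "borel_L1 (\<lambda>t. g (- t))"
    using L1_of_bounded_support(1)[OF g(1,2)] R nn_integral_lborel_reflect[of "\<lambda>t. ennreal (norm (g t))" 0]
    by (intro borel_L1I) (auto simp: nn_integral_L1_norm)
  \<comment> \<open>Convolving \<open>k\<close> with the kernel \<open>\<lambda>t. g (- t)\<close>
    amounts to applying \<open>conv k\<close> to the function \<open>g\<close> and reflecting.
    Multiplication in the algebra thus becomes application of an operator to a vector of L2, which
    is how the operator norm \<open>M\<close> enters.\<close>
  define g' where "g' s = c * g s + conv k g s" for s
  have g': "borel_sqi g'"
    unfolding g'_def by (intro borel_sqi_add borel_sqi_mult borel_sqi_conv k g)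
  moreover have "g' s = 0" if s: "real (Suc m + 1) * R < norm s" for s
  proof -
    have "k t * g (s + t) = 0" for t
    proof (cases "R < norm t")
      case False
      have "norm s \<le> norm (s + t) + norm t" using norm_triangle_ineq4[of "s + t" t] by simp
      with s False have "real (m + 1) * R < norm (s + t)" by (simp add: algebra_simps)
      then show ?thesis by (simp add: g)
    qed (simp add: supp)
    then have "conv k g s = 0" unfolding conv_def by (simp only:) simp
    moreover have "real (m + 1) * R < norm s" using s R by (simp add: algebra_simps)
    then have "g s = 0" by (rule g)
    ultimately show ?thesis by (simp add: g'_def)
  qed
  moreover have "conv_elem c k ^ Suc m * conv_elem 0 k = conv_elem 0 (\<lambda>t. g' (- t))"
  proof -
    have "conv_elem c k ^ Suc m * conv_elem 0 k = conv_elem c k * conv_elem 0 (\<lambda>t. g (- t))"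
      by (simp add: mult.assoc g(3))
    also have "\<dots> = conv_elem 0 (\<lambda>t. g' (- t))"
      by (simp add: conv_elem_mult k g1 g'_def convolve_def conv_def)
    finally show ?thesis .
  qed
  moreover have "norm (abs_L2 g') \<le> M ^ Suc m * norm (abs_L2 (\<lambda>t. k (- t)))"
  proof -
    have "norm (abs_L2 g') \<le> M * norm (abs_L2 g)"
      unfolding M_def g'_def affine_conv_abs[OF k(1) g(1), symmetric] by (rule norm_blinfun)
    also have "\<dots> \<le> M * (M ^ m * norm (abs_L2 (\<lambda>t. k (- t))))"
      by (intro mult_left_mono g) (simp add: M_def)
    finally show ?thesis by simp
  qed
  ultimately show ?case by blast
qed

text \<open>With \<open>L = - ln q\<close> and \<open>x = L * (m + 1)\<close> the sequence is a
  constant multiple of \<open>x ^ d / exp x\<close>, which tends to 0.\<close>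

lemma poly_times_geometric_bounded:
  fixes q :: real
  assumes "0 < q" "q < 1"
  obtains B where "\<And>m. real (m + 1) ^ d * q ^ m \<le> B"
proof -
  define L where "L = - ln q"
  have L: "L > 0" using assms by (simp add: L_def)
  have "filterlim (\<lambda>m. L * real (m + 1)) at_top sequentially"
    by (rule filterlim_tendsto_pos_mult_at_top[OF tendsto_const L])
       (simp add: filterlim_real_sequentially filterlim_sequentially_Suc[where f = real] del: of_nat_Suc)
  then have "(\<lambda>m. (L * real (m + 1)) ^ d / exp (L * real (m + 1))) \<longlonglongrightarrow> 0"
    using filterlim_compose[OF tendsto_power_div_exp_0] by blast
  then have "Bseq (\<lambda>m. (L * real (m + 1)) ^ d / exp (L * real (m + 1)))"
    by (intro convergent_imp_Bseq convergentI)
  then obtain B where B: "\<And>m. norm ((L * real (m + 1)) ^ d / exp (L * real (m + 1))) \<le> B"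
    by (auto simp: Bseq_def)
  have "real (m + 1) ^ d * q ^ m \<le> B / (L ^ d * q)" for m
  proof -
    have "exp (L * real (m + 1)) = inverse (q ^ (m + 1))"
    proof -
      have "exp (L * real (m + 1)) = exp L ^ (m + 1)" by (rule exp_of_nat2_mult)
      also have "exp L = inverse q" using assms by (simp add: L_def exp_minus)
      finally show ?thesis by (simp add: power_inverse)
    qed
    then have "(L * real (m + 1)) ^ d / exp (L * real (m + 1)) = (L ^ d * q) * (real (m + 1) ^ d * q ^ m)"
      by (simp add: power_mult_distrib divide_inverse mult_ac)
    then have "(L ^ d * q) * (real (m + 1) ^ d * q ^ m) \<le> B"
      using B[of m] by (metis abs_le_D1 real_norm_def)
    moreover have "L ^ d * q > 0" using L assms by simp
    ultimately show ?thesis by (simp add: pos_le_divide_eq mult.commute)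
  qed
  then show ?thesis by (rule that)
qed

text \<open>The support argument covers only pure kernels, so it is applied to
  \<open>y ^ m * conv_elem 0 k\<close>. Powers of \<open>y\<close> itself follow from the recursion
  that splits one factor \<open>y\<close> into scalar and kernel, because the scalar has modulus at
  most \<open>M < r\<close>.\<close>

lemma conv_elem_power_bound:
  fixes k :: "'a::euclidean_space \<Rightarrow> complex"
  assumes k: "borel_L1 k" "borel_sqi k" and supp: "\<And>t. R < norm t \<Longrightarrow> k t = 0" and R: "0 \<le> R"
    and r: "norm (affine_conv c k) < r"
  obtains B where "0 \<le> B" "\<And>m. norm (conv_elem c k ^ m) \<le> B * r ^ m"
proof -
  define M where "M = norm (affine_conv c k)"
  define y where "y = conv_elem c k"
  define N where "N = norm (abs_L2 (\<lambda>t. k (- t)))"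
  define V where "V = unit_ball_vol (real DIM('a)) * R ^ DIM('a)"
  have V: "V \<ge> 0" using R by (simp add: V_def)
  have M: "0 \<le> M" "M < r" using r by (auto simp: M_def)
  have r0: "0 < r" using M by simp
  \<comment> \<open>\<open>q < 1\<close> measures the gap between \<open>M\<close> and
    \<open>r\<close> that absorbs the polynomial factor; the value 1/2 for \<open>M = 0\<close>
    keeps \<open>q\<close> positive.\<close>
  define q where "q = (if M = 0 then 1/2 else M / r)"
  have q: "0 < q" "q < 1" "M \<le> q * r" using M by (auto simp: q_def)
  obtain B0 where B0: "\<And>m. real (m + 1) ^ DIM('a) * q ^ m \<le> B0"
    using poly_times_geometric_bounded[OF q(1,2)] by blast
  define P where "P = (1 + V * B0) * N"
  have p: "norm (y ^ m * conv_elem 0 k) \<le> P * r ^ m" for m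
  proof -
    obtain g where g: "borel_sqi g" "\<And>s. real (m + 1) * R < norm s \<Longrightarrow> g s = 0"
      "y ^ m * conv_elem 0 k = conv_elem 0 (\<lambda>t. g (- t))" "norm (abs_L2 g) \<le> M ^ m * N"
      using power_conv_kernel[OF k supp R, where c = c and m = m] unfolding y_def M_def N_def by blast
    note [measurable] = borel_sqi_measurable[OF g(1)]
    have mR: "0 \<le> real (m + 1) * R" using R by simp
    note g1 = L1_of_bounded_support[OF g(1,2) mR]
    have g1': "borel_L1 (\<lambda>t. g (- t))" and eq: "L1_norm (\<lambda>t. g (- t)) = L1_norm g"
      using g1(1) nn_integral_lborel_reflect[of "\<lambda>t. ennreal (norm (g t))" 0]
        integral_lborel_reflect[of "\<lambda>t. norm (g t)" 0]
      by (auto simp: L1_norm_def nn_integral_L1_norm intro!: borel_L1I)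
    have "norm (y ^ m * conv_elem 0 k) \<le> L1_norm g"
      using norm_conv_elem_le[OF g1', of 0] by (simp add: g(3) eq)
    also have "\<dots> \<le> sqrt (V * real (m + 1) ^ DIM('a)) * norm (abs_L2 g)"
      using g1(2) by (simp add: V_def power_mult_distrib mult_ac)
    also have "\<dots> \<le> (1 + V * real (m + 1) ^ DIM('a)) * (M ^ m * N)"
    proof (intro mult_mono g)
      \<comment> \<open>This trades the square root of the volume for a polynomial of degree
        \<open>DIM('a)\<close> in \<open>m + 1\<close>, the quantity bounded by
        \<open>B0\<close>.\<close>
      have "sqrt x \<le> 1 + x" if "x \<ge> 0" for x :: real
      proof (rule real_le_lsqrt)
        show "x \<le> (1 + x)\<^sup>2" using that by (simp add: power2_eq_square algebra_simps)
      qed (use that in auto)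
      then show "sqrt (V * real (m + 1) ^ DIM('a)) \<le> 1 + V * real (m + 1) ^ DIM('a)"
        using V by simp
    qed (use V in auto)
    also have "\<dots> \<le> (1 + V * real (m + 1) ^ DIM('a)) * (q ^ m * r ^ m * N)"
      using power_mono[OF q(3) M(1), of m] V
      by (intro mult_left_mono mult_right_mono) (auto simp: N_def power_mult_distrib)
    also have "\<dots> = (q ^ m + V * (real (m + 1) ^ DIM('a) * q ^ m)) * (r ^ m * N)"
      by (simp add: algebra_simps)
    also have "\<dots> \<le> (1 + V * B0) * (r ^ m * N)"
      using q r0 V B0[of m]
      by (intro mult_right_mono add_mono mult_left_mono power_le_one) (auto simp: N_def)
    finally show ?thesis by (simp add: P_def mult_ac)
  qed
  \<comment> \<open>The second entry gives \<open>M * B + P \<le> B * r\<close>, the inequality that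
    closes the induction, and the first covers the power 0.\<close>
  define B where "B = max 1 (P / (r - M))"
  have B: "1 \<le> B" "P \<le> B * (r - M)"
    using M by (auto simp: B_def pos_divide_le_eq[symmetric])
  have e: "norm (conv_elem c (\<lambda>t. 0 :: complex) :: 'a conv_alg) \<le> M"
    using norm_conv_elem_le[OF borel_L1_zero, of c, where 'a = 'a] norm_scalar_part_le[OF k(1), of c]
    by (simp add: L1_norm_def M_def)
  have split: "y = conv_elem c (\<lambda>t. 0) + conv_elem 0 k"
    by (simp add: y_def conv_elem_add borel_L1_zero k)
  have "norm (y ^ m) \<le> B * r ^ m" for m
  proof (induct m)
    case 0
    then show ?case using B by simp
  next
    case (Suc m)
    have "y ^ Suc m = conv_elem c (\<lambda>t. 0) * y ^ m + y ^ m * conv_elem 0 k"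
      by (subst power_Suc, subst (1) split) (simp add: algebra_simps)
    then have "norm (y ^ Suc m) \<le> norm (conv_elem c (\<lambda>t. 0 :: complex) :: 'a conv_alg) * norm (y ^ m) + norm (y ^ m * conv_elem 0 k)"
      by (metis norm_triangle_le add_right_mono norm_mult_ineq)
    also have "\<dots> \<le> M * (B * r ^ m) + P * r ^ m"
      using M B r0 by (intro add_mono mult_mono e Suc p) auto
    also have "\<dots> = (M * B + P) * r ^ m" by (simp add: algebra_simps)
    also have "\<dots> \<le> (B * r) * r ^ m"
      using B r0 by (intro mult_right_mono) (auto simp: algebra_simps)
    finally show ?case by (simp add: mult_ac)
  qed
  then show ?thesis using that[of B] B by (simp add: y_def)
qed

text \<open>The spectral radius in the algebra is at most the operator norm. The power bound holds
  for a truncated kernel, and as the algebra is commutative the binomial theorem adds the truncation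
  error, which is small in the algebra norm.\<close>

lemma summable_powers_if_op_norm_less_1:
  fixes y :: "'a::euclidean_space conv_alg"
  assumes "norm (conv_alg_op y) < 1"
  shows "summable (\<lambda>n. y ^ n)"
proof -
  obtain c k where k: "borel_L1 k" "y = conv_elem c k" by (rule conv_elem_cases)
  define q where "q = norm (conv_alg_op y)"
  \<comment> \<open>Three portions are spent and one remains below 1: one for the operator norm of
    the truncated element, one for the strict inequality in the power bound, one for the error in
    the binomial sum.\<close>
  define \<epsilon> where "\<epsilon> = (1 - q) / 4"
  have "q < 1" using assms by (simp add: q_def)
  then have \<epsilon>: "0 < \<epsilon>" "q + 3 * \<epsilon> < 1" by (simp_all add: \<epsilon>_def field_simps)
  have q0: "0 \<le> q" by (simp add: q_def)
  obtain l R where l: "borel_L1 l" "borel_sqi l" "0 \<le> R" "\<And>t. R < norm t \<Longrightarrow> l t = 0"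
    "borel_L1 (\<lambda>t. k t - l t)" "L1_norm (\<lambda>t. k t - l t) < \<epsilon>"
    using L1_truncation[OF k(1) \<epsilon>(1)] by blast
  define y' where "y' = conv_elem c l"
  define e where "e = y - y'"
  have e: "e = conv_elem 0 (\<lambda>t. k t - l t)"
    by (simp add: e_def y'_def k conv_elem_diff l)
  have ne: "norm e \<le> \<epsilon>" using norm_conv_elem_le[OF l(5), of 0] l(6) by (simp add: e)
  have "conv_alg_op y' = conv_alg_op y - conv_alg_op e"
    by (simp add: e_def minus_conv_alg.rep_eq)
  then have "norm (conv_alg_op y') \<le> q + \<epsilon>"
    using norm_triangle_ineq4[of "conv_alg_op y" "conv_alg_op e"] norm_conv_alg_op_le[of e] ne
    by (simp add: q_def)
  then have "norm (affine_conv c l) < q + 2 * \<epsilon>"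
    using \<epsilon> by (simp add: y'_def conv_alg_op_conv_elem l)
  then obtain B where B: "0 \<le> B" "\<And>m. norm (y' ^ m) \<le> B * (q + 2 * \<epsilon>) ^ m"
    using conv_elem_power_bound[OF l(1,2,4,3)] unfolding y'_def by metis
  have "norm (y ^ n) \<le> B * (q + 3 * \<epsilon>) ^ n" for n
  proof -
    have "y ^ n = (y' + e) ^ n" by (simp add: e_def)
    also have "\<dots> = (\<Sum>j\<le>n. of_nat (n choose j) * y' ^ j * e ^ (n - j))" by (rule binomial_ring)
    finally have "norm (y ^ n) \<le> (\<Sum>j\<le>n. norm (of_nat (n choose j) * y' ^ j * e ^ (n - j)))"
      using norm_sum by metis
    also have "\<dots> \<le> (\<Sum>j\<le>n. real (n choose j) * (B * (q + 2 * \<epsilon>) ^ j) * \<epsilon> ^ (n - j))"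
    proof (intro sum_mono)
      fix j
      have "norm (of_nat (n choose j) * y' ^ j * e ^ (n - j)) \<le> norm (of_nat (n choose j) :: 'a conv_alg) * norm (y' ^ j) * norm (e ^ (n - j))"
        by (intro order.trans[OF norm_mult_ineq] mult_right_mono norm_mult_ineq) simp
      also have "\<dots> \<le> real (n choose j) * (B * (q + 2 * \<epsilon>) ^ j) * \<epsilon> ^ (n - j)"
        using B q0 \<epsilon> ne
        by (intro mult_mono B order.trans[OF norm_power_ineq] power_mono) auto
      finally show "norm (of_nat (n choose j) * y' ^ j * e ^ (n - j)) \<le> real (n choose j) * (B * (q + 2 * \<epsilon>) ^ j) * \<epsilon> ^ (n - j)" .
    qed
    also have "\<dots> = B * ((q + 2 * \<epsilon>) + \<epsilon>) ^ n"
      unfolding binomial_ring by (simp add: sum_distrib_left mult_ac)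
    finally show ?thesis by (simp add: algebra_simps)
  qed
  moreover have "summable (\<lambda>n. B * (q + 3 * \<epsilon>) ^ n)"
    using \<epsilon> q0 by (intro summable_mult summable_geometric) auto
  ultimately show ?thesis
    using summable_comparison_test'[of "\<lambda>n. B * (q + 3 * \<epsilon>) ^ n" 0 "\<lambda>n. y ^ n"] by blast
qed

section \<open>Inverse-closedness\<close>

lemma scaleC_blinfun_adjoint: "scaleC_blinfun c F \<bullet> G = F \<bullet> scaleC_blinfun (cnj c) G"
proof -
  obtain f where f: "borel_sqi f" "F = abs_L2 f" by (rule L2_borel_cases)
  obtain g where g: "borel_sqi g" "G = abs_L2 g" by (rule L2_borel_cases)
  have "(c * x) \<bullet> y = x \<bullet> (cnj c * y)" for x y
    by (simp add: inner_complex_def algebra_simps)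
  then show ?thesis by (simp add: f g scaleC_blinfun_abs abs_L2_inner borel_sqi_mult)
qed

lemma conv_alg_adjoint:
  fixes x :: "'a::euclidean_space conv_alg"
  obtains x' :: "'a conv_alg" where "\<And>F G. conv_alg_op x F \<bullet> G = F \<bullet> conv_alg_op x' G"
proof -
  obtain c k where k: "borel_L1 k" "x = conv_elem c k" by (rule conv_elem_cases)
  have "conv_alg_op x F \<bullet> G = F \<bullet> conv_alg_op (conv_elem (cnj c) (\<lambda>t. cnj (k (- t)))) G" for F G
    using k borel_L1_star[OF k(1)]
    by (simp add: conv_alg_op_conv_elem affine_conv_def plus_blinfun.rep_eq inner_add_left inner_add_right
        scaleC_blinfun_adjoint conv_op_adjoint)
  then show ?thesis by (rule that)
qed

text \<open>If \<open>x\<close> is bounded below then \<open>1 - \<epsilon> x\<^sup>* x\<close> is a strict contraction for small \<open>\<epsilon>\<close>, so its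
  Neumann series converges already in the convolution algebra.\<close>

lemma conv_alg_invertible:
  fixes x :: "'a::euclidean_space conv_alg"
  assumes c: "0 < c" and below: "\<And>F. c * norm F \<le> norm (conv_alg_op x F)"
  obtains y where "x * y = 1"
proof -
  obtain x' :: "'a conv_alg" where adj: "\<And>F G. conv_alg_op x F \<bullet> G = F \<bullet> conv_alg_op x' G"
    using conv_alg_adjoint by blast
  \<comment> \<open>Taking the maximum with \<open>c\<close> keeps \<open>M\<close> positive and
    ensures \<open>\<epsilon> * c^2 \<le> 1\<close> below.\<close>
  define M where "M = max c (norm (conv_alg_op x))"
  have M: "0 < M" "c \<le> M" "norm (conv_alg_op x) \<le> M" using c by (auto simp: M_def)
  have Mx: "norm (conv_alg_op x F) \<le> M * norm F" for F
    using M norm_blinfun[of "conv_alg_op x" F] by (meson mult_right_mono norm_ge_zero order.trans)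
  have Mx': "norm (conv_alg_op x' G) \<le> M * norm G" for G
  proof (cases "conv_alg_op x' G = 0")
    case False
    let ?H = "conv_alg_op x' G"
    have "norm ?H * norm ?H = conv_alg_op x ?H \<bullet> G"
      by (simp add: adj power2_norm_eq_inner[symmetric] power2_eq_square)
    also have "\<dots> \<le> norm (conv_alg_op x ?H) * norm G" by (rule norm_cauchy_schwarz)
    also have "\<dots> \<le> (M * norm ?H) * norm G" by (intro mult_right_mono Mx) simp
    finally have "norm ?H * norm ?H \<le> norm ?H * (M * norm G)" by (simp add: mult_ac)
    then show ?thesis using False by simp
  qed (use M in simp)
  \<comment> \<open>With this value the quadratic term of \<open>(norm (y F))^2\<close> cancels at
    most half of the cross term, which leaves a definite decrease.\<close>
  define \<epsilon> where "\<epsilon> = 1 / M^2"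
  have \<epsilon>: "0 < \<epsilon>" "\<epsilon>^2 * M^2 = \<epsilon>" using M by (auto simp: \<epsilon>_def power2_eq_square)
  define y where "y = 1 - \<epsilon> *\<^sub>R (x' * x)"
  have "norm (conv_alg_op y F) \<le> sqrt (1 - \<epsilon> * c^2) * norm F" for F
  proof -
    let ?X = "conv_alg_op x F" and ?Z = "conv_alg_op x' (conv_alg_op x F)"
    have yF: "conv_alg_op y F = F - \<epsilon> *\<^sub>R ?Z"
      by (simp add: y_def minus_conv_alg.rep_eq one_conv_alg.rep_eq scaleR_conv_alg.rep_eq
          times_conv_alg.rep_eq minus_blinfun.rep_eq scaleR_blinfun.rep_eq)
    have "(norm (conv_alg_op y F))^2 = (norm F)^2 - 2 * \<epsilon> * (F \<bullet> ?Z) + \<epsilon>^2 * (norm ?Z)^2"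
      unfolding yF power2_norm_eq_inner
      by (simp add: inner_diff_left inner_diff_right inner_commute power2_eq_square algebra_simps)
    moreover have "F \<bullet> ?Z = (norm ?X)^2"
      by (simp add: adj[symmetric] power2_norm_eq_inner)
    moreover have "\<epsilon>^2 * (norm ?Z)^2 \<le> \<epsilon> * (norm ?X)^2"
    proof -
      have "\<epsilon>^2 * (norm ?Z)^2 \<le> \<epsilon>^2 * (M * norm ?X)^2"
        by (intro mult_left_mono power_mono Mx') auto
      also have "\<epsilon>^2 * (M * norm ?X)^2 = \<epsilon> * (norm ?X)^2"
        using \<epsilon>(2) by (metis power_mult_distrib mult.assoc)
      finally show ?thesis .
    qed
    ultimately have "(norm (conv_alg_op y F))^2 \<le> (norm F)^2 - \<epsilon> * (norm ?X)^2"
      by simp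
    also have "\<dots> \<le> (norm F)^2 - \<epsilon> * (c * norm F)^2"
      using below[of F] c \<epsilon> by (intro diff_left_mono mult_left_mono power_mono) auto
    also have "\<dots> = (1 - \<epsilon> * c^2) * (norm F)^2" by (simp add: power_mult_distrib algebra_simps)
    finally have "norm (conv_alg_op y F) \<le> sqrt ((1 - \<epsilon> * c^2) * (norm F)^2)"
      by (rule real_le_rsqrt)
    then show ?thesis by (simp add: real_sqrt_mult)
  qed
  moreover have ec: "\<epsilon> * c^2 \<le> 1" "0 < \<epsilon> * c^2"
    using M c by (auto simp: \<epsilon>_def power_mono)
  ultimately have "norm (conv_alg_op y) \<le> sqrt (1 - \<epsilon> * c^2)"
    by (intro norm_blinfun_bound) auto
  also have "\<dots> < 1" using ec by simp
  finally have s: "summable (\<lambda>n. y ^ n)" by (rule summable_powers_if_op_norm_less_1)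
  have "y * (\<Sum>n. y ^ n) = (\<Sum>n. y ^ Suc n)"
    using suminf_mult[OF s, of y] by simp
  also have "\<dots> = (\<Sum>n. y ^ n) - 1"
    using suminf_split_head[OF s] by simp
  finally have "(1 - y) * (\<Sum>n. y ^ n) = 1" by (simp add: algebra_simps)
  \<comment> \<open>Here \<open>1 - y\<close> is \<open>\<epsilon> *\<^sub>R (x' * x)\<close>.
    Inverting a multiple of \<open>x\<close> by a commuting factor inverts \<open>x\<close> itself,
    so a lower bound on \<open>x\<close> alone suffices.\<close>
  then have "x * (\<epsilon> *\<^sub>R (x' * (\<Sum>n. y ^ n))) = 1"
    by (simp add: y_def mult_ac)
  then show ?thesis by (rule that)
qed

section \<open>Resolvents in the convolution algebra\<close>

definition scal :: "complex \<Rightarrow> 'a::euclidean_space conv_alg" where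
  "scal z = conv_elem z (\<lambda>t. 0)"

lemma scal_add: "scal (z + w) = scal z + scal w"
  by (simp add: scal_def conv_elem_add borel_L1_zero)

lemma scal_mult: "scal (z * w) = scal z * scal w"
  by (simp add: scal_def conv_elem_mult borel_L1_zero convolve_def)

lemma scal_1 [simp]: "scal 1 = 1"
  by (simp add: scal_def conv_elem_1)

lemma scal_0 [simp]: "scal 0 = 0"
  by (simp add: scal_def conv_elem_0)

lemma scal_minus: "scal (- z) = - scal z"
  by (simp add: scal_def conv_elem_uminus borel_L1_zero)

lemma scal_diff: "scal (z - w) = scal z - scal w"
  using scal_add[of z "- w"] by (simp add: scal_minus)

lemma scal_power: "scal (z ^ n) = scal z ^ n"
  by (induct n) (simp_all add: scal_mult)

lemma norm_scal_le: "norm (scal z :: 'a::euclidean_space conv_alg) \<le> norm z"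
  unfolding scal_def using norm_conv_elem_le[OF borel_L1_zero, of z, where 'a = 'a] by (simp add: L1_norm_def)

lemma conv_alg_op_scal: "conv_alg_op (scal z) = scaleC_blinfun z"
  by (simp add: scal_def conv_alg_op_conv_elem borel_L1_zero affine_conv_def conv_op_zero)

lemma conv_char_scal: "conv_char (scal z) = z"
  by (simp add: scal_def conv_char_conv_elem borel_L1_zero)

lemma bounded_linear_scal: "bounded_linear (scal :: complex \<Rightarrow> 'a::euclidean_space conv_alg)"
proof
  show "\<exists>K. \<forall>z. norm (scal z :: 'a conv_alg) \<le> norm z * K"
    by (intro exI[of _ 1] allI) (simp add: norm_scal_le)
next
  fix r and z :: complex
  show "(scal (r *\<^sub>R z) :: 'a conv_alg) = r *\<^sub>R scal z"
    unfolding scal_def scaleR_conv_elem[OF borel_L1_zero] by (simp add: scaleR_conv_of_real)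
qed (rule scal_add)

text \<open>Invertibility is meant inside the algebra, where by commutativity a one-sided inverse is
  two-sided. The complement is identified with the operator spectrum in
  \<open>spectrum_rep_op\<close>.\<close>

definition res_set :: "'a::euclidean_space conv_alg \<Rightarrow> complex set" where
  "res_set h = {z. \<exists>y. (scal z - h) * y = 1}"

definition inv_res :: "'a::euclidean_space conv_alg \<Rightarrow> complex \<Rightarrow> 'a conv_alg" where
  "inv_res h z = (THE y. (scal z - h) * y = 1)"

lemma inv_res_eqI:
  assumes "(scal z - h) * y = 1"
  shows "inv_res h z = y"
  unfolding inv_res_def
proof (rule the_equality)
  show "(scal z - h) * y = 1" by (rule assms)
  fix y' assume y': "(scal z - h) * y' = 1"
  have "y' = y' * ((scal z - h) * y)" by (simp only: assms mult_1_right)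
  also have "\<dots> = ((scal z - h) * y') * y" by (simp only: mult_ac)
  also have "\<dots> = y" by (simp only: y' mult_1_left)
  finally show "y' = y" .
qed

lemma inv_res: "z \<in> res_set h \<Longrightarrow> (scal z - h) * inv_res h z = 1"
  using inv_res_eqI by (fastforce simp: res_set_def)

text \<open>The first resolvent identity: \<open>scal (z - w)\<close> is the difference of the two
  elements being inverted, and multiplying by both inverses cancels one factor in each term.\<close>

lemma inv_res_diff:
  assumes "z \<in> res_set h" "w \<in> res_set h"
  shows "inv_res h w - inv_res h z = scal (z - w) * (inv_res h w * inv_res h z)"
proof -
  let ?z = "inv_res h z" and ?w = "inv_res h w"
  have "scal (z - w) * (?w * ?z) = ((scal z - h) - (scal w - h)) * (?w * ?z)"
    by (simp add: scal_diff)
  also have "\<dots> = ((scal z - h) * ?z) * ?w - ((scal w - h) * ?w) * ?z"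
    by (simp only: left_diff_distrib right_diff_distrib mult_ac)
  finally show ?thesis by (simp add: inv_res assms)
qed

text \<open>A Neumann series around \<open>z\<close>. The threshold 1/2 rather than 1 gives the
  uniform bound \<open>2 * norm (inv_res h z)\<close>, on which continuity and the later estimates
  rely.\<close>

lemma res_set_neumann:
  fixes h :: "'a::euclidean_space conv_alg"
  assumes z: "z \<in> res_set h" and w: "norm (w - z) * norm (inv_res h z) \<le> 1/2"
  defines "u \<equiv> scal (z - w) * inv_res h z"
  shows "w \<in> res_set h" "norm u \<le> 1/2" "(1 - u) * inv_res h w = inv_res h z"
    "norm (inv_res h w) \<le> 2 * norm (inv_res h z)"
proof -
  let ?y = "inv_res h z"
  have "norm u \<le> norm (scal (z - w) :: 'a conv_alg) * norm ?y" unfolding u_def by (rule norm_mult_ineq)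
  also have "\<dots> \<le> norm (z - w) * norm ?y" by (intro mult_right_mono norm_scal_le) simp
  finally show u: "norm u \<le> 1/2" using w by (simp add: norm_minus_commute)
  have s: "summable (\<lambda>n. u ^ n)" by (rule complete_algebra_summable_geometric) (use u in simp)
  have "u * (\<Sum>n. u ^ n) = (\<Sum>n. u ^ n) - 1"
    using suminf_mult[OF s, of u] suminf_split_head[OF s] by simp
  then have us: "(1 - u) * (\<Sum>n. u ^ n) = 1" by (simp add: algebra_simps)
  have "(scal w - h) * ?y = 1 - u"
  proof -
    have "(scal w - h) * ?y = (scal z - h) * ?y - scal (z - w) * ?y"
      by (simp add: scal_diff algebra_simps)
    then show ?thesis by (simp add: inv_res z u_def)
  qed
  then have "(scal w - h) * (?y * (\<Sum>n. u ^ n)) = 1" using us by (simp add: mult.assoc[symmetric])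
  then show "w \<in> res_set h" by (auto simp: res_set_def)
  have eq: "inv_res h w = ?y * (\<Sum>n. u ^ n)"
    using \<open>(scal w - h) * (?y * (\<Sum>n. u ^ n)) = 1\<close> by (rule inv_res_eqI)
  have "(1 - u) * inv_res h w = ?y * ((1 - u) * (\<Sum>n. u ^ n))" by (simp only: eq mult_ac)
  then show e2: "(1 - u) * inv_res h w = ?y" by (simp add: us)
  have "inv_res h w = ?y + u * inv_res h w" using e2 by (simp add: algebra_simps)
  then have "norm (inv_res h w) \<le> norm ?y + norm u * norm (inv_res h w)"
    by (metis norm_triangle_le add_left_mono norm_mult_ineq)
  also have "\<dots> \<le> norm ?y + 1/2 * norm (inv_res h w)" using u by (intro add_left_mono mult_right_mono) auto
  finally show "norm (inv_res h w) \<le> 2 * norm ?y" by simp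
qed

lemma open_res_set: "open (res_set h)"
  unfolding open_contains_ball
proof (intro ballI)
  fix z assume z: "z \<in> res_set h"
  define d where "d = 1 / (2 * norm (inv_res h z) + 1)"
  have pos: "0 < 1 + 2 * norm (inv_res h z)" by (simp add: add_pos_nonneg)
  then have d: "d > 0" by (simp add: d_def)
  have "norm (w - z) * norm (inv_res h z) \<le> 1/2" if "w \<in> ball z d" for w
  proof -
    have "norm (w - z) * norm (inv_res h z) \<le> d * norm (inv_res h z)"
      using that by (intro mult_right_mono) (auto simp: dist_norm norm_minus_commute)
    also have "\<dots> \<le> 1/2" using pos by (simp add: d_def field_simps)
    finally show ?thesis .
  qed
  then show "\<exists>e>0. ball z e \<subseteq> res_set h" using res_set_neumann(1)[OF z] d by blast
qed

lemma continuous_inv_res: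
  assumes z: "z \<in> res_set h"
  shows "(inv_res h \<longlongrightarrow> inv_res h z) (at z)"
proof (rule LIM_zero_cancel, rule Lim_null_comparison)
  let ?y = "inv_res h z"
  have "((\<lambda>w. norm (w - z) * norm ?y) \<longlongrightarrow> 0) (at z)"
    by (auto intro!: tendsto_eq_intros)
  then have "\<forall>\<^sub>F w in at z. norm (w - z) * norm ?y < 1/2" by (rule order_tendstoD) simp
  then show "\<forall>\<^sub>F w in at z. norm (inv_res h w - ?y) \<le> norm (z - w) * (2 * norm ?y * norm ?y)"
  proof eventually_elim
    fix w assume "norm (w - z) * norm ?y < 1/2"
    then have w: "norm (w - z) * norm ?y \<le> 1/2" by simp
    note n = res_set_neumann[OF z w]
    have "norm (inv_res h w - ?y) \<le> norm (scal (z - w) :: 'a conv_alg) * norm (inv_res h w * ?y)"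
      unfolding inv_res_diff[OF z n(1)] by (rule norm_mult_ineq)
    also have "\<dots> \<le> norm (z - w) * (2 * norm ?y * norm ?y)"
      by (intro mult_mono norm_scal_le order.trans[OF norm_mult_ineq] mult_right_mono n(4)) auto
    finally show "norm (inv_res h w - ?y) \<le> norm (z - w) * (2 * norm ?y * norm ?y)" .
  qed
  show "((\<lambda>w. norm (z - w) * (2 * norm ?y * norm ?y)) \<longlongrightarrow> 0) (at z)"
    by (auto intro!: tendsto_eq_intros)
qed

text \<open>The derivative of the resolvent is minus its square, by the resolvent identity and
  continuity. The algebra is set up only over the reals, so complex linearity of \<open>l\<close> is
  expressed through \<open>scal\<close>.\<close>

lemma holomorphic_functional_inv_res:
  fixes l :: "'a::euclidean_space conv_alg \<Rightarrow> complex"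
  assumes l: "bounded_linear l" and lc: "\<And>c x. l (scal c * x) = c * l x"
  shows "(\<lambda>z. l (inv_res h z)) holomorphic_on res_set h"
proof -
  have "((\<lambda>z. l (inv_res h z)) has_field_derivative (- l (inv_res h z * inv_res h z))) (at z)"
    if z: "z \<in> res_set h" for z
    unfolding has_field_derivative_iff
  proof (rule Lim_transform_eventually)
    show "((\<lambda>w. - l (inv_res h w * inv_res h z)) \<longlongrightarrow> - l (inv_res h z * inv_res h z)) (at z)"
      by (intro tendsto_minus bounded_linear.tendsto[OF l] tendsto_mult tendsto_const continuous_inv_res z)
    have "\<forall>\<^sub>F w in at z. w \<in> res_set h"
      using open_res_set z by (intro eventually_at_in_open') auto
    moreover have "\<forall>\<^sub>F w in at z. w \<noteq> z" by (simp add: eventually_at_filter)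
    ultimately show "\<forall>\<^sub>F w in at z. - l (inv_res h w * inv_res h z) = (l (inv_res h w) - l (inv_res h z)) / (w - z)"
    proof eventually_elim
      fix w assume w: "w \<in> res_set h" "w \<noteq> z"
      have "l (inv_res h w) - l (inv_res h z) = l (inv_res h w - inv_res h z)"
        using l by (simp add: linear_diff bounded_linear.linear)
      also have "\<dots> = (z - w) * l (inv_res h w * inv_res h z)"
        by (simp add: inv_res_diff z w lc)
      finally show "- l (inv_res h w * inv_res h z) = (l (inv_res h w) - l (inv_res h z)) / (w - z)"
        using w by (simp add: field_simps)
    qed
  qed
  then show ?thesis
    by (auto simp: holomorphic_on_open open_res_set)
qed

section \<open>Contour integrals in the convolution algebra\<close>

text \<open>Remainder of the Neumann series, geometric and uniform in \<open>w\<close>: this is what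
  makes the termwise derivatives below converge uniformly.\<close>

lemma inv_res_partial_sum:
  fixes h :: "'a::euclidean_space conv_alg"
  assumes z: "z \<in> res_set h" and w: "norm (w - z) * norm (inv_res h z) \<le> 1/2"
  shows "norm ((\<Sum>i<n. scal ((z - w)^i) * inv_res h z ^ Suc i) - inv_res h w) \<le> (1/2)^n * (2 * norm (inv_res h z))"
proof -
  let ?y = "inv_res h z"
  define u where "u = scal (z - w) * ?y"
  note n = res_set_neumann[OF z w, folded u_def]
  have "scal ((z - w)^i) * ?y ^ Suc i = u ^ i * ?y" for i
    by (simp add: u_def power_mult_distrib scal_power mult_ac)
  then have "(\<Sum>i<n. scal ((z - w)^i) * ?y ^ Suc i) = (\<Sum>i<n. u ^ i) * ?y"
    by (simp add: sum_distrib_right)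
  also have "\<dots> = ((1 - u) * (\<Sum>i<n. u ^ i)) * inv_res h w"
    unfolding n(3)[symmetric] by (simp only: mult_ac)
  also have "(1 - u) * (\<Sum>i<n. u ^ i) = 1 - u ^ n"
    by (rule one_diff_power_eq[symmetric])
  finally have "(\<Sum>i<n. scal ((z - w)^i) * ?y ^ Suc i) - inv_res h w = - (u ^ n * inv_res h w)"
    by (simp only: left_diff_distrib) simp
  then have "norm ((\<Sum>i<n. scal ((z - w)^i) * ?y ^ Suc i) - inv_res h w) = norm (u ^ n * inv_res h w)"
    by (simp only: norm_minus_cancel)
  also have "\<dots> \<le> norm u ^ n * norm (inv_res h w)"
    by (intro order.trans[OF norm_mult_ineq] mult_right_mono norm_power_ineq) auto
  also have "\<dots> \<le> (1/2)^n * (2 * norm ?y)"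
    using n by (intro mult_mono power_mono) auto
  finally show ?thesis .
qed

text \<open>The derivative of a \<^const>\<open>valid_path\<close> may be unbounded, so integrability of the resolvent
  along it is derived from local primitives.\<close>

lemma inv_res_local_primitive:
  fixes h :: "'a::euclidean_space conv_alg"
  assumes z: "z \<in> res_set h" and E: "open E" "z \<in> E" and F: "F holomorphic_on E"
  obtains d G where "0 < d"
    "\<And>w. w \<in> ball z d \<Longrightarrow> (G has_derivative (\<lambda>v. scal (F w * v) * inv_res h w)) (at w)"
proof -
  let ?y = "inv_res h z"
  obtain d0 where d0: "d0 > 0" "cball z d0 \<subseteq> E" using E open_contains_cball by blast
  \<comment> \<open>Within this radius the Neumann expansion has ratio at most 1/2, and the closed
    disc stays in \<open>E\<close>.\<close>
  define d where "d = min d0 (1 / (2 * norm ?y + 1))"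
  have d: "d > 0" "cball z d \<subseteq> E" using d0 by (auto simp: d_def add_nonneg_pos)
  have "d * norm ?y \<le> 1 / (2 * norm ?y + 1) * norm ?y" by (intro mult_right_mono) (auto simp: d_def)
  also have "\<dots> \<le> 1/2"
  proof -
    have "0 < 1 + 2 * norm ?y" by (simp add: add_pos_nonneg)
    then show ?thesis by (simp add: field_simps)
  qed
  finally have dy: "d * norm ?y \<le> 1/2" .
  have near: "norm (w - z) * norm ?y \<le> 1/2" if "w \<in> ball z d" for w
    using that by (intro order.trans[OF mult_right_mono dy]) (auto simp: dist_norm norm_minus_commute)
  have "compact (F ` cball z d)"
    using F d by (intro compact_continuous_image holomorphic_on_imp_continuous_on) (auto intro: holomorphic_on_subset)
  then obtain B where B: "B > 0" "\<And>w. w \<in> cball z d \<Longrightarrow> norm (F w) \<le> B"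
    using compact_imp_bounded bounded_pos by (metis imageI)
  \<comment> \<open>The coefficients \<open>F w * (z - w)^j\<close> of the Neumann expansion are
    scalar holomorphic functions, so on a disc they have primitives; these are normalised to vanish
    at \<open>z\<close>.\<close>
  have "\<exists>c. c z = 0 \<and> (\<forall>w\<in>ball z d. (c has_field_derivative F w * (z - w)^j) (at w))" for j
  proof -
    have hol: "(\<lambda>w. F w * (z - w)^j) holomorphic_on ball z d"
      using d by (intro holomorphic_intros holomorphic_on_subset[OF F]) auto
    obtain c where c: "\<And>w. w \<in> ball z d \<Longrightarrow> (c has_field_derivative F w * (z - w)^j) (at w within ball z d)"
      using holomorphic_convex_primitive'[OF convex_ball open_ball hol] by blast
    have "((\<lambda>w. c w - c z) has_field_derivative F w * (z - w)^j) (at w)" if "w \<in> ball z d" for w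
      using c[OF that] that by (auto intro!: derivative_eq_intros simp: at_within_open[OF _ open_ball])
    then show ?thesis by (intro exI[of _ "\<lambda>w. c w - c z"]) simp
  qed
  then obtain c where c: "\<And>j. c j z = 0"
    "\<And>j w. w \<in> ball z d \<Longrightarrow> (c j has_field_derivative F w * (z - w)^j) (at w)" by metis
  define f where "f j w = scal (c j w) * ?y ^ Suc j" for j w
  define f' where "f' j w v = scal (F w * (z - w)^j * v) * ?y ^ Suc j" for j w v
  \<comment> \<open>Multiplying the scalar primitives by powers of the fixed element
    \<open>?y\<close> and summing gives a vector-valued primitive. Uniform convergence of the
    derivatives and convergence at the centre suffice.\<close>
  have "\<exists>G. \<forall>w\<in>ball z d. (\<lambda>n. f n w) sums (G w) \<and>
      (G has_derivative (\<lambda>v. scal (F w * v) * inv_res h w)) (at w within ball z d)"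
  proof (rule has_derivative_series)
    show "(f n has_derivative f' n w) (at w within ball z d)" if "w \<in> ball z d" for n w
    proof -
      have bl: "bounded_linear (\<lambda>x. scal x * ?y ^ Suc n)"
        by (rule bounded_linear_compose[OF bounded_linear_mult_left bounded_linear_scal])
      have "(c n has_derivative (\<lambda>v. F w * (z - w)^n * v)) (at w within ball z d)"
        using c(2)[OF that, of n] by (simp add: has_field_derivative_def has_derivative_at_withinI)
      from bounded_linear.has_derivative[OF bl this]
      show ?thesis by (simp add: f_def[abs_def] f'_def[abs_def])
    qed
    show "\<forall>\<^sub>F n in sequentially. \<forall>w\<in>ball z d. \<forall>v.
        norm ((\<Sum>i<n. f' i w v) - scal (F w * v) * inv_res h w) \<le> e * norm v" if e: "e > 0" for e
    proof -
      have "(\<lambda>n. B * ((1/2)^n * (2 * norm ?y))) \<longlonglongrightarrow> 0"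
        by (intro tendsto_mult_right_zero tendsto_mult_left_zero LIMSEQ_power_zero) simp
      then have "\<forall>\<^sub>F n in sequentially. B * ((1/2)^n * (2 * norm ?y)) < e"
        by (rule order_tendstoD) (rule e)
      then show ?thesis
      proof eventually_elim
        fix n assume n: "B * ((1/2)^n * (2 * norm ?y)) < e"
        show "\<forall>w\<in>ball z d. \<forall>v. norm ((\<Sum>i<n. f' i w v) - scal (F w * v) * inv_res h w) \<le> e * norm v"
        proof (intro ballI allI)
          fix w v assume w: "w \<in> ball z d"
          let ?D = "(\<Sum>i<n. scal ((z - w)^i) * ?y ^ Suc i) - inv_res h w"
          have "(\<Sum>i<n. f' i w v) - scal (F w * v) * inv_res h w = scal (F w * v) * ?D"
            by (simp add: f'_def right_diff_distrib sum_distrib_left scal_mult mult_ac)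
          then have "norm ((\<Sum>i<n. f' i w v) - scal (F w * v) * inv_res h w) \<le> norm (F w * v) * norm ?D"
            by (simp only:) (rule order.trans[OF norm_mult_ineq mult_right_mono[OF norm_scal_le norm_ge_zero]])
          also have "\<dots> \<le> (B * norm v) * ((1/2)^n * (2 * norm ?y))"
            using B w by (intro mult_mono inv_res_partial_sum z near) (auto simp: norm_mult intro!: mult_right_mono)
          also have "\<dots> = (B * ((1/2)^n * (2 * norm ?y))) * norm v" by (simp add: mult_ac)
          also have "\<dots> \<le> e * norm v" using n by (intro mult_right_mono) auto
          finally show "norm ((\<Sum>i<n. f' i w v) - scal (F w * v) * inv_res h w) \<le> e * norm v" .
        qed
      qed
    qed
    show "z \<in> ball z d" using d by simp
    show "(\<lambda>n. f n z) sums 0" by (simp add: f_def c)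
  qed simp
  then obtain G where "\<forall>w\<in>ball z d. (G has_derivative (\<lambda>v. scal (F w * v) * inv_res h w)) (at w within ball z d)"
    by blast
  then have "\<And>w. w \<in> ball z d \<Longrightarrow> (G has_derivative (\<lambda>v. scal (F w * v) * inv_res h w)) (at w)"
    by (auto simp: at_within_open[OF _ open_ball])
  with d(1) show ?thesis by (rule that)
qed

definition conv_integrand ::
  "(complex \<Rightarrow> complex) \<Rightarrow> 'a::euclidean_space conv_alg \<Rightarrow> (real \<Rightarrow> complex) \<Rightarrow> real \<Rightarrow> 'a conv_alg" where
  "conv_integrand F h \<gamma> t = scal (F (\<gamma> t) * vector_derivative \<gamma> (at t within {0..1})) * inv_res h (\<gamma> t)"

text \<open>Each parameter has a neighbourhood whose image lies in a disc with a primitive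
  \<open>G\<close>; there \<open>G \<circ> \<gamma>\<close> is continuous and differentiable off a
  finite set, so the fundamental theorem for the Henstock-Kurzweil integral applies whatever the
  size of the derivative.\<close>

lemma conv_integrand_integrable:
  assumes \<gamma>: "valid_path \<gamma>" "path_image \<gamma> \<subseteq> E \<inter> res_set h" and E: "open E" and F: "F holomorphic_on E"
  shows "conv_integrand F h \<gamma> integrable_on {0..1}"
proof -
  have cont: "continuous_on {0..1} \<gamma>" using valid_path_imp_path[OF \<gamma>(1)] by (simp add: path_def)
  obtain S where S: "finite S" "\<And>x. x \<in> {0..1} - S \<Longrightarrow> \<gamma> differentiable at x"
    using \<gamma>(1) unfolding valid_path_def piecewise_C1_differentiable_on_def C1_differentiable_on_eq by blast
  have "conv_integrand F h \<gamma> integrable_on cbox 0 1"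
  \<comment> \<open>Compactness of the parameter interval reduces integrability to small
    subintervals around each point.\<close>
  proof (rule integrable_on_little_subintervals, intro ballI)
    fix s :: real assume s: "s \<in> cbox 0 1"
    then have "\<gamma> s \<in> path_image \<gamma>" by (simp add: path_image_def)
    with \<gamma> have zs: "\<gamma> s \<in> E" "\<gamma> s \<in> res_set h" by auto
    obtain d G where d: "0 < d"
      and G: "\<And>w. w \<in> ball (\<gamma> s) d \<Longrightarrow> (G has_derivative (\<lambda>v. scal (F w * v) * inv_res h w)) (at w)"
      using inv_res_local_primitive[OF zs(2) E zs(1) F] by blast
    have s': "s \<in> {0..1}" using s by simp
    obtain e where e: "e > 0" "\<And>t. t \<in> {0..1} \<Longrightarrow> dist t s < e \<Longrightarrow> dist (\<gamma> t) (\<gamma> s) < d"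
      using cont[unfolded continuous_on_iff, rule_format, OF s' d] by blast
    show "\<exists>e>0. \<forall>u v. s \<in> cbox u v \<and> cbox u v \<subseteq> ball s e \<and> cbox u v \<subseteq> cbox 0 1 \<longrightarrow>
        conv_integrand F h \<gamma> integrable_on cbox u v"
    proof (intro exI[of _ e] conjI allI impI e(1))
      fix u v :: real assume uv: "s \<in> cbox u v \<and> cbox u v \<subseteq> ball s e \<and> cbox u v \<subseteq> cbox 0 1"
      then have uv': "u \<le> v" "{u..v} \<subseteq> {0..1}" "{u..v} \<subseteq> ball s e" by auto
      have in_ball: "\<gamma> t \<in> ball (\<gamma> s) d" if "t \<in> {u..v}" for t
      proof -
        have "t \<in> {0..1}" "t \<in> ball s e" using that uv' by blast+
        then show ?thesis using e(2)[of t] by (simp add: dist_commute)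
      qed
      have "(conv_integrand F h \<gamma> has_integral (G \<circ> \<gamma>) v - (G \<circ> \<gamma>) u) {u..v}"
      proof (rule fundamental_theorem_of_calculus_interior_strong[OF S(1) uv'(1)])
        show "continuous_on {u..v} (G \<circ> \<gamma>)"
        proof (rule continuous_on_compose)
          show "continuous_on {u..v} \<gamma>" by (rule continuous_on_subset[OF cont uv'(2)])
          show "continuous_on (\<gamma> ` {u..v}) G"
          proof (intro continuous_at_imp_continuous_on ballI)
            fix w assume "w \<in> \<gamma> ` {u..v}"
            then have "w \<in> ball (\<gamma> s) d" using in_ball by blast
            from has_derivative_continuous[OF G[OF this]] show "isCont G w" .
          qed
        qed
        fix t assume t: "t \<in> {u<..<v} - S"
        moreover have "0 \<le> u" "v \<le> 1" using uv' by auto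
        ultimately have t1: "t \<in> {u..v}" "t \<in> {0..1}" "0 < t" "t < 1" "t \<notin> S" by auto
        then have "(\<gamma> has_vector_derivative vector_derivative \<gamma> (at t)) (at t)"
          using S(2)[of t] by (simp add: vector_derivative_works)
        then have "(\<gamma> has_derivative (\<lambda>x. x *\<^sub>R vector_derivative \<gamma> (at t))) (at t)"
          by (simp add: has_vector_derivative_def)
        from diff_chain_at[OF this G[OF in_ball[OF t1(1)]]]
        have "(G \<circ> \<gamma> has_vector_derivative scal (F (\<gamma> t) * vector_derivative \<gamma> (at t)) * inv_res h (\<gamma> t)) (at t)"
          by (simp add: has_vector_derivative_def o_def linear_cmul[OF bounded_linear.linear[OF bounded_linear_scal]])
        moreover have "vector_derivative \<gamma> (at t within {0..1}) = vector_derivative \<gamma> (at t)"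
          using t1 S(2)[of t] by (intro vector_derivative_at_within_ivl) (auto simp: vector_derivative_works)
        ultimately show "(G \<circ> \<gamma> has_vector_derivative conv_integrand F h \<gamma> t) (at t)"
          by (simp add: conv_integrand_def)
      qed
      then show "conv_integrand F h \<gamma> integrable_on cbox u v" by auto
    qed
  qed
  then show ?thesis by simp
qed

lemma functional_conv_integral:
  fixes l :: "'a::euclidean_space conv_alg \<Rightarrow> complex"
  assumes l: "bounded_linear l" and lc: "\<And>c x. l (scal c * x) = c * l x"
    and int: "conv_integrand F h \<gamma> integrable_on {0..1}"
  shows "l (integral {0..1} (conv_integrand F h \<gamma>)) = contour_integral \<gamma> (\<lambda>z. F z * l (inv_res h z))"
proof -
  have "((l \<circ> conv_integrand F h \<gamma>) has_integral l (integral {0..1} (conv_integrand F h \<gamma>))) {0..1}"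
    by (rule has_integral_linear[OF integrable_integral[OF int] l])
  then have "((\<lambda>z. F z * l (inv_res h z)) has_contour_integral l (integral {0..1} (conv_integrand F h \<gamma>))) \<gamma>"
    unfolding has_contour_integral_def by (rule has_integral_eq_rhs[OF has_integral_eq, rotated])
       (auto simp: conv_integrand_def lc)
  then show ?thesis by (rule contour_integral_unique[symmetric])
qed

section \<open>Cauchy's theorem for cycles\<close>

text \<open>The loops are joined by a path inside \<open>V\<close> that is run forth and back, so
  its two contributions cancel. Merging makes a theorem about a single closed path applicable to
  several loops.\<close>

lemma merge_two_loops:
  assumes V: "open V" "connected V"
    and a: "valid_path a" "pathfinish a = pathstart a" "path_image a \<subseteq> V"
    and b: "valid_path b" "pathfinish b = pathstart b" "path_image b \<subseteq> V"
  obtains c where "valid_path c" "pathfinish c = pathstart c" "path_image c \<subseteq> V"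
    "\<And>f. f holomorphic_on V \<Longrightarrow> contour_integral c f = contour_integral a f + contour_integral b f"
proof -
  have "pathstart a \<in> V" "pathstart b \<in> V" using a b pathstart_in_path_image by blast+
  then obtain p where p: "polynomial_function p" "path_image p \<subseteq> V" "pathstart p = pathstart a" "pathfinish p = pathstart b"
    using connected_open_polynomial_connected[OF V] by blast
  have vp: "valid_path p" by (rule valid_path_polynomial_function[OF p(1)])
  define c where "c = a +++ (p +++ (b +++ reversepath p))"
  have "contour_integral c f = contour_integral a f + contour_integral b f" if f: "f holomorphic_on V" for f
  proof -
    have int: "f contour_integrable_on q" if "valid_path q" "path_image q \<subseteq> V" for q
      using contour_integrable_holomorphic_simple[OF f V(1)] that by blast
    have "f contour_integrable_on a" "f contour_integrable_on b" "f contour_integrable_on p"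
      "f contour_integrable_on reversepath p"
      using a b p vp by (auto intro!: int)
    then show ?thesis
      unfolding c_def using a b p vp
      by (simp add: contour_integral_join contour_integrable_joinI valid_path_join contour_integral_reversepath)
  qed
  moreover have "valid_path c" "pathfinish c = pathstart c" "path_image c \<subseteq> V"
    unfolding c_def using a b p vp by (auto simp: valid_path_join path_image_join)
  ultimately show ?thesis by (intro that)
qed

lemma merge_loops:
  assumes V: "open V" "connected V" and "\<Gamma> \<noteq> []"
    and "\<forall>\<gamma>\<in>set \<Gamma>. valid_path \<gamma> \<and> pathfinish \<gamma> = pathstart \<gamma> \<and> path_image \<gamma> \<subseteq> V"
  shows "\<exists>c. valid_path c \<and> pathfinish c = pathstart c \<and> path_image c \<subseteq> V \<and>
    (\<forall>f. f holomorphic_on V \<longrightarrow> contour_integral c f = (\<Sum>\<gamma>\<leftarrow>\<Gamma>. contour_integral \<gamma> f))"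
  using assms(3,4)
proof (induct \<Gamma>)
  case (Cons \<gamma> \<Gamma>)
  show ?case
  proof (cases "\<Gamma> = []")
    case True
    then show ?thesis using Cons.prems by (intro exI[of _ \<gamma>]) simp
  next
    case False
    then obtain b where b: "valid_path b" "pathfinish b = pathstart b" "path_image b \<subseteq> V"
      "\<And>f. f holomorphic_on V \<Longrightarrow> contour_integral b f = (\<Sum>\<gamma>\<leftarrow>\<Gamma>. contour_integral \<gamma> f)"
      using Cons by auto
    have "valid_path \<gamma>" "pathfinish \<gamma> = pathstart \<gamma>" "path_image \<gamma> \<subseteq> V" using Cons.prems by auto
    then obtain c where "valid_path c" "pathfinish c = pathstart c" "path_image c \<subseteq> V"
      "\<And>f. f holomorphic_on V \<Longrightarrow> contour_integral c f = contour_integral \<gamma> f + contour_integral b f"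
      using merge_two_loops[OF V _ _ _ b(1-3)] by blast
    then show ?thesis using b(4) by (intro exI[of _ c]) simp
  qed
qed simp

text \<open>Loops can be merged only inside a component of \<open>U\<close>, so the induction
  removes one component \<open>V\<close> at a time. The difficulty is that the hypothesis controls
  only the total winding number, so the loops in \<open>V\<close> and those outside must be shown to
  have winding sum zero separately.\<close>

lemma Cauchy_theorem_cycle:
  assumes U: "open U" and f: "f holomorphic_on U"
    and loops: "\<forall>\<gamma>\<in>set \<Gamma>. valid_path \<gamma> \<and> pathfinish \<gamma> = pathstart \<gamma> \<and> path_image \<gamma> \<subseteq> U"
    and zero: "\<And>w. w \<notin> U \<Longrightarrow> (\<Sum>\<gamma>\<leftarrow>\<Gamma>. winding_number \<gamma> w) = 0"
  shows "(\<Sum>\<gamma>\<leftarrow>\<Gamma>. contour_integral \<gamma> f) = 0"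
  using loops zero
proof (induct "length \<Gamma>" arbitrary: \<Gamma> rule: less_induct)
  case less
  show ?case
  proof (cases \<Gamma>)
    case (Cons \<gamma>0 \<Gamma>0)
    define V where "V = connected_component_set U (pathstart \<gamma>0)"
    have V: "open V" "connected V" "V \<subseteq> U" "V \<in> components U"
    proof -
      have "pathstart \<gamma>0 \<in> U" using less.prems(1) Cons pathstart_in_path_image by fastforce
      then show "V \<in> components U" unfolding V_def components_def by blast
    qed (auto simp: V_def open_connected_component U connected_component_subset)
    define G where "G = filter (\<lambda>\<gamma>. path_image \<gamma> \<subseteq> V) \<Gamma>"
    define G' where "G' = filter (\<lambda>\<gamma>. \<not> path_image \<gamma> \<subseteq> V) \<Gamma>"
    have split: "(\<Sum>\<gamma>\<leftarrow>\<Gamma>. k \<gamma>) = (\<Sum>\<gamma>\<leftarrow>G. k \<gamma>) + (\<Sum>\<gamma>\<leftarrow>G'. k \<gamma>)" for k :: "(real \<Rightarrow> complex) \<Rightarrow> complex"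
      unfolding G_def G'_def by (induct \<Gamma>) auto
    have in_V: "path_image \<gamma> \<subseteq> V" if "\<gamma> \<in> set \<Gamma>" "path_image \<gamma> \<inter> V \<noteq> {}" for \<gamma>
    proof (rule components_maximal[OF V(4)])
      show "connected (path_image \<gamma>)" "path_image \<gamma> \<subseteq> U"
        using that less.prems(1) by (auto intro: connected_path_image valid_path_imp_path)
    qed (use that in blast)
    have disj: "path_image \<gamma> \<inter> V = {}" "path_image \<gamma> \<subseteq> U" "path \<gamma>" "pathfinish \<gamma> = pathstart \<gamma>" if "\<gamma> \<in> set G'" for \<gamma>
      using that in_V less.prems(1) by (auto simp: G'_def intro: valid_path_imp_path)
    have "path_image \<gamma>0 \<subseteq> V"
    proof (rule in_V)
      have "pathstart \<gamma>0 \<in> U" using less.prems(1) Cons pathstart_in_path_image by fastforce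
      then have "pathstart \<gamma>0 \<in> V" by (simp add: V_def connected_component_refl)
      then show "path_image \<gamma>0 \<inter> V \<noteq> {}" using pathstart_in_path_image by blast
    qed (simp add: Cons)
    then have "\<gamma>0 \<in> set G" by (simp add: G_def Cons)
    then have "G \<noteq> []" by auto
    moreover have "length G + length G' = length \<Gamma>"
      using sum_length_filter_compl[of "\<lambda>\<gamma>. path_image \<gamma> \<subseteq> V" \<Gamma>] by (simp add: G_def G'_def)
    ultimately have len: "length G' < length \<Gamma>" by (cases G) auto
    obtain c where c: "valid_path c" "pathfinish c = pathstart c" "path_image c \<subseteq> V"
      and c_int: "\<And>k. k holomorphic_on V \<Longrightarrow> contour_integral c k = (\<Sum>\<gamma>\<leftarrow>G. contour_integral \<gamma> k)"
      using merge_loops[OF V(1,2) \<open>G \<noteq> []\<close>] less.prems(1) by (auto simp: G_def)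
    have pc: "path c" using c by (simp add: valid_path_imp_path)
    have c_wn: "winding_number c w = (\<Sum>\<gamma>\<leftarrow>G. winding_number \<gamma> w)" if w: "w \<notin> V" for w
    proof -
      have "(\<lambda>z. 1 / (z - w)) holomorphic_on V" using w by (intro holomorphic_intros) auto
      from c_int[OF this] have "1 / (2 * of_real pi * \<i>) * contour_integral c (\<lambda>z. 1 / (z - w)) =
          (\<Sum>\<gamma>\<leftarrow>G. 1 / (2 * of_real pi * \<i>) * contour_integral \<gamma> (\<lambda>z. 1 / (z - w)))"
        by (simp only: sum_list_const_mult)
      moreover have "map (\<lambda>\<gamma>. 1 / (2 * of_real pi * \<i>) * contour_integral \<gamma> (\<lambda>z. 1 / (z - w))) G = map (\<lambda>\<gamma>. winding_number \<gamma> w) G"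
        using less.prems(1) w
        by (intro map_cong refl) (subst winding_number_valid_path, auto simp: G_def)
      moreover have "winding_number c w = 1 / (2 * of_real pi * \<i>) * contour_integral c (\<lambda>z. 1 / (z - w))"
        using c w by (subst winding_number_valid_path) auto
      ultimately show ?thesis by (simp only:)
    qed
    \<comment> \<open>\<open>m\<close> collects the loops outside \<open>V\<close>; off
      \<open>U\<close> it is the negative of the winding number of the merged loop
      \<open>c\<close>.\<close>
    define m where "m w = (\<Sum>\<gamma>\<leftarrow>G'. winding_number \<gamma> w)" for w
    have cm: "winding_number c w + m w = 0" if "w \<notin> U" for w
    proof -
      have "w \<notin> V" using that V(3) by blast
      then show ?thesis
        using less.prems(2)[OF that] c_wn[of w] split[of "\<lambda>\<gamma>. winding_number \<gamma> w"] by (simp add: m_def)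
    qed
    \<comment> \<open>Components of an open set are relatively closed, so a boundary point of
      \<open>V\<close> leaves \<open>U\<close> and comes under the hypothesis on winding
      numbers.\<close>
    have fr: "frontier V \<inter> U = {}"
    proof -
      have "w \<notin> closure V" if "w \<in> U" "w \<notin> V" for w
      proof -
        have "open (connected_component_set U w)" using U by (rule open_connected_component)
        moreover have "w \<in> connected_component_set U w" using that by (simp add: connected_component_refl)
        moreover have "connected_component_set U w \<inter> V = {}"
          using that connected_component_nonoverlap[of U w "pathstart \<gamma>0"] connected_component_eq[of w U "pathstart \<gamma>0"]
          by (auto simp: V_def)
        ultimately show ?thesis using open_Int_closure_eq_empty by blast
      qed
      then show ?thesis using V(1) by (auto simp: frontier_def interior_open)
    qed
    \<comment> \<open>The other loops avoid the connected set \<open>closure V\<close>, on which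
      their winding numbers are therefore constant.\<close>
    have m_const: "m w = m z" if "w \<in> closure V" "z \<in> closure V" for w z
    proof -
      have "winding_number \<gamma> w = winding_number \<gamma> z" if g: "\<gamma> \<in> set G'" for \<gamma>
      proof (rule winding_number_eq[where S = "closure V"])
        have "closure V \<subseteq> V \<union> frontier V" using closure_Un_frontier by blast
        then show "closure V \<inter> path_image \<gamma> = {}" using disj[OF g] fr by blast
      qed (use disj[OF g] \<open>w \<in> closure V\<close> \<open>z \<in> closure V\<close> V(2) in \<open>auto intro: connected_imp_connected_closure\<close>)
      then show ?thesis unfolding m_def by (intro arg_cong[of _ _ sum_list] map_cong) auto
    qed
    have ne: "V \<noteq> {}" using V(4) in_components_nonempty by blast
    \<comment> \<open>By constancy a single point with \<open>m = 0\<close> is enough. For bounded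
      \<open>V\<close> it is a point of \<open>closure V\<close> farthest from 0: it lies outside
      \<open>U\<close>, and \<open>c\<close> does not wind around it. For unbounded \<open>V\<close>
      it is a point of \<open>V\<close> beyond the reach of the other loops.\<close>
    have m0: "m w = 0" if w: "w \<in> closure V" for w
    proof (cases "bounded V")
      case True
      then have "compact (closure V)" by (simp add: compact_closure)
      then have "\<exists>x\<in>closure V. \<forall>y\<in>closure V. norm y \<le> norm x"
        by (rule continuous_attains_sup) (use ne in \<open>auto intro: continuous_intros\<close>)
      then obtain x where x: "x \<in> closure V" "\<And>y. y \<in> closure V \<Longrightarrow> norm y \<le> norm x" by blast
      have "V \<subseteq> cball 0 (norm x)"
        using x(2) closure_subset[of V] by (auto simp: subset_iff)
      then have "V \<subseteq> interior (cball 0 (norm x))" by (rule interior_maximal) (rule V(1))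
      then have sub: "V \<subseteq> ball 0 (norm x)" by simp
      then have "x \<notin> V" by auto
      then have "x \<in> frontier V" using x V(1) by (simp add: frontier_def interior_open)
      then have "x \<notin> U" using fr by blast
      moreover have "winding_number c x = 0"
        by (rule winding_number_zero_outside[OF pc, where s = "ball 0 (norm x)"]) (use c sub in auto)
      ultimately have "m x = 0" using cm[of x] by simp
      then show ?thesis using m_const[OF w x(1)] by simp
    next
      case False
      have "bounded (\<Union>\<gamma>\<in>set G'. path_image \<gamma>)"
        using disj(3) by (intro bounded_Union finite_imageI) (auto intro: bounded_path_image)
      then obtain R where "\<forall>y\<in>(\<Union>\<gamma>\<in>set G'. path_image \<gamma>). norm y \<le> R"
        unfolding bounded_iff ..
      then have R: "norm y \<le> R" if "\<gamma> \<in> set G'" "y \<in> path_image \<gamma>" for \<gamma> y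
        using that by blast
      have "\<not> (\<forall>x\<in>V. norm x \<le> R)" using False unfolding bounded_iff by blast
      then obtain x where x: "x \<in> V" "norm x > R" by (auto simp: not_le)
      have "winding_number \<gamma> x = 0" if "\<gamma> \<in> set G'" for \<gamma>
        by (rule winding_number_zero_outside[where s = "cball 0 R"]) (use disj[OF that] R[OF that] x in auto)
      then have "m x = 0" by (simp add: m_def cong: map_cong)
      then show ?thesis using m_const[OF w, of x] x closure_subset[of V] by auto
    qed
    \<comment> \<open>On the frontier of \<open>V\<close> the winding number of \<open>c\<close>
      vanishes because \<open>m\<close> does. Level sets of winding numbers are open off the path,
      so \<open>Z\<close> is open and closed, hence the whole plane.\<close>
    have wn0: "winding_number c w = 0" if "w \<notin> V" for w
    proof -
      define Z where "Z = V \<union> {w. w \<notin> path_image c \<and> winding_number c w = 0}"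
      have fr0: "frontier V \<subseteq> {w. w \<notin> path_image c \<and> winding_number c w = 0}"
      proof
        fix x assume x: "x \<in> frontier V"
        then have "x \<notin> U" "x \<in> closure V" "x \<notin> V" using fr V(1) by (auto simp: frontier_def interior_open)
        then show "x \<in> {w. w \<notin> path_image c \<and> winding_number c w = 0}"
          using cm[of x] m0[of x] c(3) by auto
      qed
      have "open Z" unfolding Z_def by (intro open_Un V open_winding_number_levelsets pc c)
      moreover have "- Z = - closure V \<inter> - {w. w \<notin> path_image c \<and> winding_number c w = 0}"
        using fr0 closure_Un_frontier[of V] by (auto simp: Z_def)
      moreover have "- closure V \<inter> - {w. w \<notin> path_image c \<and> winding_number c w = 0}
         = - closure V \<inter> (\<Union>n\<in>-{0}. {w. w \<notin> path_image c \<and> winding_number c w = n})"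
        using c(3) closure_subset[of V] by auto
      moreover have "open \<dots>"
        by (intro open_Int open_UN open_winding_number_levelsets pc c ballI) auto
      ultimately have "closed Z" by (simp add: closed_def)
      with \<open>open Z\<close> have "Z = UNIV" using connected_clopen[of "UNIV :: complex set"] ne by (auto simp: Z_def)
      then show ?thesis using that by (auto simp: Z_def)
    qed
    have "contour_integral c f = 0"
      using Cauchy_theorem_global[OF V(1) holomorphic_on_subset[OF f V(3)] c(1,2,3) wn0]
      by (simp add: contour_integral_unique)
    then have "(\<Sum>\<gamma>\<leftarrow>G. contour_integral \<gamma> f) = 0"
      using c_int[OF holomorphic_on_subset[OF f V(3)]] by simp
    moreover have "(\<Sum>\<gamma>\<leftarrow>G'. contour_integral \<gamma> f) = 0"
    proof (rule less.hyps[OF len])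
      show "\<forall>\<gamma>\<in>set G'. valid_path \<gamma> \<and> pathfinish \<gamma> = pathstart \<gamma> \<and> path_image \<gamma> \<subseteq> U"
        using less.prems(1) by (auto simp: G'_def)
      show "(\<Sum>\<gamma>\<leftarrow>G'. winding_number \<gamma> w) = 0" if "w \<notin> U" for w
      proof -
        have "w \<notin> V" using that V(3) by blast
        then show ?thesis using cm[OF that] wn0[of w] by (simp add: m_def)
      qed
    qed
    ultimately show ?thesis using split[of "\<lambda>\<gamma>. contour_integral \<gamma> f"] by simp
  qed simp
qed

section \<open>Functional calculus in the convolution algebra\<close>

lemma neighbourhood_boundary_paths:
  assumes "neighbourhood_boundary S E \<Gamma>" "\<gamma> \<in> set \<Gamma>"
  shows "valid_path \<gamma>" "pathfinish \<gamma> = pathstart \<gamma>" "path_image \<gamma> \<subseteq> E - S"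
proof -
  from assms(1) obtain U where U: "open U" "S \<subseteq> U" "closure U \<subseteq> E"
    "frontier U = (\<Union>\<gamma>\<in>set \<Gamma>. path_image \<gamma>)"
    unfolding neighbourhood_boundary_def by blast
  have "path_image \<gamma> \<subseteq> frontier U" using U assms(2) by blast
  then show "path_image \<gamma> \<subseteq> E - S" using U by (auto simp: frontier_def interior_open)
  show "valid_path \<gamma>" "pathfinish \<gamma> = pathstart \<gamma>"
    using assms unfolding neighbourhood_boundary_def by blast+
qed

lemma neighbourhood_boundary_winding:
  assumes "neighbourhood_boundary S E \<Gamma>"
  shows "w \<notin> E \<Longrightarrow> (\<Sum>\<gamma>\<leftarrow>\<Gamma>. winding_number \<gamma> w) = 0"
    and "w \<in> S \<Longrightarrow> (\<Sum>\<gamma>\<leftarrow>\<Gamma>. winding_number \<gamma> w) = 1"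
  using assms unfolding neighbourhood_boundary_def by blast+

text \<open>One contour followed by the reverse of the other is a cycle in \<open>E - S\<close> with
  winding sum 0 off that set: each contributes 0 outside \<open>E\<close>, and on \<open>S\<close>
  the two values 1 cancel.\<close>

lemma neighbourhood_boundary_integral_unique:
  assumes \<Gamma>: "neighbourhood_boundary S E \<Gamma>" and \<Delta>: "neighbourhood_boundary S E \<Delta>"
    and "open (E - S)" and f: "f holomorphic_on E - S"
  shows "(\<Sum>\<gamma>\<leftarrow>\<Gamma>. contour_integral \<gamma> f) = (\<Sum>\<gamma>\<leftarrow>\<Delta>. contour_integral \<gamma> f)"
proof -
  note g = neighbourhood_boundary_paths[OF \<Gamma>] and d = neighbourhood_boundary_paths[OF \<Delta>]
  have neg: "(\<Sum>x\<leftarrow>xs. - k x) = - (\<Sum>x\<leftarrow>xs. k x)" for k :: "(real \<Rightarrow> complex) \<Rightarrow> complex" and xs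
    by (induct xs) auto
  have "(\<Sum>\<gamma>\<leftarrow>\<Gamma> @ map reversepath \<Delta>. contour_integral \<gamma> f) = 0"
  proof (rule Cauchy_theorem_cycle[OF assms(3) f])
    show "\<forall>\<gamma>\<in>set (\<Gamma> @ map reversepath \<Delta>). valid_path \<gamma> \<and> pathfinish \<gamma> = pathstart \<gamma> \<and> path_image \<gamma> \<subseteq> E - S"
    proof -
      have "\<forall>\<gamma>\<in>set \<Gamma>. valid_path \<gamma> \<and> pathfinish \<gamma> = pathstart \<gamma> \<and> path_image \<gamma> \<subseteq> E - S"
        using g by blast
      moreover have "\<forall>\<gamma>\<in>set \<Delta>. valid_path (reversepath \<gamma>) \<and>
          pathfinish (reversepath \<gamma>) = pathstart (reversepath \<gamma>) \<and> path_image (reversepath \<gamma>) \<subseteq> E - S"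
        using d by simp
      ultimately show ?thesis by (simp only: set_append set_map ball_Un ball_simps simp_thms)
    qed
    fix w assume w: "w \<notin> E - S"
    have "map (\<lambda>\<gamma>. winding_number (reversepath \<gamma>) w) \<Delta> = map (\<lambda>\<gamma>. - winding_number \<gamma> w) \<Delta>"
      using d w by (intro map_cong refl winding_number_reversepath) (auto intro: valid_path_imp_path)
    then have "(\<Sum>\<gamma>\<leftarrow>\<Gamma> @ map reversepath \<Delta>. winding_number \<gamma> w)
       = (\<Sum>\<gamma>\<leftarrow>\<Gamma>. winding_number \<gamma> w) + (\<Sum>\<gamma>\<leftarrow>\<Delta>. - winding_number \<gamma> w)"
      by (simp only: map_append sum_list.append map_map o_def)
    also have "\<dots> = (\<Sum>\<gamma>\<leftarrow>\<Gamma>. winding_number \<gamma> w) - (\<Sum>\<gamma>\<leftarrow>\<Delta>. winding_number \<gamma> w)"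
      by (simp only: neg) simp
    also have "\<dots> = 0"
      using w neighbourhood_boundary_winding[OF \<Gamma>, of w] neighbourhood_boundary_winding[OF \<Delta>, of w]
      by (cases "w \<in> E") auto
    finally show "(\<Sum>\<gamma>\<leftarrow>\<Gamma> @ map reversepath \<Delta>. winding_number \<gamma> w) = 0" .
  qed
  moreover have "map (\<lambda>\<gamma>. contour_integral (reversepath \<gamma>) f) \<Delta> = map (\<lambda>\<gamma>. - contour_integral \<gamma> f) \<Delta>"
    using d by (intro map_cong refl contour_integral_reversepath) auto
  ultimately have "(\<Sum>\<gamma>\<leftarrow>\<Gamma>. contour_integral \<gamma> f) + (\<Sum>\<gamma>\<leftarrow>\<Delta>. - contour_integral \<gamma> f) = 0"
    by (simp only: map_append sum_list.append map_map o_def)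
  then show ?thesis by (simp only: neg) simp
qed

text \<open>Any real functional is the real part of a complex linear one.\<close>

definition complexify :: "('a::euclidean_space conv_alg \<Rightarrow> real) \<Rightarrow> 'a conv_alg \<Rightarrow> complex" where
  "complexify r x = Complex (r x) (- r (scal \<i> * x))"

lemma complexify:
  assumes r: "bounded_linear r"
  shows "bounded_linear (complexify r)" "complexify r (scal c * x) = c * complexify r x"
proof -
  have eq: "complexify r = (\<lambda>x. of_real (r x) - \<i> * of_real (r (scal \<i> * x)))"
    by (rule ext) (simp add: complexify_def complex_eq_iff)
  have ri: "bounded_linear (\<lambda>x. r (scal \<i> * x))"
    by (rule bounded_linear_compose[OF r bounded_linear_mult_right])
  show "bounded_linear (complexify r)"
    unfolding eq
    by (intro bounded_linear_sub bounded_linear_compose[OF bounded_linear_of_real r]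
        bounded_linear_compose[OF bounded_linear_mult_right] bounded_linear_compose[OF bounded_linear_of_real ri])
  interpret r: bounded_linear r by (rule r)
  have scal_r: "scal (of_real a) * y = a *\<^sub>R y" for a and y :: "'a conv_alg"
  proof -
    have "a *\<^sub>R (1 :: complex) = of_real a" by (simp add: scaleR_conv_of_real)
    then have "scal (of_real a) = a *\<^sub>R (1 :: 'a conv_alg)"
      using linear_cmul[OF bounded_linear.linear[OF bounded_linear_scal], of a 1] by simp
    then show ?thesis by simp
  qed
  have c: "scal c * y = Re c *\<^sub>R y + Im c *\<^sub>R (scal \<i> * y)" for y :: "'a conv_alg"
  proof -
    have "of_real (Re c) + of_real (Im c) * \<i> = c" by (simp add: complex_eq_iff)
    then have "scal c = scal (of_real (Re c)) + scal (of_real (Im c)) * (scal \<i> :: 'a conv_alg)"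
      by (simp only: scal_add[symmetric] scal_mult[symmetric])
    then show ?thesis by (simp add: distrib_right mult.assoc scal_r)
  qed
  have ii: "scal \<i> * (scal \<i> * x) = - x"
    by (simp add: mult.assoc[symmetric] scal_mult[symmetric] scal_minus)
  have "scal \<i> * (scal c * x) = scal c * (scal \<i> * x)" by (simp add: mult_ac)
  then have "r (scal \<i> * (scal c * x)) = Re c * r (scal \<i> * x) - Im c * r x"
    by (simp only: c[of "scal \<i> * x"] ii r.add r.scaleR linear_neg[OF bounded_linear.linear[OF r]]) simp
  moreover have "r (scal c * x) = Re c * r x + Im c * r (scal \<i> * x)"
    by (simp add: c r.add r.scaleR)
  ultimately show "complexify r (scal c * x) = c * complexify r x"
    by (simp add: complexify_def complex_eq_iff)
qed

definition conv_calculus ::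
  "(complex \<Rightarrow> complex) \<Rightarrow> 'a::euclidean_space conv_alg \<Rightarrow> (real \<Rightarrow> complex) list \<Rightarrow> 'a conv_alg" where
  "conv_calculus F h \<Gamma> =
     scal (1 / (2 * of_real pi * \<i>)) * (\<Sum>\<gamma>\<leftarrow>\<Gamma>. integral {0..1} (conv_integrand F h \<gamma>))"

text \<open>Bounded linear functionals pass through the vector-valued integral, so questions about
  the calculus in the algebra become questions about scalar contour integrals.\<close>

lemma
  fixes h :: "'a::euclidean_space conv_alg"
  assumes \<Gamma>: "neighbourhood_boundary (- res_set h) E \<Gamma>" and E: "open E" and F: "F holomorphic_on E"
  shows conv_calculus_integrable: "\<gamma> \<in> set \<Gamma> \<Longrightarrow> conv_integrand F h \<gamma> integrable_on {0..1}"
    and functional_conv_calculus: "bounded_linear l \<Longrightarrow> (\<And>c x. l (scal c * x) = c * l x) \<Longrightarrow>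
      l (conv_calculus F h \<Gamma>) = 1 / (2 * of_real pi * \<i>) * (\<Sum>\<gamma>\<leftarrow>\<Gamma>. contour_integral \<gamma> (\<lambda>z. F z * l (inv_res h z)))"
proof -
  show int: "conv_integrand F h \<gamma> integrable_on {0..1}" if "\<gamma> \<in> set \<Gamma>" for \<gamma>
    using neighbourhood_boundary_paths[OF \<Gamma> that] by (intro conv_integrand_integrable[OF _ _ E F]) auto
  assume l: "bounded_linear l" and lc: "\<And>c x. l (scal c * x) = c * l x"
  have "l (\<Sum>\<gamma>\<leftarrow>\<Delta>. integral {0..1} (conv_integrand F h \<gamma>)) = (\<Sum>\<gamma>\<leftarrow>\<Delta>. contour_integral \<gamma> (\<lambda>z. F z * l (inv_res h z)))"
    if "set \<Delta> \<subseteq> set \<Gamma>" for \<Delta>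
    using that
  proof (induct \<Delta>)
    case Nil
    then show ?case by (simp add: linear_0[OF bounded_linear.linear[OF l]])
  next
    case (Cons \<gamma> \<Delta>)
    then show ?case
      by (simp add: linear_add[OF bounded_linear.linear[OF l]] functional_conv_integral[OF l lc int])
  qed
  then show "l (conv_calculus F h \<Gamma>) = 1 / (2 * of_real pi * \<i>) * (\<Sum>\<gamma>\<leftarrow>\<Gamma>. contour_integral \<gamma> (\<lambda>z. F z * l (inv_res h z)))"
    by (simp add: conv_calculus_def lc)
qed

text \<open>Matrix coefficients of the operators separate elements of the algebra. Each is made
  complex linear by \<open>complexify\<close>, so that its resolvent function is holomorphic and the
  scalar contour integrals can be compared.\<close>

lemma conv_calculus_unique:
  fixes h :: "'a::euclidean_space conv_alg"
  assumes \<Gamma>: "neighbourhood_boundary (- res_set h) E \<Gamma>" and \<Delta>: "neighbourhood_boundary (- res_set h) E \<Delta>"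
    and E: "open E" and F: "F holomorphic_on E"
  shows "conv_calculus F h \<Gamma> = conv_calculus F h \<Delta>"
proof -
  have "conv_alg_op (conv_calculus F h \<Gamma>) f \<bullet> g = conv_alg_op (conv_calculus F h \<Delta>) f \<bullet> g" for f g
  proof -
    define r :: "'a conv_alg \<Rightarrow> real" where "r x = conv_alg_op x f \<bullet> g" for x
    have r: "bounded_linear r"
    proof
      fix x y :: "'a conv_alg" and a
      show "r (x + y) = r x + r y"
        by (simp add: r_def plus_conv_alg.rep_eq plus_blinfun.rep_eq inner_add_left)
      show "r (a *\<^sub>R x) = a *\<^sub>R r x"
        by (simp add: r_def scaleR_conv_alg.rep_eq scaleR_blinfun.rep_eq)
      have "norm (r x) \<le> norm x * (norm f * norm g)" for x
      proof -
        have "norm (r x) \<le> norm (conv_alg_op x f) * norm g"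
          unfolding r_def real_norm_def by (rule Cauchy_Schwarz_ineq2)
        also have "\<dots> \<le> (norm x * norm f) * norm g"
          by (intro mult_right_mono order.trans[OF norm_blinfun] norm_conv_alg_op_le) auto
        finally show ?thesis by (simp add: mult.assoc)
      qed
      then show "\<exists>K. \<forall>x. norm (r x) \<le> norm x * K" by blast
    qed
    note c = complexify[OF r]
    have hol: "(\<lambda>z. F z * complexify r (inv_res h z)) holomorphic_on E - - res_set h"
      by (intro holomorphic_on_mult holomorphic_on_subset[OF F]
          holomorphic_on_subset[OF holomorphic_functional_inv_res[OF c]]) auto
    have op: "open (E - - res_set h)" using E open_res_set[of h] by (simp add: Diff_eq open_Int)
    have "complexify r (conv_calculus F h \<Gamma>) = complexify r (conv_calculus F h \<Delta>)"
      unfolding functional_conv_calculus[OF \<Gamma> E F c] functional_conv_calculus[OF \<Delta> E F c]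
      using neighbourhood_boundary_integral_unique[OF \<Gamma> \<Delta> op hol] by simp
    then show ?thesis by (simp add: complexify_def r_def)
  qed
  then have "conv_alg_op (conv_calculus F h \<Gamma>) = conv_alg_op (conv_calculus F h \<Delta>)"
    by (intro blinfun_eqI) (metis vector_eq_rdot)
  then show ?thesis by (simp add: conv_alg_op_inject)
qed

lemma conv_char_scal_mult: "conv_char (scal c * x) = c * conv_char x"
  by (simp add: conv_char_mult conv_char_scal)

lemma conv_char_diff: "conv_char (x - y) = conv_char x - conv_char y"
  using conv_char_add[of "x - y" y] by simp

text \<open>The scalar part is the integral of \<open>F z / z\<close>. Since \<open>F 0 = 0\<close>
  the singularity at 0 is removable, so the integral vanishes by Cauchy's theorem on
  \<open>E\<close>, with no residue to evaluate.\<close>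

lemma conv_calculus_kernel:
  fixes h :: "'a::euclidean_space conv_alg"
  assumes \<Gamma>: "neighbourhood_boundary (- res_set h) E \<Gamma>" and E: "open E" and F: "F holomorphic_on E" "F 0 = 0"
    and h: "conv_char h = 0" and sub: "- res_set h \<subseteq> E"
  obtains k where "borel_L1 k" "conv_calculus F h \<Gamma> = conv_elem 0 k"
proof -
  have char: "z * conv_char (inv_res h z) = 1" if "z \<in> res_set h" for z
  proof -
    have "conv_char ((scal z - h) * inv_res h z) = 1" by (simp add: inv_res that conv_char_1)
    then show ?thesis by (simp add: conv_char_mult conv_char_diff conv_char_scal h)
  qed
  \<comment> \<open>At \<open>z = 0\<close> the identity \<open>char\<close> would read 0 = 1, so 0
    lies in the spectrum and hence in \<open>E\<close>.\<close>
  then have "0 \<notin> res_set h" by force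
  then have "0 \<in> E" using sub by auto
  \<comment> \<open>The difference quotient of \<open>F\<close> at 0, with the derivative filling
    the removable singularity.\<close>
  define g where "g z = (if z = 0 then deriv F 0 else F z / z)" for z
  have "(\<lambda>z. if z = 0 then deriv F 0 else (F z - F 0) / (z - 0)) holomorphic_on E"
    by (rule pole_lemma_open[OF F(1) E])
  moreover have "g = (\<lambda>z. if z = 0 then deriv F 0 else (F z - F 0) / (z - 0))"
    by (auto simp: g_def fun_eq_iff F)
  ultimately have g: "g holomorphic_on E" by simp
  have "map (\<lambda>\<gamma>. contour_integral \<gamma> (\<lambda>z. F z * conv_char (inv_res h z))) \<Gamma> = map (\<lambda>\<gamma>. contour_integral \<gamma> g) \<Gamma>"
  proof (intro map_cong refl contour_integral_eq)
    fix \<gamma> z assume "\<gamma> \<in> set \<Gamma>" "z \<in> path_image \<gamma>"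
    then have z: "z \<in> res_set h" using neighbourhood_boundary_paths(3)[OF \<Gamma>] by blast
    with \<open>0 \<notin> res_set h\<close> have "z \<noteq> 0" by auto
    then show "F z * conv_char (inv_res h z) = g z"
      using char[OF z] by (simp add: g_def field_simps)
  qed
  moreover have "(\<Sum>\<gamma>\<leftarrow>\<Gamma>. contour_integral \<gamma> g) = 0"
    by (rule Cauchy_theorem_cycle[OF E g])
       (use neighbourhood_boundary_paths[OF \<Gamma>] neighbourhood_boundary_winding[OF \<Gamma>] in auto)
  ultimately have "(\<Sum>\<gamma>\<leftarrow>\<Gamma>. contour_integral \<gamma> (\<lambda>z. F z * conv_char (inv_res h z))) = 0"
    by (simp only:)
  then have "conv_char (conv_calculus F h \<Gamma>) = 0"
    by (simp add: functional_conv_calculus[OF \<Gamma> E F(1) bounded_linear_conv_char conv_char_scal_mult])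
  moreover obtain c k where k: "borel_L1 k" "conv_calculus F h \<Gamma> = conv_elem c k" by (rule conv_elem_cases)
  ultimately have "c = 0" by (simp add: conv_char_conv_elem)
  with k show ?thesis using that by blast
qed

section \<open>Invariant integrals\<close>

text \<open>Uniqueness of Haar measure: the image of the density \<open>w\<close> under
  \<open>q\<close> is translation invariant, hence proportional to Lebesgue measure. A double
  integral is evaluated in both orders, and the product form avoids dividing by constants that might
  be 0 or infinite.\<close>

lemma invariant_integral_unique:
  fixes w :: "'b::euclidean_space \<Rightarrow> ennreal" and q :: "'b \<Rightarrow> 'a::euclidean_space"
  assumes [measurable]: "w \<in> borel_measurable borel" "q \<in> borel_measurable borel"
    "f \<in> borel_measurable borel" "B \<in> sets borel"
    and inv: "\<And>h c. h \<in> borel_measurable borel \<Longrightarrow>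
      (\<integral>\<^sup>+x. w x * h (c + q x) \<partial>lborel) = (\<integral>\<^sup>+x. w x * h (q x) \<partial>lborel)"
  shows "(\<integral>\<^sup>+x. w x * indicator B (q x) \<partial>lborel) * (\<integral>\<^sup>+y. f y \<partial>lborel)
    = emeasure lborel B * (\<integral>\<^sup>+x. w x * f (q x) \<partial>lborel)"
proof -
  have "(\<integral>\<^sup>+x. w x * indicator B (q x) \<partial>lborel) * (\<integral>\<^sup>+y. f y \<partial>lborel)
      = (\<integral>\<^sup>+x. w x * indicator B (q x) * (\<integral>\<^sup>+y. f (q x + y) \<partial>lborel) \<partial>lborel)"
    by (simp add: nn_integral_lborel_translate nn_integral_multc)
  also have "\<dots> = (\<integral>\<^sup>+x. (\<integral>\<^sup>+y. w x * indicator B (q x) * f (q x + y) \<partial>lborel) \<partial>lborel)"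
    by (simp add: nn_integral_cmult)
  also have "\<dots> = (\<integral>\<^sup>+y. (\<integral>\<^sup>+x. w x * (indicator B (q x) * f (q x + y)) \<partial>lborel) \<partial>lborel)"
    by (subst lborel_pair.Fubini') (simp_all add: mult.assoc)
  also have "\<dots> = (\<integral>\<^sup>+y. (\<integral>\<^sup>+x. w x * (indicator B (q x - y) * f (q x)) \<partial>lborel) \<partial>lborel)"
  proof (rule nn_integral_cong)
    fix y
    show "(\<integral>\<^sup>+x. w x * (indicator B (q x) * f (q x + y)) \<partial>lborel) = (\<integral>\<^sup>+x. w x * (indicator B (q x - y) * f (q x)) \<partial>lborel)"
      using inv[of "\<lambda>s. indicator B s * f (s + y)" "- y"] by simp
  qed
  also have "\<dots> = (\<integral>\<^sup>+x. (\<integral>\<^sup>+y. (w x * f (q x)) * indicator B (q x - y) \<partial>lborel) \<partial>lborel)"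
    by (subst lborel_pair.Fubini') (simp_all add: mult_ac)
  also have "\<dots> = (\<integral>\<^sup>+x. (w x * f (q x)) * emeasure lborel B \<partial>lborel)"
    by (intro nn_integral_cong)
       (simp add: nn_integral_cmult nn_integral_lborel_reflect[of "indicator B"])
  also have "\<dots> = emeasure lborel B * (\<integral>\<^sup>+x. w x * f (q x) \<partial>lborel)"
    by (subst nn_integral_multc) (measurable, rule mult.commute)
  finally show ?thesis .
qed

section \<open>Lebesgue measure is invariant under orthogonal matrices\<close>

lemma orthogonal_matrix_norm:
  fixes C :: "real^'n^'n"
  assumes "orthogonal_matrix C"
  shows "norm (C *v x) = norm x"
  using assms orthogonal_transformation_norm[of "(*v) C" x] by (simp add: orthogonal_transformation_matrix)

lemma orthogonal_matrix_vector_cancel: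
  fixes C :: "real^'n^'n"
  assumes "orthogonal_matrix C"
  shows "transpose C *v (C *v x) = x" "C *v (transpose C *v x) = x"
  using assms by (simp_all add: orthogonal_matrix_def matrix_vector_mul_assoc del: transpose_matrix_vector)

lemma borel_measurable_matrix_vector [measurable]:
  fixes C :: "real^'n^'m"
  shows "(*v) C \<in> borel_measurable borel"
  by (intro borel_measurable_continuous_onI linear_continuous_on matrix_vector_mul_bounded_linear)

text \<open>The image measure is translation invariant, hence a multiple of Lebesgue measure; the
  unit ball is preserved, which fixes the factor as 1.\<close>

lemma nn_integral_orthogonal:
  fixes C :: "real^'n^'n" and f :: "real^'n \<Rightarrow> ennreal"
  assumes C: "orthogonal_matrix C" and [measurable]: "f \<in> borel_measurable borel"
  shows "(\<integral>\<^sup>+x. f (C *v x) \<partial>lborel) = (\<integral>\<^sup>+x. f x \<partial>lborel)"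
proof -
  let ?B = "ball (0::real^'n) 1"
  have "(\<integral>\<^sup>+x. 1 * indicator ?B (C *v x) \<partial>lborel) * (\<integral>\<^sup>+y. f y \<partial>lborel)
    = emeasure lborel ?B * (\<integral>\<^sup>+x. 1 * f (C *v x) \<partial>lborel)"
  proof (rule invariant_integral_unique)
    fix h :: "real^'n \<Rightarrow> ennreal" and c
    assume [measurable]: "h \<in> borel_measurable borel"
    have "c + C *v x = C *v (transpose C *v c + x)" for x
      by (simp only: matrix_vector_right_distrib orthogonal_matrix_vector_cancel(2)[OF C])
    then show "(\<integral>\<^sup>+x. 1 * h (c + C *v x) \<partial>lborel) = (\<integral>\<^sup>+x. 1 * h (C *v x) \<partial>lborel)"
      using nn_integral_lborel_translate[of "\<lambda>x. h (C *v x)" "transpose C *v c"] by simp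
  qed simp_all
  moreover have "(\<integral>\<^sup>+x. 1 * indicator ?B (C *v x) \<partial>lborel) = emeasure lborel ?B"
  proof -
    have "(\<integral>\<^sup>+x. 1 * indicator ?B (C *v x) \<partial>lborel) = (\<integral>\<^sup>+x. indicator ?B x \<partial>lborel)"
      by (intro nn_integral_cong) (simp add: indicator_def orthogonal_matrix_norm C)
    then show ?thesis by simp
  qed
  moreover have "emeasure lborel ?B < \<infinity>" by (rule emeasure_lborel_ball_finite)
  moreover have "emeasure lborel ?B \<noteq> 0"
    using content_ball_pos[of 1 "0::real^'n"] by (auto simp: measure_def)
  ultimately show ?thesis by (simp add: ennreal_mult_cancel_left less_top[symmetric])
qed

section \<open>Logarithmic coordinates in the octants\<close>

definition vexp :: "real^'n \<Rightarrow> real^'n" where "vexp t = (\<chi> i. exp (t $ i))"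

definition trace_vec :: "real^'n \<Rightarrow> real" where "trace_vec t = (\<Sum>i\<in>UNIV. t $ i)"

definition dilate :: "real^'n \<Rightarrow> real^'n \<Rightarrow> real^'n" where "dilate t y = (\<chi> i. exp (t $ i) * y $ i)"

definition vlog :: "real^'n \<Rightarrow> real^'n" where "vlog y = (\<chi> i. ln \<bar>y $ i\<bar>)"

definition octant :: "'n set \<Rightarrow> (real^'n) set" where
  "octant \<epsilon> = {y. \<forall>i. if i \<in> \<epsilon> then y $ i < 0 else 0 < y $ i}"

definition oexp :: "'n set \<Rightarrow> real^'n \<Rightarrow> real^'n" where
  "oexp \<epsilon> s = (\<chi> i. (if i \<in> \<epsilon> then - 1 else 1) * exp (s $ i))"

lemma borel_measurable_vec_lambda:
  fixes f :: "'n::finite \<Rightarrow> 'a \<Rightarrow> real"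
  assumes "\<And>i. f i \<in> borel_measurable M"
  shows "(\<lambda>x. \<chi> i. f i x) \<in> borel_measurable M"
  unfolding borel_measurable_euclidean_space[of "\<lambda>x. \<chi> i. f i x"]
  using assms by (auto simp: Basis_vec_def inner_axis)

lemma borel_measurable_vec_nth' [measurable (raw)]:
  fixes f :: "'a \<Rightarrow> real^'n"
  shows "f \<in> borel_measurable M \<Longrightarrow> (\<lambda>x. f x $ i) \<in> borel_measurable M"
  by (rule measurable_compose[OF _ borel_measurable_continuous_onI]) (auto intro: continuous_intros)

lemma measurable_log_coordinates [measurable]:
  "vlog \<in> borel_measurable borel" "oexp \<epsilon> \<in> borel_measurable borel" "trace_vec \<in> borel_measurable borel"
  "octant \<epsilon> \<in> sets borel"
  "(\<lambda>(t, y). dilate t y) \<in> borel_measurable (borel \<Otimes>\<^sub>M borel)"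
proof -
  show "vlog \<in> borel_measurable borel" "oexp \<epsilon> \<in> borel_measurable borel"
    "(\<lambda>(t, y). dilate t y) \<in> borel_measurable (borel \<Otimes>\<^sub>M borel)"
    unfolding vlog_def[abs_def] oexp_def[abs_def] dilate_def split_beta
    by (auto intro!: borel_measurable_vec_lambda)
  show "trace_vec \<in> borel_measurable borel" unfolding trace_vec_def[abs_def] by measurable
  have "octant \<epsilon> = (\<Inter>i. {y. if i \<in> \<epsilon> then y $ i < 0 else 0 < y $ i})" by (auto simp: octant_def)
  also have "\<dots> \<in> sets borel" by (intro sets.countable_INT'') (auto split: if_splits)
  finally show "octant \<epsilon> \<in> sets borel" .
qed

lemma measurable_dilate [measurable (raw)]:
  assumes "f \<in> borel_measurable M" "g \<in> borel_measurable M"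
  shows "(\<lambda>x. dilate (f x) (g x)) \<in> borel_measurable M"
  using measurable_compose[OF measurable_Pair[OF assms] measurable_log_coordinates(5)] by simp

lemma oexp_in_octant_iff: "oexp \<epsilon> s \<in> octant \<epsilon>' \<longleftrightarrow> \<epsilon> = \<epsilon>'"
proof -
  have "(\<forall>i. if i \<in> \<epsilon>' then oexp \<epsilon> s $ i < 0 else 0 < oexp \<epsilon> s $ i) \<longleftrightarrow> (\<forall>i. i \<in> \<epsilon> \<longleftrightarrow> i \<in> \<epsilon>')"
    by (intro iff_allI) (simp add: oexp_def)
  then show ?thesis by (auto simp: octant_def)
qed

lemma vlog_oexp: "vlog (oexp \<epsilon> s) = s"
  by (simp add: vlog_def oexp_def vec_eq_iff abs_mult)

lemma oexp_vlog: "y \<in> octant \<epsilon> \<Longrightarrow> oexp \<epsilon> (vlog y) = y"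
proof -
  assume y: "y \<in> octant \<epsilon>"
  have "oexp \<epsilon> (vlog y) $ i = y $ i" for i
    using y[unfolded octant_def mem_Collect_eq, rule_format, of i]
    by (auto simp: oexp_def vlog_def split: if_splits)
  then show ?thesis by (simp add: vec_eq_iff)
qed

lemma dilate_octant: "dilate t y \<in> octant \<epsilon> \<longleftrightarrow> y \<in> octant \<epsilon>"
  by (simp add: octant_def dilate_def mult_less_0_iff zero_less_mult_iff)

lemma vlog_dilate: "y \<in> octant \<epsilon> \<Longrightarrow> vlog (dilate t y) = t + vlog y"
proof -
  assume y: "y \<in> octant \<epsilon>"
  have "vlog (dilate t y) $ i = (t + vlog y) $ i" for i
    using y[unfolded octant_def mem_Collect_eq, rule_format, of i]
    by (auto simp: vlog_def dilate_def abs_mult ln_mult split: if_splits)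
  then show ?thesis by (simp add: vec_eq_iff)
qed

lemma oexp_add: "oexp \<epsilon> (s + t) = dilate t (oexp \<epsilon> s)"
  by (simp add: oexp_def dilate_def vec_eq_iff exp_add mult_ac)

lemma trace_vec_add: "trace_vec (s + t) = trace_vec s + trace_vec t"
  by (simp add: trace_vec_def sum.distrib)

lemma nn_integral_dilate:
  fixes f :: "real^'n \<Rightarrow> ennreal"
  assumes [measurable]: "f \<in> borel_measurable borel"
  shows "(\<integral>\<^sup>+y. f y \<partial>lborel) = ennreal (exp (trace_vec t)) * (\<integral>\<^sup>+y. f (dilate t y) \<partial>lborel)"
proof -
  have T: "0 + (\<Sum>j\<in>Basis. (exp (t \<bullet> j) * (x \<bullet> j)) *\<^sub>R j) = dilate t x" for x
  proof -
    have "(\<Sum>j\<in>Basis. (exp (t \<bullet> j) * (x \<bullet> j)) *\<^sub>R j) = (\<Sum>j\<in>Basis. (dilate t x \<bullet> j) *\<^sub>R j)"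
      by (intro sum.cong refl) (auto simp: Basis_vec_def inner_axis dilate_def)
    then show ?thesis by (simp add: euclidean_representation)
  qed
  have "(\<Prod>j\<in>Basis. \<bar>exp (t \<bullet> j)\<bar>) = exp (trace_vec t)"
  proof -
    have "(\<Sum>j\<in>(Basis :: (real^'n) set). t \<bullet> j) = trace_vec t"
    proof -
      have B: "(Basis :: (real^'n) set) = (\<lambda>i. axis i 1) ` UNIV" by (auto simp: Basis_vec_def)
      show ?thesis
        unfolding B trace_vec_def
        by (subst sum.reindex) (auto simp: inj_on_def axis_eq_axis inner_axis)
    qed
    then show ?thesis by (simp add: exp_sum[symmetric])
  qed
  then have "lborel = density (distr lborel borel (dilate t)) (\<lambda>_. ennreal (exp (trace_vec t)))"
    using lborel_affine_euclidean[of "\<lambda>j. exp (t \<bullet> j)" 0] unfolding T by simp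
  then have "(\<integral>\<^sup>+y. f y \<partial>lborel) = (\<integral>\<^sup>+y. f y \<partial>density (distr lborel borel (dilate t)) (\<lambda>_. ennreal (exp (trace_vec t))))"
    by simp
  also have "\<dots> = (\<integral>\<^sup>+y. ennreal (exp (trace_vec t)) * f y \<partial>distr lborel borel (dilate t))"
    by (subst nn_integral_density) auto
  also have "\<dots> = (\<integral>\<^sup>+y. ennreal (exp (trace_vec t)) * f (dilate t y) \<partial>lborel)"
    by (subst nn_integral_distr) auto
  finally show ?thesis by (simp add: nn_integral_cmult)
qed

lemma open_octant: "open (octant \<epsilon> :: (real^'n) set)"
proof -
  have "octant \<epsilon> = (\<Inter>i. {y. if i \<in> \<epsilon> then y $ i < 0 else 0 < y $ i})" by (auto simp: octant_def)
  also have "open \<dots>"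
  proof (intro open_INT ballI)
    fix i
    show "open {y :: real^'n. if i \<in> \<epsilon> then y $ i < 0 else 0 < y $ i}"
      by (cases "i \<in> \<epsilon>")
         (simp_all add: open_halfspace_component_lt_cart open_halfspace_component_gt_cart)
  qed simp
  finally show ?thesis .
qed

text \<open>Dilations act on the octant as translations act on logarithms, so the dilation-invariant
  measure of the octant corresponds to a translation-invariant one. Uniqueness then gives the change
  of variables up to a constant.\<close>

lemma octant_integral_constant:
  fixes \<epsilon> :: "'n::finite set"
  obtains \<kappa> :: real where "0 < \<kappa>"
    "\<And>g :: real^'n \<Rightarrow> ennreal. g \<in> borel_measurable borel \<Longrightarrow>
      (\<integral>\<^sup>+y. indicator (octant \<epsilon>) y * g y \<partial>lborel)
       = ennreal \<kappa> * (\<integral>\<^sup>+s. ennreal (exp (trace_vec s)) * g (oexp \<epsilon> s) \<partial>lborel)"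
proof -
  \<comment> \<open>On the octant this is the reciprocal of the absolute product of the coordinates,
    the density of the dilation-invariant measure.\<close>
  define w :: "real^'n \<Rightarrow> ennreal" where "w y = indicator (octant \<epsilon>) y * ennreal (exp (- trace_vec (vlog y)))" for y
  have w [measurable]: "w \<in> borel_measurable borel" unfolding w_def by measurable
  \<comment> \<open>The unit cube has measure 1, so \<open>I\<close> is itself the constant of
    proportionality.\<close>
  let ?B = "cbox 0 One :: (real^'n) set"
  define I where "I = (\<integral>\<^sup>+y. w y * indicator ?B (vlog y) \<partial>lborel)"
  have main: "I * (\<integral>\<^sup>+s. h s \<partial>lborel) = (\<integral>\<^sup>+y. w y * h (vlog y) \<partial>lborel)"
    if [measurable]: "h \<in> borel_measurable borel" for h
  proof -
    have "I * (\<integral>\<^sup>+s. h s \<partial>lborel) = emeasure lborel ?B * (\<integral>\<^sup>+y. w y * h (vlog y) \<partial>lborel)"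
      unfolding I_def
    proof (rule invariant_integral_unique)
      fix h :: "real^'n \<Rightarrow> ennreal" and c
      assume [measurable]: "h \<in> borel_measurable borel"
      have "(\<integral>\<^sup>+y. w y * h (vlog y) \<partial>lborel)
          = (\<integral>\<^sup>+y. ennreal (exp (trace_vec c)) * (w (dilate c y) * h (vlog (dilate c y))) \<partial>lborel)"
        by (subst nn_integral_dilate[where t = c]) (simp_all add: nn_integral_cmult)
      also have "\<dots> = (\<integral>\<^sup>+y. w y * h (c + vlog y) \<partial>lborel)"
      proof (rule nn_integral_cong)
        fix y
        show "ennreal (exp (trace_vec c)) * (w (dilate c y) * h (vlog (dilate c y))) = w y * h (c + vlog y)"
        proof (cases "y \<in> octant \<epsilon>")
          case True
          have "ennreal (exp (trace_vec c)) * ennreal (exp (- trace_vec (c + vlog y))) = ennreal (exp (- trace_vec (vlog y)))"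
            by (simp add: ennreal_mult[symmetric] exp_add[symmetric] trace_vec_add)
          then show ?thesis
            using True by (simp add: w_def dilate_octant vlog_dilate mult.assoc[symmetric])
        qed (simp add: w_def dilate_octant)
      qed
      finally show "(\<integral>\<^sup>+y. w y * h (c + vlog y) \<partial>lborel) = (\<integral>\<^sup>+y. w y * h (vlog y) \<partial>lborel)" by simp
    qed simp_all
    moreover have "emeasure lborel ?B = 1" by (simp add: emeasure_lborel_cbox_eq)
    ultimately show ?thesis by simp
  qed
  \<comment> \<open>Otherwise the octant would be a null set, although it is open and
    nonempty.\<close>
  have "I \<noteq> 0"
  proof
    assume "I = 0"
    then have "(\<integral>\<^sup>+y. w y * 1 \<partial>lborel) = 0" using main[of "\<lambda>s. 1"] by simp
    then have "AE y in lborel. w y = 0" by (subst (asm) nn_integral_0_iff_AE) auto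
    then have "AE y in lborel. y \<notin> octant \<epsilon>"
      by eventually_elim (auto simp: w_def)
    then have "octant \<epsilon> \<in> null_sets lborel"
      by (subst (asm) AE_iff_null_sets[symmetric]) auto
    then have "negligible (octant \<epsilon> :: (real^'n) set)"
      by (simp add: negligible_iff_null_sets null_sets_completionI)
    then show False
      using open_not_negligible[OF open_octant] oexp_in_octant_iff[of \<epsilon> 0 \<epsilon>] by blast
  qed
  \<comment> \<open>Where \<open>vlog y\<close> lies in the unit cube the density is at most 1 and
    every coordinate is at most \<open>exp 1\<close> in modulus, so the integral is over a bounded
    set.\<close>
  moreover have "I < \<infinity>"
  proof -
    have "I \<le> (\<integral>\<^sup>+y. indicator (cball (0::real^'n) (real CARD('n) * exp 1)) y \<partial>lborel)"
      unfolding I_def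
    proof (rule nn_integral_mono)
      fix y :: "real^'n"
      show "w y * indicator ?B (vlog y) \<le> indicator (cball 0 (real CARD('n) * exp 1)) y"
      proof (cases "y \<in> octant \<epsilon> \<and> vlog y \<in> ?B")
        case True
        have b: "0 \<le> vlog y $ i \<and> vlog y $ i \<le> 1" for i
        proof -
          have ax: "axis i 1 \<in> (Basis :: (real^'n) set)" by (simp add: axis_in_Basis_iff)
          have "\<forall>j\<in>Basis. 0 \<bullet> j \<le> vlog y \<bullet> j \<and> vlog y \<bullet> j \<le> One \<bullet> j"
            using True mem_box(2) by blast
          from bspec[OF this ax] have "0 \<le> vlog y \<bullet> axis i 1" "vlog y \<bullet> axis i 1 \<le> 1"
            using inner_sum_left_Basis[OF ax] by simp_all
          then show ?thesis by (simp add: inner_axis)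
        qed
        then have "0 \<le> trace_vec (vlog y)" by (auto simp: trace_vec_def intro: sum_nonneg)
        then have "w y \<le> 1" by (auto simp: w_def indicator_def)
        moreover have "\<bar>y $ i\<bar> \<le> exp 1" for i
        proof -
          have "y $ i \<noteq> 0" using True by (auto simp: octant_def dest!: spec[of _ i] split: if_splits)
          then have "\<bar>y $ i\<bar> = exp (vlog y $ i)" by (simp add: vlog_def)
          then show ?thesis using b[of i] by simp
        qed
        then have "norm y \<le> (\<Sum>i\<in>(UNIV :: 'n set). exp 1)"
          by (intro order.trans[OF norm_le_l1_cart sum_mono])
        ultimately show ?thesis using True by (simp add: indicator_def)
      qed (auto simp: w_def indicator_def)
    qed
    also have "\<dots> = emeasure lborel (cball (0::real^'n) (real CARD('n) * exp 1))" by simp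
    also have "\<dots> < \<infinity>" by (rule emeasure_lborel_cball_finite)
    finally show ?thesis .
  qed
  ultimately obtain \<kappa> where \<kappa>: "I = ennreal \<kappa>" "0 < \<kappa>"
    by (cases I) (auto simp: ennreal_eq_0_iff not_le)
  show ?thesis
  proof (rule that[OF \<kappa>(2)])
    fix g :: "real^'n \<Rightarrow> ennreal"
    assume [measurable]: "g \<in> borel_measurable borel"
    have "indicator (octant \<epsilon>) y * g y = w y * (ennreal (exp (trace_vec (vlog y))) * g (oexp \<epsilon> (vlog y)))" for y
    proof (cases "y \<in> octant \<epsilon>")
      case True
      have "ennreal (exp (- trace_vec (vlog y))) * ennreal (exp (trace_vec (vlog y))) = 1"
        by (simp add: ennreal_mult[symmetric] exp_add[symmetric])
      then show ?thesis using True by (simp add: w_def oexp_vlog mult.assoc[symmetric])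
    qed (simp add: w_def)
    then show "(\<integral>\<^sup>+y. indicator (octant \<epsilon>) y * g y \<partial>lborel)
       = ennreal \<kappa> * (\<integral>\<^sup>+s. ennreal (exp (trace_vec s)) * g (oexp \<epsilon> s) \<partial>lborel)"
      using main[of "\<lambda>s. ennreal (exp (trace_vec s)) * g (oexp \<epsilon> s)"] by (simp add: \<kappa>)
  qed
qed

lemma octants_disjoint_cover:
  fixes y :: "real^'n"
  assumes "\<And>i. y $ i \<noteq> 0"
  shows "y \<in> octant \<epsilon> \<longleftrightarrow> \<epsilon> = {i. y $ i < 0}"
proof -
  have "(if i \<in> \<epsilon> then y $ i < 0 else 0 < y $ i) \<longleftrightarrow> (i \<in> \<epsilon> \<longleftrightarrow> y $ i < 0)" for i
    using assms[of i] by auto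
  then show ?thesis by (auto simp: octant_def)
qed

lemma AE_coordinates_nonzero: "AE y in lborel. \<forall>i. (y :: real^'n) $ i \<noteq> 0"
proof -
  have "AE y in lborel. (y :: real^'n) $ i \<noteq> 0" for i :: 'n
  proof -
    have "negligible {y :: real^'n. y $ i = 0}"
      using negligible_standard_hyperplane[of "axis i 1 :: real^'n" 0]
      by (simp add: axis_in_Basis_iff inner_axis)
    then have "AE y in lebesgue. y \<notin> {y :: real^'n. y $ i = 0}"
      by (intro AE_not_in) (simp add: negligible_iff_null_sets)
    then show ?thesis by (simp add: AE_lebesgue_iff_lborel)
  qed
  then show ?thesis by (simp add: AE_all_countable)
qed

section \<open>Transfer of the convolution algebra to the octants\<close>

definition octant_const :: "'n::finite set \<Rightarrow> real" where
  "octant_const \<epsilon> = (SOME \<kappa>. 0 < \<kappa> \<and>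
    (\<forall>g :: real^'n \<Rightarrow> ennreal. g \<in> borel_measurable borel \<longrightarrow>
      (\<integral>\<^sup>+y. indicator (octant \<epsilon>) y * g y \<partial>lborel)
       = ennreal \<kappa> * (\<integral>\<^sup>+s. ennreal (exp (trace_vec s)) * g (oexp \<epsilon> s) \<partial>lborel)))"

lemma octant_const:
  shows octant_const_pos: "0 < octant_const \<epsilon>"
    and nn_integral_octant: "(g :: real^'n \<Rightarrow> ennreal) \<in> borel_measurable borel \<Longrightarrow>
      (\<integral>\<^sup>+y. indicator (octant \<epsilon>) y * g y \<partial>lborel)
       = ennreal (octant_const \<epsilon>) * (\<integral>\<^sup>+s. ennreal (exp (trace_vec s)) * g (oexp \<epsilon> s) \<partial>lborel)"
proof -
  have "\<exists>\<kappa>. 0 < \<kappa> \<and> (\<forall>g :: real^'n \<Rightarrow> ennreal. g \<in> borel_measurable borel \<longrightarrow>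
      (\<integral>\<^sup>+y. indicator (octant \<epsilon>) y * g y \<partial>lborel)
       = ennreal \<kappa> * (\<integral>\<^sup>+s. ennreal (exp (trace_vec s)) * g (oexp \<epsilon> s) \<partial>lborel))"
    by (rule octant_integral_constant[of \<epsilon>]) blast
  from someI_ex[OF this, folded octant_const_def]
  show "0 < octant_const \<epsilon>" "(g :: real^'n \<Rightarrow> ennreal) \<in> borel_measurable borel \<Longrightarrow>
      (\<integral>\<^sup>+y. indicator (octant \<epsilon>) y * g y \<partial>lborel)
       = ennreal (octant_const \<epsilon>) * (\<integral>\<^sup>+s. ennreal (exp (trace_vec s)) * g (oexp \<epsilon> s) \<partial>lborel)"
    by blast+
qed

lemma ennreal_norm_of_real_mult:
  "0 \<le> r \<Longrightarrow> ennreal (norm (of_real r * z :: complex))^2 = ennreal (r^2) * ennreal (norm z)^2"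
  by (simp add: norm_mult ennreal_mult power_mult_distrib ennreal_power)

lemma abs_L2_sum:
  assumes "finite I" "\<And>i. i \<in> I \<Longrightarrow> square_integrable (f i)"
  shows "(\<Sum>i\<in>I. abs_L2 (f i)) = abs_L2 (\<lambda>x. \<Sum>i\<in>I. f i x) \<and> square_integrable (\<lambda>x. \<Sum>i\<in>I. f i x)"
  using assms
proof (induct I rule: finite_induct)
  case empty
  then show ?case by (simp add: zero_L2.abs_eq)
qed (simp add: abs_L2_add square_integrable_add)

locale rotation =
  fixes C :: "real^'n^'n"
  assumes orth: "orthogonal_matrix C"
begin

definition coords :: "real^'n \<Rightarrow> real^'n" where "coords x = transpose C *v x"

lemma coords_rotate [simp]: "coords (C *v y) = y"
  unfolding coords_def by (rule orthogonal_matrix_vector_cancel[OF orth])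

lemma rotate_coords [simp]: "C *v coords x = x"
  unfolding coords_def by (rule orthogonal_matrix_vector_cancel[OF orth])

lemma measurable_coords [measurable]: "coords \<in> borel_measurable borel"
  unfolding coords_def[abs_def] by (rule borel_measurable_matrix_vector)

lemma nn_integral_rotate:
  "f \<in> borel_measurable borel \<Longrightarrow> (\<integral>\<^sup>+x. f (C *v x) \<partial>lborel) = (\<integral>\<^sup>+x. f x \<partial>lborel)"
  by (rule nn_integral_orthogonal[OF orth])

lemma nn_integral_coords:
  "f \<in> borel_measurable borel \<Longrightarrow> (\<integral>\<^sup>+x. f (coords x) \<partial>lborel) = (\<integral>\<^sup>+x. f x \<partial>lborel)"
  unfolding coords_def using orth by (intro nn_integral_orthogonal) (simp add: orthogonal_matrix_transpose)

text \<open>The factor is the square root of the density in \<open>nn_integral_octant\<close>, so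
  this is isometric on functions living in the octant and kills the rest; \<open>from_log\<close> is
  its adjoint, an isometry into L2 with values extended by 0.\<close>

definition to_log :: "'n set \<Rightarrow> (real^'n \<Rightarrow> complex) \<Rightarrow> real^'n \<Rightarrow> complex" where
  "to_log \<epsilon> f s = of_real (sqrt (octant_const \<epsilon>) * exp (trace_vec s / 2)) * f (C *v oexp \<epsilon> s)"

definition from_log :: "'n set \<Rightarrow> (real^'n \<Rightarrow> complex) \<Rightarrow> real^'n \<Rightarrow> complex" where
  "from_log \<epsilon> g x = (if coords x \<in> octant \<epsilon>
     then of_real (1 / sqrt (octant_const \<epsilon>) * exp (- trace_vec (vlog (coords x)) / 2)) * g (vlog (coords x)) else 0)"

lemma measurable_to_log [measurable]:
  assumes [measurable]: "f \<in> borel_measurable borel"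
  shows "to_log \<epsilon> f \<in> borel_measurable borel"
  unfolding to_log_def[abs_def] by measurable

lemma measurable_from_log [measurable]:
  assumes [measurable]: "f \<in> borel_measurable borel"
  shows "from_log \<epsilon> f \<in> borel_measurable borel"
  unfolding from_log_def[abs_def] by measurable

lemma to_log_norm:
  assumes [measurable]: "f \<in> borel_measurable borel"
  shows "(\<integral>\<^sup>+s. ennreal (norm (to_log \<epsilon> f s))^2 \<partial>lborel) = (\<integral>\<^sup>+y. indicator (octant \<epsilon>) y * ennreal (norm (f (C *v y)))^2 \<partial>lborel)"
proof -
  have "ennreal (norm (to_log \<epsilon> f s))^2 = ennreal (octant_const \<epsilon>) * (ennreal (exp (trace_vec s)) * ennreal (norm (f (C *v oexp \<epsilon> s)))^2)" for s :: "real^'n"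
  proof -
    have "(sqrt (octant_const \<epsilon>) * exp (trace_vec s / 2))^2 = octant_const \<epsilon> * exp (trace_vec s)"
      using octant_const_pos[of \<epsilon>] by (simp add: power_mult_distrib exp_double[symmetric])
    then show ?thesis
      unfolding to_log_def using octant_const_pos[of \<epsilon>]
      by (subst ennreal_norm_of_real_mult) (auto simp: ennreal_mult mult.assoc)
  qed
  then show ?thesis
    by (simp add: nn_integral_octant[of "\<lambda>y. ennreal (norm (f (C *v y)))^2"] nn_integral_cmult)
qed

lemma from_log_norm:
  fixes g :: "real^'n \<Rightarrow> complex"
  assumes [measurable]: "g \<in> borel_measurable borel"
  shows "(\<integral>\<^sup>+x. ennreal (norm (from_log \<epsilon> g x))^2 \<partial>lborel) = (\<integral>\<^sup>+s. ennreal (norm (g s))^2 \<partial>lborel)"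
proof -
  define h where "h y = ennreal (1 / octant_const \<epsilon> * exp (- trace_vec (vlog y))) * ennreal (norm (g (vlog y)))^2" for y :: "real^'n"
  have [measurable]: "h \<in> borel_measurable borel" unfolding h_def by measurable
  have "ennreal (norm (from_log \<epsilon> g x))^2 = indicator (octant \<epsilon>) (coords x) * h (coords x)" for x
  proof (cases "coords x \<in> octant \<epsilon>")
    case True
    have "(1 / sqrt (octant_const \<epsilon>) * exp (- trace_vec (vlog (coords x)) / 2))^2 = 1 / octant_const \<epsilon> * exp (- trace_vec (vlog (coords x)))"
      using octant_const_pos[of \<epsilon>] by (simp add: power_mult_distrib power_divide exp_double[symmetric])
    moreover have "0 \<le> 1 / sqrt (octant_const \<epsilon>) * exp (- trace_vec (vlog (coords x)) / 2)"
      using octant_const_pos[of \<epsilon>] by simp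
    ultimately show ?thesis
      using True by (simp only: from_log_def if_True ennreal_norm_of_real_mult h_def) simp
  qed (simp add: from_log_def)
  then have "(\<integral>\<^sup>+x. ennreal (norm (from_log \<epsilon> g x))^2 \<partial>lborel) = (\<integral>\<^sup>+y. indicator (octant \<epsilon>) y * h y \<partial>lborel)"
    using nn_integral_coords[of "\<lambda>y. indicator (octant \<epsilon>) y * h y"] by simp
  also have "\<dots> = (\<integral>\<^sup>+s. ennreal (octant_const \<epsilon>) * (ennreal (exp (trace_vec s)) * h (oexp \<epsilon> s)) \<partial>lborel)"
    by (simp add: nn_integral_octant nn_integral_cmult)
  also have "\<dots> = (\<integral>\<^sup>+s. ennreal (norm (g s))^2 \<partial>lborel)"
  proof (rule nn_integral_cong)
    fix s :: "real^'n"
    have "ennreal (octant_const \<epsilon>) * (ennreal (exp (trace_vec s)) * ennreal (1 / octant_const \<epsilon> * exp (- trace_vec s))) = 1"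
      using octant_const_pos[of \<epsilon>] by (simp add: ennreal_mult[symmetric] exp_minus)
    then show "ennreal (octant_const \<epsilon>) * (ennreal (exp (trace_vec s)) * h (oexp \<epsilon> s)) = ennreal (norm (g s))^2"
      by (simp add: h_def vlog_oexp mult.assoc[symmetric])
  qed
  finally show ?thesis .
qed

lemma liftable_to_log: "L2_liftable (to_log \<epsilon>) 1"
proof
  fix f :: "real^'n \<Rightarrow> complex" assume f: "borel_sqi f"
  note [measurable] = borel_sqi_measurable[OF f]
  show "to_log \<epsilon> f \<in> borel_measurable borel" by measurable
  have "(\<integral>\<^sup>+s. ennreal (norm (to_log \<epsilon> f s))^2 \<partial>lborel) \<le> (\<integral>\<^sup>+y. ennreal (norm (f (C *v y)))^2 \<partial>lborel)"
    unfolding to_log_norm[OF borel_sqi_measurable[OF f]] by (intro nn_integral_mono) (simp add: indicator_def)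
  then show "(\<integral>\<^sup>+s. ennreal (norm (to_log \<epsilon> f s))^2 \<partial>lborel) \<le> ennreal (1\<^sup>2) * (\<integral>\<^sup>+y. ennreal (norm (f y))^2 \<partial>lborel)"
    using nn_integral_rotate[of "\<lambda>y. ennreal (norm (f y))^2"] by simp
qed (simp_all add: to_log_def distrib_left mult_ac)

lemma liftable_from_log: "L2_liftable (from_log \<epsilon>) 1"
proof
  fix f :: "real^'n \<Rightarrow> complex" assume f: "borel_sqi f"
  note [measurable] = borel_sqi_measurable[OF f]
  show "from_log \<epsilon> f \<in> borel_measurable borel" by measurable
  show "(\<integral>\<^sup>+s. ennreal (norm (from_log \<epsilon> f s))^2 \<partial>lborel) \<le> ennreal (1\<^sup>2) * (\<integral>\<^sup>+y. ennreal (norm (f y))^2 \<partial>lborel)"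
    by (simp add: from_log_norm)
qed (simp_all add: from_log_def distrib_left distrib_right add_divide_distrib mult_ac)

definition to_log_op :: "'n set \<Rightarrow> (real^'n) L2 \<Rightarrow>\<^sub>L (real^'n) L2" where
  "to_log_op \<epsilon> = L2_lift (to_log \<epsilon>)"

definition from_log_op :: "'n set \<Rightarrow> (real^'n) L2 \<Rightarrow>\<^sub>L (real^'n) L2" where
  "from_log_op \<epsilon> = L2_lift (from_log \<epsilon>)"

lemmas to_log_op_abs = L2_liftable.lift_abs[OF liftable_to_log, folded to_log_op_def]
lemmas from_log_op_abs = L2_liftable.lift_abs[OF liftable_from_log, folded from_log_op_def]
lemmas from_log_op_scaleC = L2_liftable.lift_scaleC[OF liftable_from_log, folded from_log_op_def]
lemmas borel_sqi_to_log = L2_liftable.sqi[OF liftable_to_log]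
lemmas borel_sqi_from_log = L2_liftable.sqi[OF liftable_from_log]

lemma norm_from_log_op: "norm (from_log_op \<epsilon> G) = norm G"
proof -
  obtain g where g: "borel_sqi g" "G = abs_L2 g" by (rule L2_borel_cases)
  have "ennreal (norm (abs_L2 (from_log \<epsilon> g)))^2 = ennreal (norm (abs_L2 g))^2"
    by (simp add: norm_abs_L2_nn g borel_sqi_from_log from_log_norm borel_sqi_measurable)
  then show ?thesis by (simp add: g from_log_op_abs ennreal_power)
qed

lemma to_log_from_log: "to_log \<epsilon> (from_log \<epsilon>' g) s = (if \<epsilon> = \<epsilon>' then g s else 0)"
proof (cases "\<epsilon> = \<epsilon>'")
  case True
  have "sqrt (octant_const \<epsilon>) * exp (trace_vec s / 2) * (1 / sqrt (octant_const \<epsilon>) * exp (- trace_vec s / 2)) = 1"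
    using octant_const_pos[of \<epsilon>] by (simp add: exp_minus)
  then have "of_real (sqrt (octant_const \<epsilon>) * exp (trace_vec s / 2)) * (of_real (1 / sqrt (octant_const \<epsilon>) * exp (- trace_vec s / 2)) * g s) = g s"
    by (simp only: mult.assoc[symmetric] of_real_mult[symmetric] of_real_1 mult_1_left)
  then show ?thesis
    unfolding to_log_def from_log_def using True by (simp only: coords_rotate vlog_oexp oexp_in_octant_iff if_True simp_thms)
qed (simp add: to_log_def from_log_def oexp_in_octant_iff)

lemma to_log_from_log_op: "to_log_op \<epsilon> o\<^sub>L from_log_op \<epsilon>' = (if \<epsilon> = \<epsilon>' then id_blinfun else 0)"
proof (rule blinfun_L2_eqI)
  fix g :: "real^'n \<Rightarrow> complex" assume g: "borel_sqi g"
  have "(to_log_op \<epsilon> o\<^sub>L from_log_op \<epsilon>') (abs_L2 g) = abs_L2 (to_log \<epsilon> (from_log \<epsilon>' g))"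
    by (simp add: from_log_op_abs to_log_op_abs borel_sqi_from_log g)
  also have "to_log \<epsilon> (from_log \<epsilon>' g) = (if \<epsilon> = \<epsilon>' then g else (\<lambda>x. 0))"
    by (auto simp: to_log_from_log fun_eq_iff)
  finally show "(to_log_op \<epsilon> o\<^sub>L from_log_op \<epsilon>') (abs_L2 g) = (if \<epsilon> = \<epsilon>' then id_blinfun else 0) (abs_L2 g)"
    by (simp add: zero_L2.abs_eq)
qed

lemma AE_rotated:
  assumes "Measurable.pred borel P" "AE y in lborel. P y"
  shows "AE x in lborel. P (coords x)"
proof -
  note [measurable] = assms(1)
  have "(\<integral>\<^sup>+x. indicator {y. \<not> P y} (coords x) \<partial>lborel) = (\<integral>\<^sup>+y. indicator {y. \<not> P y} y \<partial>lborel)"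
    by (rule nn_integral_coords) measurable
  also have "\<dots> = 0" using assms(2) by (subst nn_integral_0_iff_AE) (auto elim!: eventually_mono)
  finally have "AE x in lborel. (indicator {y. \<not> P y} (coords x) :: ennreal) = 0"
    by (subst (asm) nn_integral_0_iff_AE) auto
  then show ?thesis by eventually_elim (auto simp: indicator_def split: if_splits)
qed

lemma AE_coords_octant: "AE x in lborel. \<exists>\<delta>. \<forall>\<epsilon>. coords x \<in> octant \<epsilon> \<longleftrightarrow> \<epsilon> = \<delta>"
proof -
  have "AE x in lborel. \<forall>i. coords x $ i \<noteq> 0"
    by (rule AE_rotated[OF _ AE_coordinates_nonzero]) measurable
  then show ?thesis
  proof eventually_elim
    fix x assume "\<forall>i. coords x $ i \<noteq> 0"
    then have "\<forall>\<epsilon>. coords x \<in> octant \<epsilon> \<longleftrightarrow> \<epsilon> = {i. coords x $ i < 0}"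
      using octants_disjoint_cover[of "coords x"] by blast
    then show "\<exists>\<delta>. \<forall>\<epsilon>. coords x \<in> octant \<epsilon> \<longleftrightarrow> \<epsilon> = \<delta>" ..
  qed
qed

section \<open>Copying operators to all octants\<close>

text \<open>The dilations have positive factors and preserve each octant, so the same
  \<open>T\<close> is placed on every one: the result is a direct sum of copies of
  \<open>T\<close>.\<close>

definition transfer :: "((real^'n) L2 \<Rightarrow>\<^sub>L (real^'n) L2) \<Rightarrow> (real^'n) L2 \<Rightarrow>\<^sub>L (real^'n) L2" where
  "transfer T = (\<Sum>\<epsilon>\<in>UNIV. from_log_op \<epsilon> o\<^sub>L T o\<^sub>L to_log_op \<epsilon>)"

lemma transfer_apply: "transfer T F = (\<Sum>\<epsilon>\<in>UNIV. from_log_op \<epsilon> (T (to_log_op \<epsilon> F)))"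
proof -
  have "blinfun_apply (\<Sum>\<epsilon>\<in>S. h \<epsilon>) F = (\<Sum>\<epsilon>\<in>S. blinfun_apply (h \<epsilon>) F)" if "finite S"
    for S :: "'n set set" and h :: "'n set \<Rightarrow> (real^'n) L2 \<Rightarrow>\<^sub>L (real^'n) L2"
    using that by (induct S rule: finite_induct) (simp_all add: plus_blinfun.rep_eq)
  then show ?thesis by (simp add: transfer_def)
qed

lemma bounded_linear_transfer: "bounded_linear transfer"
  unfolding transfer_def[abs_def]
  by (intro bounded_linear_sum bounded_linear_compose[OF
      bounded_bilinear.bounded_linear_left[OF bounded_bilinear_blinfun_compose]
      bounded_bilinear.bounded_linear_right[OF bounded_bilinear_blinfun_compose]])

text \<open>The Hausdorff operator with the logarithmic eigenvalues as parameter;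
  \<open>exp (trace_vec t / 2)\<close> is the square root of the determinant of the dilation, and
  makes it unitary on L2.\<close>

definition dilation_mean :: "(real^'n \<Rightarrow> complex) \<Rightarrow> (real^'n \<Rightarrow> complex) \<Rightarrow> real^'n \<Rightarrow> complex" where
  "dilation_mean k f x = (LINT t|lborel. k t * (of_real (exp (trace_vec t / 2)) * f (C *v dilate t (coords x))))"

lemma to_log_add: "coords x \<in> octant \<epsilon> \<Longrightarrow>
  of_real (1 / sqrt (octant_const \<epsilon>) * exp (- trace_vec (vlog (coords x)) / 2)) * to_log \<epsilon> f (vlog (coords x) + t)
   = of_real (exp (trace_vec t / 2)) * f (C *v dilate t (coords x))"
proof -
  assume x: "coords x \<in> octant \<epsilon>"
  let ?s = "vlog (coords x)"
  have "1 / sqrt (octant_const \<epsilon>) * exp (- trace_vec ?s / 2) * (sqrt (octant_const \<epsilon>) * exp (trace_vec (?s + t) / 2)) = exp (trace_vec t / 2)"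
    using octant_const_pos[of \<epsilon>] by (simp add: trace_vec_add add_divide_distrib exp_add exp_minus)
  then show ?thesis
    unfolding to_log_def oexp_add oexp_vlog[OF x]
    by (simp only: mult.assoc[symmetric] of_real_mult[symmetric])
qed

lemma from_log_to_log:
  assumes "coords x \<in> octant \<epsilon>"
  shows "from_log \<epsilon> (to_log \<epsilon> f) x = f x"
  using to_log_add[OF assms, of f 0] assms by (simp add: from_log_def trace_vec_def dilate_def)

lemma from_log_conv_to_log:
  assumes "coords x \<in> octant \<epsilon>"
  shows "from_log \<epsilon> (conv k (to_log \<epsilon> f)) x = dilation_mean k f x"
proof -
  have "from_log \<epsilon> (conv k (to_log \<epsilon> f)) x = (LINT t|lborel.
      of_real (1 / sqrt (octant_const \<epsilon>) * exp (- trace_vec (vlog (coords x)) / 2)) * (k t * to_log \<epsilon> f (vlog (coords x) + t)))"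
    using assms by (simp add: from_log_def conv_def)
  also have "\<dots> = dilation_mean k f x"
    unfolding dilation_mean_def to_log_add[OF assms, symmetric] by (simp only: mult.left_commute)
  finally show ?thesis .
qed

text \<open>Almost every point lies in exactly one octant, so at such a point only one summand is
  nonzero.\<close>

lemma sum_from_log:
  assumes "\<And>\<epsilon>. borel_sqi (g \<epsilon>)" and "\<And>x \<epsilon>. coords x \<in> octant \<epsilon> \<Longrightarrow> from_log \<epsilon> (g \<epsilon>) x = h x"
    and [measurable]: "h \<in> borel_measurable borel"
  shows "(\<Sum>\<epsilon>\<in>UNIV. from_log_op \<epsilon> (abs_L2 (g \<epsilon>))) = abs_L2 h \<and> borel_sqi h"
proof -
  define S where "S x = (\<Sum>\<epsilon>\<in>UNIV. from_log \<epsilon> (g \<epsilon>) x)" for x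
  have sq: "square_integrable (from_log \<epsilon> (g \<epsilon>))" for \<epsilon>
    by (intro borel_sqi_square_integrable borel_sqi_from_log assms)
  have 1: "(\<Sum>\<epsilon>\<in>UNIV. from_log_op \<epsilon> (abs_L2 (g \<epsilon>))) = abs_L2 S" "square_integrable S"
    using abs_L2_sum[of UNIV "\<lambda>\<epsilon>. from_log \<epsilon> (g \<epsilon>)"] sq unfolding S_def
    by (simp_all add: from_log_op_abs assms)
  have "AE x in lborel. S x = h x"
    using AE_coords_octant
  proof eventually_elim
    fix x assume "\<exists>\<delta>. \<forall>\<epsilon>. coords x \<in> octant \<epsilon> \<longleftrightarrow> \<epsilon> = \<delta>"
    then obtain \<delta> where d: "\<And>\<epsilon>. coords x \<in> octant \<epsilon> \<longleftrightarrow> \<epsilon> = \<delta>" by blast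
    have "S x = (\<Sum>\<epsilon>\<in>UNIV. if \<epsilon> = \<delta> then from_log \<epsilon> (g \<epsilon>) x else 0)"
      unfolding S_def by (intro sum.cong refl) (simp add: from_log_def d)
    also have "\<dots> = h x" using assms(2)[of x \<delta>] d by simp
    finally show "S x = h x" .
  qed
  then have ae: "AE x in lebesgue. S x = h x" by (simp add: AE_lebesgue_iff_lborel)
  have "h \<in> borel_measurable lebesgue" by (intro measurable_completion) simp
  then have sh: "square_integrable h" by (rule square_integrable_cong_AE[OF 1(2) ae])
  then have "borel_sqi h" by (simp add: borel_sqi_iff)
  moreover have "abs_L2 S = abs_L2 h" using abs_L2_eq_iff[OF 1(2) sh] ae by simp
  ultimately show ?thesis using 1 by simp
qed

lemma transfer_id: "transfer id_blinfun = id_blinfun"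
proof (rule blinfun_L2_eqI)
  fix f :: "real^'n \<Rightarrow> complex" assume f: "borel_sqi f"
  show "transfer id_blinfun (abs_L2 f) = id_blinfun (abs_L2 f)"
    using sum_from_log[of "\<lambda>\<epsilon>. to_log \<epsilon> f" f] f
    by (simp add: transfer_apply to_log_op_abs borel_sqi_to_log from_log_to_log borel_sqi_measurable)
qed

text \<open>\<open>to_log_op \<epsilon>\<close> annihilates what
  \<open>from_log_op \<epsilon>'\<close> puts into a different octant, so only the diagonal terms of
  the double sum survive.\<close>

lemma transfer_compose: "transfer (S o\<^sub>L T) = transfer S o\<^sub>L transfer T"
proof (rule blinfun_eqI)
  fix F
  have *: "to_log_op \<epsilon> (from_log_op \<epsilon>' G) = (if \<epsilon> = \<epsilon>' then G else 0)" for \<epsilon> \<epsilon>' G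
    using arg_cong[OF to_log_from_log_op[of \<epsilon> \<epsilon>'], of "\<lambda>T. blinfun_apply T G"] by auto
  show "transfer (S o\<^sub>L T) F = (transfer S o\<^sub>L transfer T) F"
    by (simp add: transfer_apply blinfun.sum_right * if_distrib[of "blinfun_apply _"] cong: if_cong)
qed

text \<open>Embedding L2 into one octant exhibits \<open>T\<close> as a restriction of
  \<open>transfer T\<close>; bounds on the transferred operator are thereby brought back to
  \<open>T\<close>.\<close>

lemma transfer_from_log: "transfer T (from_log_op \<delta> G) = from_log_op \<delta> (T G)"
proof -
  have *: "to_log_op \<epsilon> (from_log_op \<delta> G) = (if \<epsilon> = \<delta> then G else 0)" for \<epsilon>
    using arg_cong[OF to_log_from_log_op[of \<epsilon> \<delta>], of "\<lambda>T. blinfun_apply T G"] by auto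
  show ?thesis
    by (simp add: transfer_apply * if_distrib[of "blinfun_apply _"] cong: if_cong)
qed

lemma transfer_scaleC: "transfer (scaleC_blinfun c) = scaleC_blinfun c"
proof (rule blinfun_eqI)
  fix F
  have "transfer (scaleC_blinfun c) F = (\<Sum>\<epsilon>\<in>UNIV. scaleC_blinfun c (from_log_op \<epsilon> (to_log_op \<epsilon> F)))"
    by (simp add: transfer_apply scaleC_blinfun.rep_eq from_log_op_scaleC)
  also have "\<dots> = scaleC_blinfun c (transfer id_blinfun F)"
    by (simp add: transfer_apply blinfun.sum_right)
  finally show "transfer (scaleC_blinfun c) F = scaleC_blinfun c F"
    by (simp add: transfer_id)
qed

lemma transfer_conv_op:
  assumes k: "borel_L1 k" and f: "borel_sqi f"
  shows "transfer (conv_op k) (abs_L2 f) = abs_L2 (dilation_mean k f)" "borel_sqi (dilation_mean k f)"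
proof -
  note [measurable] = borel_L1_measurable[OF k] borel_sqi_measurable[OF f]
  have m: "dilation_mean k f \<in> borel_measurable borel"
    unfolding dilation_mean_def[abs_def] by measurable
  have "(\<Sum>\<epsilon>\<in>UNIV. from_log_op \<epsilon> (abs_L2 (conv k (to_log \<epsilon> f)))) = abs_L2 (dilation_mean k f) \<and> borel_sqi (dilation_mean k f)"
    by (rule sum_from_log) (simp_all add: borel_sqi_conv k borel_sqi_to_log f from_log_conv_to_log m)
  then show "transfer (conv_op k) (abs_L2 f) = abs_L2 (dilation_mean k f)" "borel_sqi (dilation_mean k f)"
    by (simp_all add: transfer_apply to_log_op_abs f borel_sqi_to_log conv_op_abs k)
qed

text \<open>Positive densities relate the two measures, so null sets of logarithmic coordinates pull
  back to null sets of the octant.\<close>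

lemma AE_octant_vlog:
  assumes "Measurable.pred borel P" "AE s in lborel. P s"
  shows "AE x in lborel. coords x \<in> octant \<epsilon> \<longrightarrow> P (vlog (coords x))"
proof (rule AE_rotated[where P = "\<lambda>y. y \<in> octant \<epsilon> \<longrightarrow> P (vlog y)"])
  note [measurable] = assms(1)
  show "Measurable.pred borel (\<lambda>y. y \<in> octant \<epsilon> \<longrightarrow> P (vlog y))" by measurable
  have "(\<integral>\<^sup>+y. indicator (octant \<epsilon>) y * indicator {s. \<not> P s} (vlog y) \<partial>lborel)
      = ennreal (octant_const \<epsilon>) * (\<integral>\<^sup>+s. ennreal (exp (trace_vec s)) * indicator {s. \<not> P s} s \<partial>lborel)"
    by (subst nn_integral_octant) (simp_all add: vlog_oexp)
  also have "(\<integral>\<^sup>+s. ennreal (exp (trace_vec s)) * indicator {s. \<not> P s} s \<partial>lborel) = 0"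
    using assms(2) by (subst nn_integral_0_iff_AE) (auto elim!: eventually_mono)
  finally have "(\<integral>\<^sup>+y. indicator (octant \<epsilon>) y * indicator {s. \<not> P s} (vlog y) \<partial>lborel) = 0" by simp
  then have "AE y in lborel. (indicator (octant \<epsilon>) y * indicator {s. \<not> P s} (vlog y) :: ennreal) = 0"
    by (subst (asm) nn_integral_0_iff_AE) auto
  then show "AE y in lborel. y \<in> octant \<epsilon> \<longrightarrow> P (vlog y)"
    by eventually_elim (auto simp: indicator_def split: if_splits)
qed

lemma AE_dilation_integrable:
  assumes k: "borel_L1 k" and f: "borel_sqi f"
  shows "AE x in lborel. integrable lborel (\<lambda>t. k t * (of_real (exp (trace_vec t / 2)) * f (C *v dilate t (coords x))))"
proof -
  note [measurable] = borel_L1_measurable[OF k] borel_sqi_measurable[OF f]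
  have "AE x in lborel. coords x \<in> octant \<epsilon> \<longrightarrow> integrable lborel (\<lambda>t. k t * to_log \<epsilon> f (vlog (coords x) + t))" for \<epsilon>
    by (rule AE_octant_vlog[OF _ AE_conv_integrable[OF k borel_sqi_to_log[OF f]]]) measurable
  then have "AE x in lborel. \<forall>\<epsilon>. coords x \<in> octant \<epsilon> \<longrightarrow> integrable lborel (\<lambda>t. k t * to_log \<epsilon> f (vlog (coords x) + t))"
    by (simp add: AE_all_countable)
  with AE_coords_octant show ?thesis
  proof eventually_elim
    fix x
    assume "\<exists>\<delta>. \<forall>\<epsilon>. coords x \<in> octant \<epsilon> \<longleftrightarrow> \<epsilon> = \<delta>"
      and *: "\<forall>\<epsilon>. coords x \<in> octant \<epsilon> \<longrightarrow> integrable lborel (\<lambda>t. k t * to_log \<epsilon> f (vlog (coords x) + t))"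
    then obtain \<delta> where d: "coords x \<in> octant \<delta>" by blast
    let ?c = "of_real (1 / sqrt (octant_const \<delta>) * exp (- trace_vec (vlog (coords x)) / 2)) :: complex"
    have "integrable lborel (\<lambda>t. ?c * (k t * to_log \<delta> f (vlog (coords x) + t)))"
      using * d by (intro integrable_mult_right) blast
    then show "integrable lborel (\<lambda>t. k t * (of_real (exp (trace_vec t / 2)) * f (C *v dilate t (coords x))))"
      unfolding to_log_add[OF d, symmetric] by (simp only: mult.left_commute)
  qed
qed

end

section \<open>Transport of kernels\<close>

text \<open>An integrable kernel is pushed forward along a nonsingular map with an almost everywhere
  inverse by applying Radon-Nikodym to its modulus and carrying its phase along.\<close>

lemma transport_kernel:
  fixes p :: "'a::euclidean_space \<Rightarrow> 'b::euclidean_space" and K :: "'a \<Rightarrow> complex"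
  assumes K: "borel_L1 K" and p [measurable]: "p \<in> borel_measurable borel" and q [measurable]: "q \<in> borel_measurable borel"
    and inv: "AE u in lborel. q (p u) = u"
    and nonsing: "\<And>S. S \<in> null_sets lborel \<Longrightarrow> AE u in lborel. p u \<notin> S"
  obtains k where "borel_L1 k"
    "\<And>G :: 'b \<Rightarrow> complex. G \<in> borel_measurable borel \<Longrightarrow>
      integrable lborel (\<lambda>u. K u * G (p u)) \<longleftrightarrow> integrable lborel (\<lambda>t. k t * G t)"
    "\<And>G :: 'b \<Rightarrow> complex. G \<in> borel_measurable borel \<Longrightarrow>
      (LINT u|lborel. K u * G (p u)) = (LINT t|lborel. k t * G t)"
proof -
  note [measurable] = borel_L1_measurable[OF K]
  define \<mu> where "\<mu> = density lborel (\<lambda>u. ennreal (norm (K u)))"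
  define \<nu> where "\<nu> = distr \<mu> borel p"
  have [measurable_cong]: "sets \<mu> = sets borel" "sets \<nu> = sets borel" by (simp_all add: \<mu>_def \<nu>_def)
  have "absolutely_continuous lborel \<nu>"
    unfolding absolutely_continuous_def
  proof
    fix S :: "'b set" assume S: "S \<in> null_sets lborel"
    then have [measurable]: "S \<in> sets borel" by auto
    have "emeasure \<nu> S = emeasure \<mu> (p -` S \<inter> space \<mu>)"
      unfolding \<nu>_def by (rule emeasure_distr) auto
    also have "\<dots> = (\<integral>\<^sup>+u. ennreal (norm (K u)) * indicator (p -` S) u \<partial>lborel)"
      unfolding \<mu>_def by (subst emeasure_density) (auto intro: measurable_sets_borel[OF p])
    also have "\<dots> = (\<integral>\<^sup>+u. 0 \<partial>(lborel :: 'a measure))"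
      using nonsing[OF S] by (intro nn_integral_cong_AE) (auto elim!: eventually_mono simp: indicator_def)
    finally show "S \<in> null_sets \<nu>" by (simp add: null_sets_def)
  qed
  then obtain w where w [measurable]: "w \<in> borel_measurable borel" and dw: "density lborel w = \<nu>"
    using sigma_finite_measure.Radon_Nikodym[OF sigma_finite_lborel, of \<nu>] by (auto simp: \<nu>_def)
  have "(\<integral>\<^sup>+t. w t \<partial>lborel) = emeasure (density lborel w) UNIV"
    by (subst emeasure_density) auto
  also have "\<dots> = emeasure \<mu> UNIV"
    unfolding dw \<nu>_def by (subst emeasure_distr) (auto simp: \<mu>_def)
  also have "\<dots> = ennreal (L1_norm K)"
    unfolding \<mu>_def by (subst emeasure_density) (auto simp: nn_integral_L1_norm[OF K])
  finally have "AE t in lborel. w t \<noteq> \<infinity>" by (intro nn_integral_PInf_AE) auto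
  \<comment> \<open>The integral of \<open>w\<close> is the L1 norm of \<open>K\<close>, so
    \<open>w\<close> is finite almost everywhere and may be replaced by a real function.\<close>
  then have wr: "density lborel (\<lambda>t. ennreal (enn2real (w t))) = \<nu>"
    unfolding dw[symmetric] by (intro density_cong) (auto elim!: eventually_mono simp: less_top)
  define k where "k t = enn2real (w t) *\<^sub>R sgn (K (q t))" for t
  have [measurable]: "k \<in> borel_measurable borel"
    unfolding k_def sgn_div_norm by measurable
  have *: "(integrable lborel (\<lambda>u. K u * G (p u)) \<longleftrightarrow> integrable lborel (\<lambda>t. k t * G t)) \<and>
      (LINT u|lborel. K u * G (p u)) = (LINT t|lborel. k t * G t)"
    if [measurable]: "G \<in> borel_measurable borel" for G :: "'b \<Rightarrow> complex"
  proof -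
    define H where "H t = sgn (K (q t)) * G t" for t
    have [measurable]: "H \<in> borel_measurable borel" unfolding H_def sgn_div_norm by measurable
    have ae: "AE u in lborel. K u * G (p u) = norm (K u) *\<^sub>R H (p u)"
      using inv
    proof eventually_elim
      fix u assume "q (p u) = u"
      moreover have "norm (K u) *\<^sub>R sgn (K u) = K u" by (cases "K u = 0") (auto simp: sgn_div_norm)
      ultimately show "K u * G (p u) = norm (K u) *\<^sub>R H (p u)"
        by (metis H_def mult_scaleR_left)
    qed
    have kG: "k t * G t = enn2real (w t) *\<^sub>R H t" for t by (simp add: k_def H_def)
    have "integrable lborel (\<lambda>u. K u * G (p u)) \<longleftrightarrow> integrable lborel (\<lambda>u. norm (K u) *\<^sub>R H (p u))"
      using ae by (intro integrable_cong_AE) measurable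
    also have "\<dots> \<longleftrightarrow> integrable \<mu> (\<lambda>u. H (p u))"
      unfolding \<mu>_def by (subst integrable_density) auto
    also have "\<dots> \<longleftrightarrow> integrable \<nu> H"
      unfolding \<nu>_def by (subst integrable_distr_eq) auto
    also have "\<dots> \<longleftrightarrow> integrable lborel (\<lambda>t. k t * G t)"
      unfolding wr[symmetric] kG by (subst integrable_density) auto
    finally have 1: "integrable lborel (\<lambda>u. K u * G (p u)) \<longleftrightarrow> integrable lborel (\<lambda>t. k t * G t)" .
    have "(LINT u|lborel. K u * G (p u)) = (LINT u|lborel. norm (K u) *\<^sub>R H (p u))"
      using ae by (intro integral_cong_AE) measurable
    also have "\<dots> = (LINT u|\<mu>. H (p u))"
      unfolding \<mu>_def by (subst integral_density) auto
    also have "\<dots> = (LINT t|\<nu>. H t)"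
      unfolding \<nu>_def by (subst integral_distr) auto
    also have "\<dots> = (LINT t|lborel. k t * G t)"
      unfolding wr[symmetric] kG by (subst integral_density) auto
    finally show ?thesis using 1 by simp
  qed
  have "borel_L1 k" using *[of "\<lambda>t. 1"] K by (simp add: borel_L1_def)
  with * show ?thesis by (intro that) blast+
qed

lemma null_lebesgue_subset:
  "S \<in> null_sets lebesgue \<Longrightarrow> T \<subseteq> S \<Longrightarrow> T \<in> null_sets lebesgue"
  using negligible_subset negligible_iff_null_sets by blast

lemma AE_lebesgue_null: "AE x in lebesgue. P x \<Longrightarrow> {x. \<not> P x} \<in> null_sets lebesgue"
  by (simp add: completion.AE_iff_null_sets[symmetric] completion.AE_iff_null_sets AE_iff_null)

lemma borel_measurable_lebesgue_AE:
  fixes f g :: "'a::euclidean_space \<Rightarrow> 'b::euclidean_space"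
  assumes "f \<in> borel_measurable borel" "AE x in lebesgue. g x = f x"
  shows "g \<in> borel_measurable lebesgue"
proof (rule borel_measurable_AE)
  show "f \<in> borel_measurable lebesgue" using assms(1) by (intro measurable_completion) simp
  show "AE x in lebesgue. f x = g x" using assms(2) by eventually_elim simp
qed

section \<open>Hausdorff operators of a diagonalised family\<close>

locale hausdorff_family = rotation C for C :: "real^'n^'n" +
  fixes D :: "(real^'n) set" and A :: "real^'n \<Rightarrow> real^'n^'n" and a b :: "real^'n \<Rightarrow> real^'n"
  assumes family: "measurable_family D A"
    and diagonal: "\<And>u. u \<in> D \<Longrightarrow> matrix_inv C ** A u ** C = diag (a u)"
    and solution: "AE t in lebesgue. b t \<in> D \<and> (\<forall>k. a (b t) $ k = exp (t $ k))"
    and b_measurable: "b \<in> borel_measurable lebesgue"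
    and b_bijective: "almost_bijective b"
begin

lemma C_inverse: "transpose C ** C = mat 1" "C ** transpose C = mat 1" "matrix_inv C = transpose C"
proof -
  show 1: "transpose C ** C = mat 1" "C ** transpose C = mat 1"
    using orth by (auto simp: orthogonal_matrix_def)
  then have "\<exists>B. C ** B = mat 1 \<and> B ** C = mat 1" by blast
  then have "C ** matrix_inv C = mat 1 \<and> matrix_inv C ** C = mat 1"
    unfolding matrix_inv_def by (rule someI_ex)
  then have "matrix_inv C ** (C ** transpose C) = transpose C"
    by (simp only: matrix_mul_assoc matrix_mul_lid)
  then show "matrix_inv C = transpose C" using 1 by simp
qed

lemma A_diagonal: "u \<in> D \<Longrightarrow> A u = C ** diag (a u) ** transpose C"
proof -
  assume "u \<in> D"
  then have "diag (a u) = transpose C ** A u ** C" using diagonal C_inverse by simp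
  then have "C ** diag (a u) ** transpose C = (C ** transpose C) ** A u ** (C ** transpose C)"
    by (simp only: matrix_mul_assoc)
  then show ?thesis using C_inverse by simp
qed

lemma diag_vexp: "diag (vexp t) *v y = dilate t y"
  by (simp add: vec_eq_iff diag_def vexp_def dilate_def matrix_vector_mult_def if_distrib[of "\<lambda>z. z * _"] cong: if_cong)

lemma A_apply: "u \<in> D \<Longrightarrow> a u = vexp t \<Longrightarrow> A u *v x = C *v dilate t (coords x)"
  using A_diagonal[of u] by (simp add: diag_vexp[symmetric] coords_def matrix_vector_mul_assoc matrix_mul_assoc del: transpose_matrix_vector)

lemma A_det: "u \<in> D \<Longrightarrow> a u = vexp t \<Longrightarrow> det (A u) = exp (trace_vec t)"
proof -
  assume u: "u \<in> D" "a u = vexp t"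
  have "det C * det (transpose C) = 1"
    using C_inverse(2) det_mul[of C "transpose C"] by simp
  moreover have "det (diag (vexp t)) = (\<Prod>i\<in>UNIV. diag (vexp t) $ i $ i)"
    by (rule det_diagonal) (simp add: diag_def)
  moreover have "(\<Prod>i\<in>UNIV. diag (vexp t) $ i $ i) = exp (trace_vec t)"
    by (simp add: diag_def vexp_def trace_vec_def exp_sum)
  moreover have "det (A u) = det C * det (diag (vexp t)) * det (transpose C)"
    using A_diagonal[OF u(1)] u(2) by (simp only: det_mul)
  ultimately show ?thesis by (simp add: mult_ac)
qed

section \<open>Logarithmic eigenvalues as coordinates on the parameter space\<close>

text \<open>Logarithms of eigenvalues, read off \<open>A\<close> itself because measurability is
  assumed of \<open>A\<close> and not of \<open>a\<close>; the indicator of \<open>D\<close> makes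
  the function total and measurable.\<close>

definition alpha :: "real^'n \<Rightarrow> real^'n" where
  "alpha u = (\<chi> i. ln \<bar>(transpose C ** (indicator D u *\<^sub>R A u) ** C) $ i $ i\<bar>)"

lemma alpha_measurable: "alpha \<in> borel_measurable lebesgue"
proof -
  have "D \<in> sets lebesgue" "A \<in> borel_measurable (restrict_space lebesgue D)"
    using family by (auto simp: measurable_family_def)
  then have m: "(\<lambda>u. indicator D u *\<^sub>R A u) \<in> borel_measurable lebesgue"
    by (subst (asm) borel_measurable_restrict_space_iff) auto
  have "(\<lambda>B. (transpose C ** B ** C) $ i $ i) \<in> borel_measurable borel" for i
    by (intro borel_measurable_continuous_onI) (simp add: matrix_matrix_mult_def continuous_intros)
  from measurable_compose[OF m this]
  show ?thesis unfolding alpha_def[abs_def]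
    by (intro borel_measurable_vec_lambda borel_measurable_ln borel_measurable_abs)
qed

lemma alpha_eq: "u \<in> D \<Longrightarrow> a u = vexp t \<Longrightarrow> alpha u = t"
  using diagonal[of u] by (simp add: alpha_def C_inverse diag_def vexp_def)

definition good :: "real^'n \<Rightarrow> bool" where
  "good t \<longleftrightarrow> b t \<in> D \<and> a (b t) = vexp t"

lemma good_alpha: "good t \<Longrightarrow> alpha (b t) = t"
  by (simp add: good_def alpha_eq)

lemma AE_good: "AE t in lebesgue. good t"
  using solution by eventually_elim (simp add: good_def vexp_def vec_eq_iff)

text \<open>The exceptional set of \<open>t\<close> is null, hence so is its image, by the
  correspondence of null sets in \<open>almost_bijective\<close>; surjectivity off a null set does
  the rest.\<close>

lemma AE_image:
  assumes "AE t in lebesgue. P t"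
  shows "AE u in lebesgue. \<exists>t. u = b t \<and> P t"
proof -
  obtain N M where NM: "N \<in> null_sets lebesgue" "M \<in> null_sets lebesgue" "bij_betw b (- N) (- M)"
    "\<And>S. S \<subseteq> - N \<Longrightarrow> b ` S \<in> null_sets lebesgue \<longleftrightarrow> S \<in> null_sets lebesgue"
    using b_bijective unfolding almost_bijective_def by blast
  define S where "S = {t. \<not> P t} - N"
  have "S \<in> null_sets lebesgue"
    using AE_lebesgue_null[OF assms] by (rule null_lebesgue_subset) (auto simp: S_def)
  then have "b ` S \<in> null_sets lebesgue" using NM(4)[of S] by (auto simp: S_def)
  then have "AE u in lebesgue. u \<notin> b ` S" "AE u in lebesgue. u \<notin> M"
    using NM(2) by (auto intro: AE_not_in)
  then show ?thesis
  proof eventually_elim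
    fix u assume u: "u \<notin> b ` S" "u \<notin> M"
    then obtain t where "t \<notin> N" "u = b t" using NM(3) unfolding bij_betw_def by blast
    with u show "\<exists>t. u = b t \<and> P t" by (auto simp: S_def)
  qed
qed

lemma AE_preimage:
  assumes "AE u in lebesgue. P u"
  shows "AE t in lebesgue. P (b t)"
proof -
  obtain N M where NM: "N \<in> null_sets lebesgue" "M \<in> null_sets lebesgue" "bij_betw b (- N) (- M)"
    "\<And>S. S \<subseteq> - N \<Longrightarrow> b ` S \<in> null_sets lebesgue \<longleftrightarrow> S \<in> null_sets lebesgue"
    using b_bijective unfolding almost_bijective_def by blast
  define S where "S = {t. \<not> P (b t)} - N"
  have "b ` S \<in> null_sets lebesgue"
    using AE_lebesgue_null[OF assms] by (rule null_lebesgue_subset) (auto simp: S_def)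
  then have "S \<in> null_sets lebesgue" using NM(4)[of S] by (auto simp: S_def)
  then have "AE t in lebesgue. t \<notin> S" "AE t in lebesgue. t \<notin> N"
    using NM(1) by (auto intro: AE_not_in)
  then show ?thesis by eventually_elim (auto simp: S_def)
qed

text \<open>Almost every \<open>u\<close> is \<open>b t\<close> for a parameter \<open>t\<close>
  that solves the eigenvalue equations, and there \<open>alpha u = t\<close>: so
  \<open>alpha\<close> inverts \<open>b\<close> almost everywhere and respects null sets.\<close>

lemma AE_alpha:
  assumes "AE t in lebesgue. P t"
  shows "AE u in lebesgue. u \<in> D \<and> a u = vexp (alpha u) \<and> b (alpha u) = u \<and> P (alpha u)"
proof -
  have "AE t in lebesgue. good t \<and> P t" using AE_good assms by eventually_elim simp
  from AE_image[OF this] show ?thesis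
    by eventually_elim (auto simp: good_alpha good_def)
qed

text \<open>\<open>p\<close> and \<open>q\<close> are Borel versions of \<open>alpha\<close> and
  \<open>b\<close>. Changing either map on a null set stays harmless after composition because both
  maps are nonsingular.\<close>

lemma borel_coordinates:
  obtains p q where "p \<in> borel_measurable borel" "q \<in> borel_measurable borel"
    "AE u in lebesgue. p u = alpha u" "AE u in lborel. q (p u) = u" "AE t in lborel. p (q t) = t"
    "\<And>S. S \<in> null_sets lborel \<Longrightarrow> AE u in lborel. p u \<notin> S"
    "\<And>S. S \<in> null_sets lborel \<Longrightarrow> AE t in lborel. q t \<notin> S"
proof -
  obtain p where p: "p \<in> borel_measurable borel" "AE u in lebesgue. alpha u = p u"
    by (rule borel_representative[OF alpha_measurable])
  obtain q where q: "q \<in> borel_measurable borel" "AE t in lebesgue. b t = q t"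
    by (rule borel_representative[OF b_measurable])
  have "AE u in lebesgue. q (p u) = u"
    using p(2) AE_alpha[OF q(2)] by eventually_elim metis
  moreover have "AE t in lebesgue. p (q t) = t"
    using q(2) AE_preimage[OF p(2)] AE_good by eventually_elim (metis good_alpha)
  moreover have "AE u in lebesgue. p u \<notin> S" if "S \<in> null_sets lborel" for S
  proof -
    have "AE t in lebesgue. t \<notin> S" using that by (intro AE_not_in null_sets_completionI)
    from p(2) AE_alpha[OF this] show ?thesis by eventually_elim simp
  qed
  moreover have "AE t in lebesgue. q t \<notin> S" if "S \<in> null_sets lborel" for S
  proof -
    have "AE u in lebesgue. u \<notin> S" using that by (intro AE_not_in null_sets_completionI)
    from q(2) AE_preimage[OF this] show ?thesis by eventually_elim simp
  qed
  moreover have "AE u in lebesgue. p u = alpha u" using p(2) by eventually_elim simp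
  ultimately show ?thesis
    using p(1) q(1) by (intro that[of p q]) (simp_all add: AE_lebesgue_iff_lborel)
qed

text \<open>For a fixed point of an open octant the dilations sweep out that octant with a positive
  density. Hence changing \<open>f\<close> on a null set alters the integrand of the Hausdorff
  operator only on a null set of parameters, for each such point separately.\<close>

lemma AE_orbit:
  assumes x: "coords x \<in> octant \<epsilon>" and P: "AE y in lebesgue. P y"
  shows "AE t in lebesgue. P (C *v dilate t (coords x))"
proof -
  have "AE y in lborel. P y" using P by (simp add: AE_lebesgue_iff_lborel)
  then obtain N where N: "{y. \<not> P y} \<subseteq> N" "emeasure lborel N = 0" "N \<in> sets borel"
    by (auto elim: AE_E)
  note [measurable] = N(3)
  have "ennreal (octant_const \<epsilon>) * (\<integral>\<^sup>+s. ennreal (exp (trace_vec s)) * indicator N (C *v oexp \<epsilon> s) \<partial>lborel)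
     = (\<integral>\<^sup>+y. indicator (octant \<epsilon>) y * indicator N (C *v y) \<partial>lborel)"
    by (subst nn_integral_octant) simp_all
  also have "\<dots> \<le> (\<integral>\<^sup>+y. indicator N (C *v y) \<partial>lborel)"
    by (intro nn_integral_mono) (simp add: indicator_def)
  also have "\<dots> = 0" using nn_integral_rotate[of "indicator N"] N by simp
  finally have "(\<integral>\<^sup>+s. ennreal (exp (trace_vec s)) * indicator N (C *v oexp \<epsilon> s) \<partial>lborel) = 0"
    using octant_const_pos[of \<epsilon>] by (simp add: ennreal_eq_0_iff not_le)
  then have "AE s in lborel. ennreal (exp (trace_vec s)) * indicator N (C *v oexp \<epsilon> s) = 0"
    by (subst (asm) nn_integral_0_iff_AE) auto
  then have "AE s in lborel. C *v oexp \<epsilon> s \<notin> N"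
    by eventually_elim (auto simp: indicator_def ennreal_eq_0_iff split: if_splits)
  then have "AE t in lborel. C *v oexp \<epsilon> (vlog (coords x) + t) \<notin> N"
    by (rule AE_lborel_translate[rotated]) measurable
  then have "AE t in lborel. P (C *v dilate t (coords x))"
    by eventually_elim (use N(1) in \<open>auto simp: oexp_add oexp_vlog[OF x]\<close>)
  then show ?thesis by (simp add: AE_lebesgue_iff_lborel)
qed

section \<open>Hausdorff kernels and L1 kernels\<close>

text \<open>A change of variables at each fixed \<open>x\<close>: with \<open>t = p u\<close> the
  matrix \<open>A u\<close> acts as the rotated dilation by \<open>exp t\<close>, and the factor
  relating \<open>K\<close> to \<open>K1\<close> is the weight in
  \<open>dilation_mean\<close>.\<close>

lemma hausdorff_operator_transfer:
  assumes p [measurable]: "p \<in> borel_measurable borel" and pa: "AE u in lebesgue. p u = alpha u"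
    and K1: "borel_L1 K1" and k: "borel_L1 k"
    and KK: "AE u in lebesgue. K u = K1 u * of_real (exp (trace_vec (p u) / 2))"
    and int: "\<And>G :: real^'n \<Rightarrow> complex. G \<in> borel_measurable borel \<Longrightarrow>
      integrable lborel (\<lambda>u. K1 u * G (p u)) \<longleftrightarrow> integrable lborel (\<lambda>t. k t * G t)"
    and eq: "\<And>G :: real^'n \<Rightarrow> complex. G \<in> borel_measurable borel \<Longrightarrow>
      (LINT u|lborel. K1 u * G (p u)) = (LINT t|lborel. k t * G t)"
  shows "is_hausdorff_operator D A K (transfer (conv_op k))"
  unfolding is_hausdorff_operator_def
proof (intro allI impI)
  fix f :: "real^'n \<Rightarrow> complex" assume f: "square_integrable f"
  obtain g where g: "borel_sqi g" "AE x in lebesgue. f x = g x" by (rule borel_sqi_representative[OF f])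
  note [measurable] = borel_L1_measurable[OF K1] borel_L1_measurable[OF k] borel_sqi_measurable[OF g(1)]
  have "abs_L2 f = abs_L2 g" using abs_L2_eq_iff[OF f borel_sqi_square_integrable[OF g(1)]] g(2) by simp
  then have "AE x in lebesgue. rep_L2 (transfer (conv_op k) (abs_L2 f)) x = dilation_mean k g x"
    using rep_abs_L2[OF borel_sqi_square_integrable[OF transfer_conv_op(2)[OF k g(1)]]]
    by (simp add: transfer_conv_op k g)
  moreover have "AE x in lebesgue. \<exists>\<delta>. \<forall>\<epsilon>. coords x \<in> octant \<epsilon> \<longleftrightarrow> \<epsilon> = \<delta>"
    using AE_coords_octant by (simp add: AE_lebesgue_iff_lborel)
  moreover have "AE x in lebesgue. integrable lborel (\<lambda>t. k t * (of_real (exp (trace_vec t / 2)) * g (C *v dilate t (coords x))))"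
    using AE_dilation_integrable[OF k g(1)] by (simp add: AE_lebesgue_iff_lborel)
  ultimately show "AE x in lebesgue. (\<lambda>u. K u * f (A u *v x)) absolutely_integrable_on D \<and>
      rep_L2 (transfer (conv_op k) (abs_L2 f)) x = (LINT u:D|lebesgue. K u * f (A u *v x))"
  proof eventually_elim
    fix x
    assume rep: "rep_L2 (transfer (conv_op k) (abs_L2 f)) x = dilation_mean k g x"
      and oct: "\<exists>\<delta>. \<forall>\<epsilon>. coords x \<in> octant \<epsilon> \<longleftrightarrow> \<epsilon> = \<delta>"
      and ki: "integrable lborel (\<lambda>t. k t * (of_real (exp (trace_vec t / 2)) * g (C *v dilate t (coords x))))"
    obtain \<epsilon> where x: "coords x \<in> octant \<epsilon>" using oct by blast
    define G :: "real^'n \<Rightarrow> complex" where "G t = of_real (exp (trace_vec t / 2)) * g (C *v dilate t (coords x))" for t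
    have [measurable]: "G \<in> borel_measurable borel" unfolding G_def by measurable
    define L where "L u = indicator D u *\<^sub>R (K u * f (A u *v x))" for u
    \<comment> \<open>\<open>AE_orbit\<close> replaces \<open>f\<close> by its Borel version along
      the orbit of this \<open>x\<close>, and \<open>AE_alpha\<close> carries the exceptional null
      set from \<open>t\<close> over to \<open>u\<close>.\<close>
    have ae: "AE u in lebesgue. L u = K1 u * G (p u)"
      using AE_alpha[OF AE_orbit[OF x g(2)]] KK pa
      by eventually_elim (auto simp: L_def G_def A_apply)
    have mL: "L \<in> borel_measurable lebesgue"
      by (rule borel_measurable_lebesgue_AE[OF _ ae]) measurable
    have mK: "(\<lambda>u. K1 u * G (p u)) \<in> borel_measurable lebesgue" by (intro measurable_completion) measurable
    have "integrable lebesgue L \<longleftrightarrow> integrable lborel (\<lambda>u. K1 u * G (p u))"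
      using integrable_cong_AE[OF mL mK ae] by (simp add: integrable_completion)
    also have "\<dots>" using int[of G] ki by (simp add: G_def)
    finally have "(\<lambda>u. K u * f (A u *v x)) absolutely_integrable_on D"
      by (simp add: set_integrable_def L_def[abs_def])
    moreover have "(LINT u:D|lebesgue. K u * f (A u *v x)) = dilation_mean k g x"
    proof -
      have "(LINT u:D|lebesgue. K u * f (A u *v x)) = (LINT u|lebesgue. L u)"
        by (simp add: set_lebesgue_integral_def L_def)
      also have "\<dots> = (LINT u|lborel. K1 u * G (p u))"
        using integral_cong_AE[OF mL mK ae] by (simp add: integral_completion)
      also have "\<dots> = dilation_mean k g x"
        using eq[of G] by (simp add: dilation_mean_def G_def)
      finally show ?thesis .
    qed
    ultimately show "(\<lambda>u. K u * f (A u *v x)) absolutely_integrable_on D \<and>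
      rep_L2 (transfer (conv_op k) (abs_L2 f)) x = (LINT u:D|lebesgue. K u * f (A u *v x))"
      using rep by simp
  qed
qed

text \<open>The determinant of \<open>A u\<close> is the exponential of the sum of the logarithmic
  eigenvalues, so the weight in \<open>L2_kernel\<close> exactly undoes the factor between
  \<open>K\<close> and \<open>K1\<close>.\<close>

lemma AE_det_weight:
  assumes pa: "AE u in lebesgue. p u = alpha u"
    and KK: "AE u in lebesgue. K u = K1 u * of_real (exp (trace_vec (p u) / 2))"
  shows "AE u in lebesgue. indicator D u *\<^sub>R (\<bar>det (A u)\<bar> powr (-1/2) *\<^sub>R K u) = (K1 u :: complex)"
proof -
  have "AE t in lebesgue. True" by simp
  from AE_alpha[OF this] pa KK show ?thesis
  proof eventually_elim
    fix u assume u: "u \<in> D \<and> a u = vexp (alpha u) \<and> b (alpha u) = u \<and> True" and "p u = alpha u"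
      and K: "K u = K1 u * of_real (exp (trace_vec (p u) / 2))"
    then have "\<bar>det (A u)\<bar> powr (-1/2) = exp (- trace_vec (p u) / 2)"
      using A_det[of u "p u"] by (simp add: powr_def)
    moreover have "of_real (exp (- trace_vec (p u) / 2)) * (of_real (exp (trace_vec (p u) / 2)) :: complex) = 1"
      by (simp add: of_real_mult[symmetric] exp_add[symmetric] del: of_real_mult)
    ultimately show "indicator D u *\<^sub>R (\<bar>det (A u)\<bar> powr (-1/2) *\<^sub>R K u) = K1 u"
      using u K by (simp add: scaleR_conv_of_real mult_ac)
  qed
qed

text \<open>The determinant weight turns \<open>K\<close> into an integrable function of
  \<open>u\<close>, which is then transported along \<open>p\<close> to the logarithmic
  coordinates.\<close>

lemma L2_kernel_transfer:
  assumes K: "L2_kernel D A K"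
  obtains k where "borel_L1 k" "is_hausdorff_operator D A K (transfer (conv_op k))"
proof -
  obtain p q where p: "p \<in> borel_measurable borel" "q \<in> borel_measurable borel"
    "AE u in lebesgue. p u = alpha u" "AE u in lborel. q (p u) = u" "AE t in lborel. p (q t) = t"
    "\<And>S. S \<in> null_sets lborel \<Longrightarrow> AE u in lborel. p u \<notin> S"
    "\<And>S. S \<in> null_sets lborel \<Longrightarrow> AE t in lborel. q t \<notin> S"
    by (rule borel_coordinates) blast
  have "K \<in> borel_measurable lebesgue" using K by (simp add: L2_kernel_def)
  then obtain K0 where K0: "K0 \<in> borel_measurable borel" "AE u in lebesgue. K u = K0 u"
    by (rule borel_representative)
  note [measurable] = p(1) K0(1)
  define K1 where "K1 u = K0 u * of_real (exp (- trace_vec (p u) / 2))" for u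
  have m1 [measurable]: "K1 \<in> borel_measurable borel" unfolding K1_def by measurable
  have inv: "of_real (exp (- trace_vec (p u) / 2)) * (of_real (exp (trace_vec (p u) / 2)) :: complex) = 1" for u
    by (simp add: of_real_mult[symmetric] exp_add[symmetric] del: of_real_mult)
  have KK: "AE u in lebesgue. K u = K1 u * of_real (exp (trace_vec (p u) / 2))"
    using K0(2) by eventually_elim (simp only: K1_def mult.assoc inv mult_1_right)
  note ae = AE_det_weight[OF p(3) KK]
  have "integrable lebesgue (\<lambda>u. indicator D u *\<^sub>R (\<bar>det (A u)\<bar> powr (-1/2) *\<^sub>R K u))"
    using K by (simp add: L2_kernel_def set_integrable_def)
  then have "integrable lebesgue K1"
    using integrable_cong_AE[OF borel_measurable_integrable _ ae] m1 by (simp add: measurable_completion)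
  then have K1: "borel_L1 K1" using m1 by (simp add: borel_L1_def integrable_completion)
  show ?thesis
  proof (rule transport_kernel[OF K1 p(1,2,4) p(6)])
    fix k assume "borel_L1 k"
      "\<And>G :: real^'n \<Rightarrow> complex. G \<in> borel_measurable borel \<Longrightarrow> integrable lborel (\<lambda>u. K1 u * G (p u)) \<longleftrightarrow> integrable lborel (\<lambda>t. k t * G t)"
      "\<And>G :: real^'n \<Rightarrow> complex. G \<in> borel_measurable borel \<Longrightarrow> (LINT u|lborel. K1 u * G (p u)) = (LINT t|lborel. k t * G t)"
    then show ?thesis
      using hausdorff_operator_transfer[OF p(1) p(3) K1 _ KK] by (intro that) blast+
  qed
qed

text \<open>The reverse passage, along \<open>q\<close>: an L1 kernel is carried to the parameter
  space and the determinant weight is put back.\<close>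

lemma transfer_is_hausdorff:
  assumes k: "borel_L1 k"
  obtains K where "L2_kernel D A K" "is_hausdorff_operator D A K (transfer (conv_op k))"
proof -
  obtain p q where p: "p \<in> borel_measurable borel" "q \<in> borel_measurable borel"
    "AE u in lebesgue. p u = alpha u" "AE u in lborel. q (p u) = u" "AE t in lborel. p (q t) = t"
    "\<And>S. S \<in> null_sets lborel \<Longrightarrow> AE u in lborel. p u \<notin> S"
    "\<And>S. S \<in> null_sets lborel \<Longrightarrow> AE t in lborel. q t \<notin> S"
    by (rule borel_coordinates) blast
  obtain K1 where K1: "borel_L1 K1"
    "\<And>G :: real^'n \<Rightarrow> complex. G \<in> borel_measurable borel \<Longrightarrow> integrable lborel (\<lambda>t. k t * G (q t)) \<longleftrightarrow> integrable lborel (\<lambda>u. K1 u * G u)"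
    "\<And>G :: real^'n \<Rightarrow> complex. G \<in> borel_measurable borel \<Longrightarrow> (LINT t|lborel. k t * G (q t)) = (LINT u|lborel. K1 u * G u)"
    by (rule transport_kernel[OF k p(2,1,5) p(7)]) (assumption, rule that)
  note [measurable] = p(1,2) borel_L1_measurable[OF k] borel_L1_measurable[OF K1(1)]
  define K where "K u = K1 u * of_real (exp (trace_vec (p u) / 2))" for u
  have [measurable]: "K \<in> borel_measurable borel" unfolding K_def by measurable
  have mK: "K \<in> borel_measurable lebesgue" by (intro measurable_completion) measurable
  have KK: "AE u in lebesgue. K u = K1 u * of_real (exp (trace_vec (p u) / 2))" by (simp add: K_def)
  note ae = AE_det_weight[OF p(3) KK]
  have m1: "K1 \<in> borel_measurable borel" by measurable
  have "integrable lebesgue (\<lambda>u. indicator D u *\<^sub>R (\<bar>det (A u)\<bar> powr (-1/2) *\<^sub>R K u))"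
  proof (subst integrable_cong_AE[OF _ _ ae])
    show "(\<lambda>u. indicator D u *\<^sub>R (\<bar>det (A u)\<bar> powr (-1/2) *\<^sub>R K u)) \<in> borel_measurable lebesgue"
      by (rule borel_measurable_lebesgue_AE[OF m1 ae])
    show "K1 \<in> borel_measurable lebesgue" by (intro measurable_completion) measurable
    show "integrable lebesgue K1" using K1(1) by (simp add: borel_L1_def integrable_completion)
  qed
  moreover have "AE u in lebesgue. K u \<noteq> 0 \<longrightarrow> u \<in> D \<and> det (A u) \<noteq> 0"
  proof -
    have "AE t in lebesgue. True" by simp
    from AE_alpha[OF this] show ?thesis
      by eventually_elim (auto simp: A_det)
  qed
  ultimately have "L2_kernel D A K" using mK by (simp add: L2_kernel_def set_integrable_def)
  moreover have "is_hausdorff_operator D A K (transfer (conv_op k))"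
  proof (rule hausdorff_operator_transfer[OF p(1) p(3) K1(1) k KK])
    \<comment> \<open>The transport ran along \<open>q\<close>; testing it on
      \<open>G \<circ> p\<close> and cancelling \<open>p (q t) = t\<close> gives the identities
      along \<open>p\<close> that are required.\<close>
    fix G :: "real^'n \<Rightarrow> complex" assume [measurable]: "G \<in> borel_measurable borel"
    have ae: "AE t in lborel. k t * G (p (q t)) = k t * G t" using p(5) by eventually_elim simp
    have "integrable lborel (\<lambda>t. k t * G (p (q t))) \<longleftrightarrow> integrable lborel (\<lambda>t. k t * G t)"
      using ae by (intro integrable_cong_AE) measurable
    then show "integrable lborel (\<lambda>u. K1 u * G (p u)) \<longleftrightarrow> integrable lborel (\<lambda>t. k t * G t)"
      using K1(2)[of "\<lambda>u. G (p u)"] by simp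
    have "(LINT t|lborel. k t * G (p (q t))) = (LINT t|lborel. k t * G t)"
      using ae by (intro integral_cong_AE) measurable
    then show "(LINT u|lborel. K1 u * G (p u)) = (LINT t|lborel. k t * G t)"
      using K1(3)[of "\<lambda>u. G (p u)"] by simp
  qed
  ultimately show ?thesis by (rule that)
qed

end

section \<open>The functional calculus of a Hausdorff operator\<close>

lemma bounded_linear_conv_alg_op: "bounded_linear conv_alg_op"
proof
  fix x y :: "'a conv_alg" and r
  show "conv_alg_op (x + y) = conv_alg_op x + conv_alg_op y" by (rule plus_conv_alg.rep_eq)
  show "conv_alg_op (r *\<^sub>R x) = r *\<^sub>R conv_alg_op x" by (rule scaleR_conv_alg.rep_eq)
  show "\<exists>K. \<forall>x :: 'a conv_alg. norm (conv_alg_op x) \<le> norm x * K"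
    by (intro exI[of _ 1] allI) (simp add: norm_conv_alg_op_le)
qed

lemma is_hausdorff_operator_unique:
  fixes S T :: "(real^'n) L2 \<Rightarrow>\<^sub>L (real^'n) L2"
  assumes S: "is_hausdorff_operator D A K S" and T: "is_hausdorff_operator D A K T"
  shows "S = T"
proof (rule blinfun_L2_eqI)
  fix f :: "real^'n \<Rightarrow> complex" assume "borel_sqi f"
  then have f: "square_integrable f" by (rule borel_sqi_square_integrable)
  have "AE x in lebesgue. rep_L2 (S (abs_L2 f)) x = rep_L2 (T (abs_L2 f)) x"
    using S[unfolded is_hausdorff_operator_def, rule_format, OF f] T[unfolded is_hausdorff_operator_def, rule_format, OF f]
    by eventually_elim simp
  then have "abs_L2 (rep_L2 (S (abs_L2 f))) = abs_L2 (rep_L2 (T (abs_L2 f)))"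
    by (simp only: abs_L2_eq_iff rep_L2_square_integrable)
  then show "S (abs_L2 f) = T (abs_L2 f)" by simp
qed

lemma hausdorff_operator_eq: "is_hausdorff_operator D A K T \<Longrightarrow> hausdorff_operator D A K = T"
  unfolding hausdorff_operator_def by (rule the_equality) (auto intro: is_hausdorff_operator_unique)

lemma is_resolvent_unique:
  assumes "is_resolvent T z R" "is_resolvent T z S"
  shows "R = S"
proof (rule blinfun_eqI)
  fix F
  have "(scaleC_blinfun z - T) (S F) = F"
    using assms(2) unfolding is_resolvent_def by (metis blinfun_apply_blinfun_compose blinfun_apply_id_blinfun)
  moreover have "R ((scaleC_blinfun z - T) (S F)) = S F"
    using assms(1) unfolding is_resolvent_def by (metis blinfun_apply_blinfun_compose blinfun_apply_id_blinfun)
  ultimately show "R F = S F" by simp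
qed

lemma resolvent_eq: "is_resolvent T z R \<Longrightarrow> resolvent T z = R"
  unfolding resolvent_def by (rule the_equality) (auto intro: is_resolvent_unique)

section \<open>The algebra represented on L2 of the original space\<close>

context rotation
begin

definition rep_op :: "(real^'n) conv_alg \<Rightarrow> (real^'n) L2 \<Rightarrow>\<^sub>L (real^'n) L2" where
  "rep_op x = transfer (conv_alg_op x)"

lemma bounded_linear_rep_op: "bounded_linear rep_op"
  unfolding rep_op_def[abs_def]
  by (rule bounded_linear_compose[OF bounded_linear_transfer bounded_linear_conv_alg_op])

lemma rep_op_mult: "rep_op (x * y) = rep_op x o\<^sub>L rep_op y"
  by (simp add: rep_op_def times_conv_alg.rep_eq transfer_compose)

lemma rep_op_1: "rep_op 1 = id_blinfun"
  by (simp add: rep_op_def one_conv_alg.rep_eq transfer_id)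

lemma rep_op_scal: "rep_op (scal z) = scaleC_blinfun z"
  by (simp add: rep_op_def conv_alg_op_scal transfer_scaleC)

lemma rep_op_diff: "rep_op (x - y) = rep_op x - rep_op y"
  by (rule linear_diff[OF bounded_linear.linear[OF bounded_linear_rep_op]])

lemma rep_op_conv_elem: "borel_L1 k \<Longrightarrow> rep_op (conv_elem 0 k) = transfer (conv_op k)"
  by (simp add: rep_op_def conv_alg_op_conv_elem affine_conv_def)

lemma is_resolvent_rep_op:
  assumes "z \<in> res_set h"
  shows "is_resolvent (rep_op h) z (rep_op (inv_res h z))"
  using inv_res[OF assms]
  by (simp add: is_resolvent_def rep_op_scal[symmetric] rep_op_diff[symmetric] rep_op_mult[symmetric] rep_op_1
      mult.commute[of "inv_res h z"])

text \<open>A bounded inverse on one octant makes the convolution operator bounded below, so it is already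
  invertible in the convolution algebra.\<close>

lemma spectrum_rep_op: "spectrum (rep_op h) = - res_set h"
proof -
  have "z \<in> res_set h" if R: "is_resolvent (rep_op h) z R" for z R
  proof -
    define x where "x = scal z - h"
    have Rx: "R o\<^sub>L rep_op x = id_blinfun"
      using R by (simp add: is_resolvent_def x_def rep_op_diff rep_op_scal)
    \<comment> \<open>The empty set indexes the positive octant, into which vectors are embedded
      isometrically. The added 1 keeps the denominator positive.\<close>
    have "1 / (norm R + 1) * norm G \<le> norm (conv_alg_op x G)" for G
    proof -
      let ?J = "from_log_op {}"
      have "rep_op x (?J G) = ?J (conv_alg_op x G)" by (simp add: rep_op_def transfer_from_log)
      then have "R (?J (conv_alg_op x G)) = ?J G"
        using arg_cong[OF Rx, of "\<lambda>T. blinfun_apply T (?J G)"] by simp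
      then have "norm G \<le> norm R * norm (conv_alg_op x G)"
        using norm_blinfun[of R "?J (conv_alg_op x G)"] by (simp add: norm_from_log_op)
      also have "\<dots> \<le> (norm R + 1) * norm (conv_alg_op x G)" by (intro mult_right_mono) auto
      finally have "norm G \<le> (norm R + 1) * norm (conv_alg_op x G)" .
      moreover have "0 < norm R + 1" by (simp add: add_nonneg_pos)
      ultimately show ?thesis by (simp add: pos_divide_le_eq mult.commute)
    qed
    moreover have "0 < 1 / (norm R + 1)" by (simp add: add_nonneg_pos)
    ultimately obtain y where "x * y = 1" using conv_alg_invertible[of "1 / (norm R + 1)" x] by blast
    then show ?thesis by (auto simp: res_set_def x_def)
  qed
  then show ?thesis using is_resolvent_rep_op unfolding spectrum_def by blast
qed

text \<open>A bounded linear homomorphism commutes with the integral, so the integral in the algebra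
  norm computes the one in operator norm once resolvents are matched along the contour.\<close>

lemma has_holomorphic_calculus_rep_op:
  assumes \<Gamma>: "neighbourhood_boundary (- res_set h) E \<Gamma>" and E: "open E" and F: "F holomorphic_on E"
  shows "has_holomorphic_calculus F (rep_op h) \<Gamma> (rep_op (conv_calculus F h \<Gamma>))"
proof -
  interpret rep_op: bounded_linear rep_op by (rule bounded_linear_rep_op)
  have int: "(calculus_integrand F (rep_op h) \<gamma> has_integral rep_op (integral {0..1} (conv_integrand F h \<gamma>))) {0..1}"
    if g: "\<gamma> \<in> set \<Gamma>" for \<gamma>
  proof (rule has_integral_eq)
    show "((rep_op \<circ> conv_integrand F h \<gamma>) has_integral rep_op (integral {0..1} (conv_integrand F h \<gamma>))) {0..1}"
      by (rule has_integral_linear[OF integrable_integral[OF conv_calculus_integrable[OF \<Gamma> E F g]] bounded_linear_rep_op])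
    fix t :: real assume "t \<in> {0..1}"
    then have "\<gamma> t \<in> path_image \<gamma>" by (simp add: path_image_def)
    then have "\<gamma> t \<in> res_set h" using neighbourhood_boundary_paths(3)[OF \<Gamma> g] by blast
    then have "resolvent (rep_op h) (\<gamma> t) = rep_op (inv_res h (\<gamma> t))"
      by (intro resolvent_eq is_resolvent_rep_op)
    then show "(rep_op \<circ> conv_integrand F h \<gamma>) t = calculus_integrand F (rep_op h) \<gamma> t"
      by (simp add: calculus_integrand_def conv_integrand_def rep_op_mult rep_op_scal)
  qed
  have "(\<Sum>\<gamma>\<leftarrow>\<Delta>. integral {0..1} (calculus_integrand F (rep_op h) \<gamma>))
      = rep_op (\<Sum>\<gamma>\<leftarrow>\<Delta>. integral {0..1} (conv_integrand F h \<gamma>))" if "set \<Delta> \<subseteq> set \<Gamma>" for \<Delta>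
    using that by (induct \<Delta>) (auto simp: rep_op.zero rep_op.add integral_unique[OF int])
  then show ?thesis
    unfolding has_holomorphic_calculus_def conv_calculus_def rep_op_mult rep_op_scal
    using int by (auto simp: has_integral_integrable)
qed

end

theorem theorem5:
  fixes D :: "(real^'n) set"
    and A :: "real^'n \<Rightarrow> real^'n^'n"
    and C :: "real^'n^'n"
    and a b :: "real^'n \<Rightarrow> real^'n"
    and K :: "real^'n \<Rightarrow> complex"
    and E :: "complex set"
    and F :: "complex \<Rightarrow> complex"
  assumes "measurable_family D A"
    and "\<And>u. u \<in> D \<Longrightarrow> transpose (A u) = A u"
    and "\<And>u v. u \<in> D \<Longrightarrow> v \<in> D \<Longrightarrow> A u ** A v = A v ** A u"
    and "\<And>u. u \<in> D \<Longrightarrow> positive_definite (A u)"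
    and "orthogonal_matrix C"
    and "\<And>u. u \<in> D \<Longrightarrow> matrix_inv C ** A u ** C = diag (a u)"
    and "AE t in lebesgue. b t \<in> D \<and> (\<forall>k. a (b t) $ k = exp (t $ k)) \<and>
           (\<forall>u\<in>D. (\<forall>k. a u $ k = exp (t $ k)) \<longrightarrow> u = b t)"
    and "b \<in> borel_measurable lebesgue"
    and "almost_bijective b"
    and "\<And>S. compact S \<Longrightarrow> K absolutely_integrable_on S"
    and "L2_kernel D A K"
    and "open E"
    and "spectrum (hausdorff_operator D A K) \<subseteq> E"
    and "F holomorphic_on E"
    and "F 0 = 0"
  shows "\<exists>K\<^sub>F. L2_kernel D A K\<^sub>F \<and>
           (\<forall>\<Gamma>. neighbourhood_boundary (spectrum (hausdorff_operator D A K)) E \<Gamma> \<longrightarrow>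
              (\<exists>R. has_holomorphic_calculus F (hausdorff_operator D A K) \<Gamma> R \<and>
                   is_hausdorff_operator D A K\<^sub>F R))"
proof -
  have sol: "AE t in lebesgue. b t \<in> D \<and> (\<forall>k. a (b t) $ k = exp (t $ k))"
    using assms(7) by eventually_elim simp
  interpret hausdorff_family C D A a b
    by unfold_locales (fact assms(5) assms(1) assms(6) sol assms(8) assms(9))+
  obtain k where k: "borel_L1 k" "is_hausdorff_operator D A K (transfer (conv_op k))"
    using L2_kernel_transfer[OF assms(11)] by blast
  define h where "h = conv_elem 0 k"
  have H: "hausdorff_operator D A K = rep_op h"
    using hausdorff_operator_eq[OF k(2)] by (simp add: h_def rep_op_conv_elem k)
  have sub: "- res_set h \<subseteq> E" using assms(13) by (simp add: H spectrum_rep_op)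
  have char: "conv_char h = 0" by (simp add: h_def conv_char_conv_elem k)
  show ?thesis
  proof (cases "\<exists>\<Gamma>. neighbourhood_boundary (- res_set h) E \<Gamma>")
    \<comment> \<open>With no admissible contour there is nothing to represent, and the zero kernel
      serves.\<close>
    case False
    have "L2_kernel D A (\<lambda>u. 0)" by (simp add: L2_kernel_def)
    with False show ?thesis by (auto simp: H spectrum_rep_op)
  next
    case True
    \<comment> \<open>The kernel is constructed from one contour;
      \<open>conv_calculus_unique\<close> shows that it represents the integral over every other
      one.\<close>
    then obtain \<Gamma> where \<Gamma>: "neighbourhood_boundary (- res_set h) E \<Gamma>" by blast
    obtain l where l: "borel_L1 l" "conv_calculus F h \<Gamma> = conv_elem 0 l"
      using conv_calculus_kernel[OF \<Gamma> assms(12,14,15) char sub] by blast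
    obtain K\<^sub>F where K\<^sub>F: "L2_kernel D A K\<^sub>F" "is_hausdorff_operator D A K\<^sub>F (transfer (conv_op l))"
      using transfer_is_hausdorff[OF l(1)] by blast
    have "has_holomorphic_calculus F (rep_op h) \<Delta> (transfer (conv_op l))"
      if \<Delta>: "neighbourhood_boundary (- res_set h) E \<Delta>" for \<Delta>
      using has_holomorphic_calculus_rep_op[OF \<Delta> assms(12,14)] l
        conv_calculus_unique[OF \<Delta> \<Gamma> assms(12,14)]
      by (simp add: rep_op_conv_elem)
    with K\<^sub>F show ?thesis by (auto simp: H spectrum_rep_op)
  qed
qed

end
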